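(* Let $\mathcal{D}$ be a domain in the vertical plane $\mathbb{R}^2\ni \mathbf{x}=(x,z)$ or in $\mathbb{R}^3\ni\mathbf{x}=(x,y,z)$ (compact, connected, with smooth boundary $\partial\mathcal{D}$), endowed with a volume form $\mu$. Let $\bar\rho(z)>0$ and $\bar\theta(z)>0$ be smooth reference density and reference potential temperature, let $g,c_p>0$ be constants, and let $\bar\pi(z)$ be a smooth function with $c_p\,\bar\theta\,\frac{d\bar\pi}{dz}=-g$. The anelastic system with reference density $\bar\rho$, respectively the pseudo-incompressible system with reference density $\bar\rho$ and reference potential temperature $\bar\theta$, can be derived from an Euler-Poincaré variational principle for the Lie group $G=\operatorname{Diff}_{\bar\rho\mu}(\mathcal{D})$, respectively $G=\operatorname{Diff}_{\bar\rho\bar\theta\mu}(\mathcal{D})$. Precisely: (1) (Anelastic) Put $\bar\sigma=\bar\rho$ and $$\ell(\mathbf{u},\theta)=\int_{\mathcal{D}}\Big(\tfrac12|\mathbf{u}|^2-c_p\bar\pi\,\theta\Big)\bar\rho\,\mu,\qquad \mathbf{u}\in\mathfrak{X}_{\bar\rho\mu}(\mathcal{D}).$$ Let $\varphi(t,\cdot)\in\operatorname{Diff}_{\bar\rho\mu}(\mathcal{D})$, $t\in[0,T]$, be a smooth curve and $\Theta_0$ a smooth function on $\mathcal{D}$, and let $\mathbf{u},\theta$ be given by $\mathbf{u}(t,\varphi(t,X))=\dot\varphi(t,X)$, $\theta(t,\varphi(t,X))=\Theta_0(X)$. If $(\mathbf{u},\theta)$ satisfies the Euler-Poincaré variational principle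 for $\ell$ on $\operatorname{Diff}_{\bar\rho\mu}(\mathcal{D})$, then there is a function $\pi'(t,\mathbf{x})$ such that, with $\theta'=\theta-\bar\theta$, $$\partial_t\mathbf{u}+\mathbf{u}\cdot\nabla\mathbf{u}+\nabla(c_p\bar\theta\pi')=g\frac{\theta'}{\bar\theta}\mathbf{z},\qquad \operatorname{div}_\mu(\bar\rho\mathbf{u})=0,\qquad \partial_t\theta+\mathbf{u}\cdot\nabla\theta=0.$$ (2) (Pseudo-incompressible) Put $\bar\sigma=\bar\rho\bar\theta$ and $$\ell(\mathbf{u},\theta)=\int_{\mathcal{D}}\frac1\theta\Big(\tfrac12|\mathbf{u}|^2-gz\Big)\bar\rho\bar\theta\,\mu,\qquad \mathbf{u}\in\mathfrak{X}_{\bar\rho\bar\theta\mu}(\mathcal{D}).$$ Let $\varphi(t,\cdot)\in\operatorname{Diff}_{\bar\rho\bar\theta\mu}(\mathcal{D})$, $t\in[0,T]$, be a smooth curve and $\Theta_0>0$ a smooth function on $\mathcal{D}$, and let $\mathbf{u},\theta$ be given by $\mathbf{u}(t,\varphi(t,X))=\dot\varphi(t,X)$, $\theta(t,\varphi(t,X))=\Theta_0(X)$. If $(\mathbf{u},\theta)$ satisfies the Euler-Poincaré variational principle for $\ell$ on $\operatorname{Diff}_{\bar\rho\bar\theta\mu}(\mathcal{D})$, then there is a function $\pi'(t,\mathbf{x})$ such that, with $\theta'=\theta-\bar\theta$, $$\partial_t\mathbf{u}+\mathbf{u}\cdot\nabla\mathbf{u}+c_p\theta\nabla\pi'=g\frac{\theta'}{\bar\theta}\mathbf{z},\qquad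 \operatorname{div}_\mu(\bar\rho\bar\theta\mathbf{u})=0,\qquad \partial_t\theta+\mathbf{u}\cdot\nabla\theta=0.$$
   Context: $\mathbf{z}$ is the upward vertical unit vector; $|\cdot|$, $\nabla$ are the Euclidean norm and gradient (with $\mathbf{u}\cdot\nabla\mathbf{u}$ the usual directional derivative). All objects are smooth. For a volume form $\nu$ on $\mathcal{D}$, $\operatorname{div}_\nu(\mathbf{u})$ is the function defined by $\pounds_{\mathbf{u}}\nu=\operatorname{div}_\nu(\mathbf{u})\,\nu$, where $\pounds_{\mathbf{u}}$ is the Lie derivative. $\operatorname{Diff}_\nu(\mathcal{D})$ is the group of smooth diffeomorphisms $\varphi:\mathcal{D}\to\mathcal{D}$ with $\varphi^*\nu=\nu$; its (formal) Lie algebra is $\mathfrak{X}_\nu(\mathcal{D})=\{\mathbf{u}\in\mathfrak{X}(\mathcal{D}) : \operatorname{div}_\nu(\mathbf{u})=0,\ \mathbf{u}\text{ tangent to }\partial\mathcal{D}\}$. One has $\mathbf{u}\in\mathfrak{X}_{\bar\sigma\mu}(\mathcal{D})$ iff $\operatorname{div}_\mu(\bar\sigma\mathbf{u})=0$ and $\mathbf{u}$ is tangent to $\partial\mathcal{D}$. Integrals over $\mathcal{D}$ are taken with the orientation defined by $\mu$. Euler-Poincaré variational principle for $\ell$ on $\operatorname{Diff}_{\bar\sigma\mu}(\mathcal{D})$: the pair $(\mathbf{u}(t),\theta(t))$, with $\mathbf{u}(t)\in\mathfrak{X}_{\bar\sigma\mu}(\mathcal{D})$, satisfies $$\delta\int_0^T\ell(\mathbf{u},\theta)\,dt=0$$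 for all variations of the form $\delta\mathbf{u}=\partial_t\mathbf{v}+[\mathbf{u},\mathbf{v}]$, $\delta\theta=-\mathbf{d}\theta\cdot\mathbf{v}$, where $\mathbf{v}(t,\cdot)\in\mathfrak{X}_{\bar\sigma\mu}(\mathcal{D})$ is an arbitrary smooth time-dependent vector field with $\mathbf{v}(0,\cdot)=\mathbf{v}(T,\cdot)=0$, and $[\mathbf{u},\mathbf{v}]^i=u^j\partial_jv^i-v^j\partial_ju^i$. (The first variation $\delta\int\ell$ means the derivative of the functional at $(\mathbf{u},\theta)$ in the direction $(\delta\mathbf{u},\delta\theta)$.) This is the Eulerian form of Hamilton's principle for curves $\varphi(t)$ in $\operatorname{Diff}_{\bar\sigma\mu}(\mathcal{D})$. *)

theory Defs
  imports "HOL-Analysis.Analysis"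
begin

text \<open>
  All derivatives are taken within the set on which the function lives, so that only the values on
  that set matter. Every set used below (a domain \<open>D\<close> with smooth boundary, \<open>{0..T} \<times> D\<close>, a
  nondegenerate interval, an open set) contains a nondegenerate cone at each of its points, hence
  derivatives within it are unique; on such sets being smooth in the sense below is the same as
  having a smooth extension to a neighbourhood.
\<close>

primrec C_k_on :: "nat \<Rightarrow> 'a::real_normed_vector set \<Rightarrow> ('a \<Rightarrow> 'b::real_normed_vector) \<Rightarrow> bool" where
  "C_k_on 0 S f \<longleftrightarrow> continuous_on S f"
| "C_k_on (Suc n) S f \<longleftrightarrow> f differentiable_on S \<and>
     (\<forall>v. C_k_on n S (\<lambda>x. frechet_derivative f (at x within S) v))"

definition smooth_on :: "'a::real_normed_vector set \<Rightarrow> ('a \<Rightarrow> 'b::real_normed_vector) \<Rightarrow> bool" where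
  "smooth_on S f \<longleftrightarrow> (\<forall>n. C_k_on n S f)"

definition grad_within :: "(real^'n) set \<Rightarrow> (real^'n \<Rightarrow> real) \<Rightarrow> real^'n \<Rightarrow> real^'n" where
  "grad_within D f x = (\<chi> i. frechet_derivative f (at x within D) (axis i 1))"

definition boundary_defining ::
  "(real^'n) set \<Rightarrow> real^'n \<Rightarrow> (real^'n) set \<Rightarrow> (real^'n \<Rightarrow> real) \<Rightarrow> bool" where
  "boundary_defining D p U h \<longleftrightarrow> open U \<and> p \<in> U \<and> smooth_on U h \<and>
     D \<inter> U = {x\<in>U. h x \<le> 0} \<and> frechet_derivative h (at p) \<noteq> (\<lambda>_. 0)"

definition smooth_domain :: "(real^'n) set \<Rightarrow> bool" where
  "smooth_domain D \<longleftrightarrow> D \<noteq> {} \<and> compact D \<and> connected D \<and>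
     (\<forall>p\<in>frontier D. \<exists>U h. boundary_defining D p U h)"

text \<open>The tangent space of the boundary at \<open>p\<close> is the kernel of the differential of any local
  defining function; these differentials are all proportional.\<close>

definition tangent_to_boundary :: "(real^'n) set \<Rightarrow> (real^'n \<Rightarrow> real^'n) \<Rightarrow> bool" where
  "tangent_to_boundary D u \<longleftrightarrow> (\<forall>p\<in>frontier D. \<forall>U h.
     boundary_defining D p U h \<longrightarrow> frechet_derivative h (at p) (u p) = 0)"

text \<open>A form of degree \<open>n\<close> on a subset of \<open>real^'n\<close>, where \<open>n = CARD('n)\<close>, takes a point and a tuple
  \<open>V\<close> of \<open>n\<close> vectors; the \<open>i\<close>-th vector is \<open>V $ i\<close>. The tuple \<open>mat 1\<close> is the standard basis.\<close>

type_synonym 'n top_form = "real^'n \<Rightarrow> (real^'n)^'n \<Rightarrow> real"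

definition replace_vec :: "(real^'n)^'n \<Rightarrow> 'n \<Rightarrow> real^'n \<Rightarrow> (real^'n)^'n" where
  "replace_vec V i w = (\<chi> j. if j = i then w else V $ j)"

definition alternating_multilinear :: "((real^'n)^'n \<Rightarrow> real) \<Rightarrow> bool" where
  "alternating_multilinear \<omega> \<longleftrightarrow>
     (\<forall>V i. linear (\<lambda>w. \<omega> (replace_vec V i w))) \<and>
     (\<forall>V i j. i \<noteq> j \<longrightarrow> V $ i = V $ j \<longrightarrow> \<omega> V = 0)"

definition volume_form :: "(real^'n) set \<Rightarrow> 'n top_form \<Rightarrow> bool" where
  "volume_form D \<nu> \<longleftrightarrow>
     (\<forall>x\<in>D. alternating_multilinear (\<nu> x)) \<and>
     (\<forall>V. smooth_on D (\<lambda>x. \<nu> x V)) \<and>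
     (\<forall>x\<in>D. \<exists>V. \<nu> x V \<noteq> 0)"

definition scale_form :: "(real^'n \<Rightarrow> real) \<Rightarrow> 'n top_form \<Rightarrow> 'n top_form" where
  "scale_form f \<nu> = (\<lambda>x V. f x * \<nu> x V)"

definition pullback_form ::
  "(real^'n) set \<Rightarrow> (real^'n \<Rightarrow> real^'n) \<Rightarrow> 'n top_form \<Rightarrow> 'n top_form" where
  "pullback_form D \<phi> \<nu> =
     (\<lambda>x V. \<nu> (\<phi> x) (\<chi> i. frechet_derivative \<phi> (at x within D) (V $ i)))"

text \<open>The Lie derivative of a covariant tensor field in Cartesian coordinates:
  \<open>(L\<^sub>u \<nu>)\<^sub>x (V\<^sub>1, \<dots>, V\<^sub>n) = D(\<nu>(V\<^sub>1, \<dots>, V\<^sub>n))\<^sub>x (u x) + (\<Sum>i. \<nu>\<^sub>x (V\<^sub>1, \<dots>, Du\<^sub>x V\<^sub>i, \<dots>, V\<^sub>n))\<close>.\<close>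

definition lie_derivative ::
  "(real^'n) set \<Rightarrow> (real^'n \<Rightarrow> real^'n) \<Rightarrow> 'n top_form \<Rightarrow> 'n top_form" where
  "lie_derivative D u \<nu> = (\<lambda>x V.
     frechet_derivative (\<lambda>y. \<nu> y V) (at x within D) (u x) +
     (\<Sum>i\<in>UNIV. \<nu> x (replace_vec V i (frechet_derivative u (at x within D) (V $ i)))))"

definition divergence ::
  "(real^'n) set \<Rightarrow> 'n top_form \<Rightarrow> (real^'n \<Rightarrow> real^'n) \<Rightarrow> real^'n \<Rightarrow> real" where
  "divergence D \<nu> u x = (THE c. \<forall>V. lie_derivative D u \<nu> x V = c * \<nu> x V)"

text \<open>Integral over \<open>D\<close> of the form \<open>\<omega>\<close>, with \<open>D\<close> oriented by \<open>\<mu>\<close>: the standard basis is positively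
  oriented where \<open>\<mu> x (mat 1) > 0\<close>.\<close>

definition form_integral :: "(real^'n) set \<Rightarrow> 'n top_form \<Rightarrow> 'n top_form \<Rightarrow> real" where
  "form_integral D \<mu> \<omega> = (LINT x:D|lborel. sgn (\<mu> x (mat 1)) * \<omega> x (mat 1))"

definition Diff_vol :: "(real^'n) set \<Rightarrow> 'n top_form \<Rightarrow> (real^'n \<Rightarrow> real^'n) set" where
  "Diff_vol D \<nu> = {\<phi>. bij_betw \<phi> D D \<and> smooth_on D \<phi> \<and> smooth_on D (inv_into D \<phi>) \<and>
     (\<forall>x\<in>D. \<forall>V. pullback_form D \<phi> \<nu> x V = \<nu> x V)}"

definition X_vol :: "(real^'n) set \<Rightarrow> 'n top_form \<Rightarrow> (real^'n \<Rightarrow> real^'n) set" where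
  "X_vol D \<nu> = {u. smooth_on D u \<and> (\<forall>x\<in>D. divergence D \<nu> u x = 0) \<and> tangent_to_boundary D u}"

definition bracket ::
  "(real^'n) set \<Rightarrow> (real^'n \<Rightarrow> real^'n) \<Rightarrow> (real^'n \<Rightarrow> real^'n) \<Rightarrow> real^'n \<Rightarrow> real^'n" where
  "bracket D u v x =
     frechet_derivative v (at x within D) (u x) - frechet_derivative u (at x within D) (v x)"

definition time_smooth ::
  "(real^'n) set \<Rightarrow> real \<Rightarrow> (real \<Rightarrow> real^'n \<Rightarrow> 'b::real_normed_vector) \<Rightarrow> bool" where
  "time_smooth D T f \<longleftrightarrow> smooth_on ({0..T} \<times> D) (\<lambda>(t, x). f t x)"

definition time_deriv ::
  "real \<Rightarrow> (real \<Rightarrow> real^'n \<Rightarrow> 'b::real_normed_vector) \<Rightarrow> real \<Rightarrow> real^'n \<Rightarrow> 'b" where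
  "time_deriv T f t x = vector_derivative (\<lambda>s. f s x) (at t within {0..T})"

definition smooth_curve_in_Diff_vol ::
  "(real^'n) set \<Rightarrow> 'n top_form \<Rightarrow> real \<Rightarrow> (real \<Rightarrow> real^'n \<Rightarrow> real^'n) \<Rightarrow> bool" where
  "smooth_curve_in_Diff_vol D \<nu> T \<phi> \<longleftrightarrow>
     time_smooth D T \<phi> \<and> (\<forall>t\<in>{0..T}. \<phi> t \<in> Diff_vol D \<nu>)"

definition eulerian_fields ::
  "(real^'n) set \<Rightarrow> real \<Rightarrow> (real \<Rightarrow> real^'n \<Rightarrow> real^'n) \<Rightarrow> (real^'n \<Rightarrow> real) \<Rightarrow>
    (real \<Rightarrow> real^'n \<Rightarrow> real^'n) \<Rightarrow> (real \<Rightarrow> real^'n \<Rightarrow> real) \<Rightarrow> bool" where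
  "eulerian_fields D T \<phi> \<Theta>\<^sub>0 u \<theta> \<longleftrightarrow>
     (\<forall>t\<in>{0..T}. \<forall>X\<in>D. u t (\<phi> t X) = time_deriv T \<phi> t X \<and> \<theta> t (\<phi> t X) = \<Theta>\<^sub>0 X)"

definition EP_du ::
  "(real^'n) set \<Rightarrow> real \<Rightarrow> (real \<Rightarrow> real^'n \<Rightarrow> real^'n) \<Rightarrow> (real \<Rightarrow> real^'n \<Rightarrow> real^'n) \<Rightarrow>
    real \<Rightarrow> real^'n \<Rightarrow> real^'n" where
  "EP_du D T u v t x = time_deriv T v t x + bracket D (u t) (v t) x"

definition EP_dtheta ::
  "(real^'n) set \<Rightarrow> (real \<Rightarrow> real^'n \<Rightarrow> real) \<Rightarrow> (real \<Rightarrow> real^'n \<Rightarrow> real^'n) \<Rightarrow>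
    real \<Rightarrow> real^'n \<Rightarrow> real" where
  "EP_dtheta D \<theta> v t x = - frechet_derivative (\<theta> t) (at x within D) (v t x)"

definition action ::
  "((real^'n \<Rightarrow> real^'n) \<Rightarrow> (real^'n \<Rightarrow> real) \<Rightarrow> real) \<Rightarrow> real \<Rightarrow>
    (real \<Rightarrow> real^'n \<Rightarrow> real^'n) \<Rightarrow> (real \<Rightarrow> real^'n \<Rightarrow> real) \<Rightarrow> real" where
  "action l T u \<theta> = (LINT t:{0..T}|lborel. l (u t) (\<theta> t))"

definition EP_principle ::
  "(real^'n) set \<Rightarrow> 'n top_form \<Rightarrow> real \<Rightarrow>
    ((real^'n \<Rightarrow> real^'n) \<Rightarrow> (real^'n \<Rightarrow> real) \<Rightarrow> real) \<Rightarrow>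
    (real \<Rightarrow> real^'n \<Rightarrow> real^'n) \<Rightarrow> (real \<Rightarrow> real^'n \<Rightarrow> real) \<Rightarrow> bool" where
  "EP_principle D \<nu> T l u \<theta> \<longleftrightarrow>
     time_smooth D T u \<and> time_smooth D T \<theta> \<and> (\<forall>t\<in>{0..T}. u t \<in> X_vol D \<nu>) \<and>
     (\<forall>v. time_smooth D T v \<longrightarrow> (\<forall>t\<in>{0..T}. v t \<in> X_vol D \<nu>) \<longrightarrow>
        (\<forall>x\<in>D. v 0 x = 0 \<and> v T x = 0) \<longrightarrow>
        ((\<lambda>\<epsilon>. action l T (\<lambda>t x. u t x + \<epsilon> *\<^sub>R EP_du D T u v t x)
                          (\<lambda>t x. \<theta> t x + \<epsilon> * EP_dtheta D \<theta> v t x))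
          has_real_derivative 0) (at 0))"

text \<open>\<open>k\<close> is the index of the vertical coordinate, so \<open>x $ k\<close> is the height \<open>z\<close>.\<close>

definition anelastic_lagrangian ::
  "(real^'n) set \<Rightarrow> 'n top_form \<Rightarrow> 'n \<Rightarrow> real \<Rightarrow> (real \<Rightarrow> real) \<Rightarrow> (real \<Rightarrow> real) \<Rightarrow>
    (real^'n \<Rightarrow> real^'n) \<Rightarrow> (real^'n \<Rightarrow> real) \<Rightarrow> real" where
  "anelastic_lagrangian D \<mu> k c\<^sub>p \<rho>b \<pi>b u \<theta> =
     form_integral D \<mu> (scale_form
       (\<lambda>x. (1/2 * (norm (u x))\<^sup>2 - c\<^sub>p * \<pi>b (x $ k) * \<theta> x) * \<rho>b (x $ k)) \<mu>)"

definition pseudo_incompressible_lagrangian ::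
  "(real^'n) set \<Rightarrow> 'n top_form \<Rightarrow> 'n \<Rightarrow> real \<Rightarrow> (real \<Rightarrow> real) \<Rightarrow> (real \<Rightarrow> real) \<Rightarrow>
    (real^'n \<Rightarrow> real^'n) \<Rightarrow> (real^'n \<Rightarrow> real) \<Rightarrow> real" where
  "pseudo_incompressible_lagrangian D \<mu> k g \<rho>b \<theta>b u \<theta> =
     form_integral D \<mu> (scale_form
       (\<lambda>x. 1 / \<theta> x * (1/2 * (norm (u x))\<^sup>2 - g * (x $ k)) * (\<rho>b (x $ k) * \<theta>b (x $ k))) \<mu>)"

end

theory Submission
  imports Defs
begin

text \<open>
  The principle is only tested with variations \<open>v = a(t) V(x) / w(x)\<close>, where \<open>w\<close> is the density of
  \<open>\<sigma>\<mu>\<close> and \<open>V\<close> is a divergence-free field with compact support in the interior of \<open>D\<close>. Integration by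
  parts then has no boundary terms, and it shows that at each time the Euler-Poincare residual
  \<open>\<beta> = - (\<partial>\<^sub>t m + Dm u + (Du)\<^sup>T m) - n \<nabla>\<theta>\<close>, with \<open>m = \<delta>l/\<delta>u\<close> and \<open>n = \<delta>l/\<delta>\<theta>\<close>, annihilates all such \<open>V\<close>.
  Choosing for \<open>V\<close> smeared closed polygons, all circulations of \<open>\<beta>\<close> vanish, so \<open>\<beta>\<close> is a gradient in the
  interior, whatever the topology of \<open>D\<close>. The interior cone condition makes the potential \<open>P\<close>
  extend to the boundary, and \<open>\<partial>\<^sub>t P\<close> is the potential of \<open>\<partial>\<^sub>t \<beta>\<close>, which gives smoothness by induction.
  The pressure is \<open>P\<close> up to explicit terms: \<open>\<pi>' = (P + |u|\<^sup>2/2 - c\<^sub>p \<pi>b \<theta> - g z) / (c\<^sub>p \<theta>b)\<close> in the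
  anelastic case and \<open>\<pi>' = (P + (|u|\<^sup>2/2 - g z) / \<theta>) / c\<^sub>p - \<pi>b\<close> in the pseudo-incompressible case.
\<close>

subsection \<open>Smooth functions on sets with interior cones\<close>

text \<open>Dividing by \<open>w\<close> turns the constraint div (\<open>w\<close> v) = 0 into the
  Euclidean condition div \<open>V\<close> = 0, so the space of test fields no longer depends on the
  weight. A curl-free field need not be a gradient on a domain with holes; but closed polygons that
  cannot be contracted also smear to solenoidal fields, and so annihilating all of these is enough.
  The field of one edge has as divergence the mollifier at its start minus the mollifier at its end;
  fields of consecutive edges are added, and the sources at the inner vertices cancel. The boundary
  has two costs: derivatives within closed sets have to be shown unique, for which a cone at each
  point suffices, and estimates near a boundary point need one cone for all points around it. Time
  has a third: \<open>P\<close> is chosen separately at each time, so its regularity in time is not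
  given. It is normalised at one point, and a bound of oscillations by the supremum of the gradient,
  valid on the connected \<open>D\<close>, carries the uniform convergence of difference quotients
  over from \<open>\<beta>\<close> to \<open>P\<close>.\<close>

definition fat :: "'a::real_normed_vector set \<Rightarrow> bool" where
  "fat S \<longleftrightarrow> (\<forall>x\<in>S. \<exists>e. \<exists>c>0. \<exists>d>0. \<forall>s. 0 < s \<and> s \<le> d \<longrightarrow> ball (x + s *\<^sub>R e) (c * s) \<subseteq> S)"

lemma fatI:
  assumes "\<And>x. x \<in> S \<Longrightarrow> \<exists>e c d. c > 0 \<and> d > 0 \<and> (\<forall>s. 0 < s \<and> s \<le> d \<longrightarrow> ball (x + s *\<^sub>R e) (c * s) \<subseteq> S)"
  shows "fat S"
  unfolding fat_def
proof
  fix x assume "x \<in> S"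
  from assms[OF this] show "\<exists>e. \<exists>c>0. \<exists>d>0. \<forall>s. 0 < s \<and> s \<le> d \<longrightarrow> ball (x + s *\<^sub>R e) (c * s) \<subseteq> S"
    by (elim exE conjE) (intro exI conjI)
qed

lemma fatD:
  assumes "fat S" "x \<in> S"
  shows "\<exists>e c d. c > 0 \<and> d > 0 \<and> (\<forall>s. 0 < s \<and> s \<le> d \<longrightarrow> ball (x + s *\<^sub>R e) (c * s) \<subseteq> S)"
  using bspec[OF assms(1)[unfolded fat_def] assms(2)] by (elim exE conjE) (intro exI conjI)

lemma fat_open:
  assumes "open S" shows "fat S"
proof (rule fatI)
  fix x assume "x \<in> S"
  then obtain d where d: "d > 0" "ball x d \<subseteq> S" using assms open_contains_ball by blast
  have "ball (x + s *\<^sub>R (0::'a)) (1 * s) \<subseteq> S" if "0 < s" "s \<le> d" for s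
    using d(2) subset_ball[OF that(2), of x] by (simp add: order_trans)
  then show "\<exists>e c d. c > 0 \<and> d > 0 \<and> (\<forall>s. 0 < s \<and> s \<le> d \<longrightarrow> ball (x + s *\<^sub>R e) (c * s) \<subseteq> S)"
    using d(1) zero_less_one by (intro exI[of _ 0] exI[of _ 1] exI[of _ d] conjI) auto
qed

text \<open>This makes the cylinder \<open>{0..T} \<times> D\<close> admissible, including its
  corners over the boundary of \<open>D\<close> at the times 0 and \<open>T\<close>. Two cones run
  with a common parameter \<open>s\<close> contain a cone about \<open>(e, e')\<close> with the
  smaller aperture.\<close>

lemma fat_Times:
  fixes A :: "'a::real_normed_vector set" and B :: "'b::real_normed_vector set"
  assumes "fat A" "fat B" shows "fat (A \<times> B)"
proof (rule fatI)
  fix p assume "p \<in> A \<times> B"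
  then obtain x y where p: "p = (x, y)" and xy: "x \<in> A" "y \<in> B" by auto
  obtain e c d where 1: "c > 0" "d > 0" "\<forall>s. 0 < s \<and> s \<le> d \<longrightarrow> ball (x + s *\<^sub>R e) (c * s) \<subseteq> A"
    using fatD[OF assms(1) xy(1)] by (elim exE conjE)
  obtain e' c' d' where 2: "c' > 0" "d' > 0" "\<forall>s. 0 < s \<and> s \<le> d' \<longrightarrow> ball (y + s *\<^sub>R e') (c' * s) \<subseteq> B"
    using fatD[OF assms(2) xy(2)] by (elim exE conjE)
  have "ball (p + s *\<^sub>R (e, e')) (min c c' * s) \<subseteq> A \<times> B" if s: "0 < s" "s \<le> min d d'" for s
  proof
    fix q assume q: "q \<in> ball (p + s *\<^sub>R (e, e')) (min c c' * s)"
    obtain a b where ab: "q = (a, b)" by (cases q)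
    have "dist (x + s *\<^sub>R e) a \<le> dist (p + s *\<^sub>R (e, e')) q" "dist (y + s *\<^sub>R e') b \<le> dist (p + s *\<^sub>R (e, e')) q"
      using dist_fst_le[of "p + s *\<^sub>R (e, e')" q] dist_snd_le[of "p + s *\<^sub>R (e, e')" q] by (auto simp: p ab)
    moreover have "min c c' * s \<le> c * s" "min c c' * s \<le> c' * s" using s by auto
    ultimately have "a \<in> ball (x + s *\<^sub>R e) (c * s)" "b \<in> ball (y + s *\<^sub>R e') (c' * s)"
      using q by auto
    then show "q \<in> A \<times> B" using 1(3)[rule_format, of s] 2(3)[rule_format, of s] s by (auto simp: ab)
  qed
  then have "\<forall>s. 0 < s \<and> s \<le> min d d' \<longrightarrow> ball (p + s *\<^sub>R (e, e')) (min c c' * s) \<subseteq> A \<times> B"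
    by (intro allI impI) (elim conjE)
  moreover have "min c c' > 0" "min d d' > 0" using 1 2 by auto
  ultimately show "\<exists>e c d. c > 0 \<and> d > 0 \<and> (\<forall>s. 0 < s \<and> s \<le> d \<longrightarrow> ball (p + s *\<^sub>R e) (c * s) \<subseteq> A \<times> B)"
    by (intro exI[of _ "(e, e')"] exI[of _ "min c c'"] exI[of _ "min d d'"] conjI)
qed

lemma fat_Icc:
  fixes a b :: real
  assumes "a < b" shows "fat {a..b}"
proof (rule fatI)
  fix x assume x: "x \<in> {a..b}"
  have "\<exists>e d. d > 0 \<and> (\<forall>s. 0 < s \<and> s \<le> d \<longrightarrow> ball (x + s *\<^sub>R e) (1 * s) \<subseteq> {a..b})"
  proof (cases "x < b")
    case True
    have "ball (x + s *\<^sub>R 1) (1 * s) \<subseteq> {a..b}" if "0 < s" "s \<le> (b - x) / 2" for s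
      using that x by (auto simp: ball_eq_greaterThanLessThan)
    then show ?thesis using True by (intro exI[of _ 1] exI[of _ "(b - x) / 2"]) simp
  next
    case False
    have "ball (x + s *\<^sub>R (-1)) (1 * s) \<subseteq> {a..b}" if "0 < s" "s \<le> (x - a) / 2" for s
      using that x by (auto simp: ball_eq_greaterThanLessThan)
    then show ?thesis using False assms x by (intro exI[of _ "-1"] exI[of _ "(x - a) / 2"]) simp
  qed
  then obtain e d where "d > 0" "\<forall>s. 0 < s \<and> s \<le> d \<longrightarrow> ball (x + s *\<^sub>R e) (1 * s) \<subseteq> {a..b}"
    by (elim exE conjE)
  then show "\<exists>e c d. c > 0 \<and> d > 0 \<and> (\<forall>s. 0 < s \<and> s \<le> d \<longrightarrow> ball (x + s *\<^sub>R e) (c * s) \<subseteq> {a..b})"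
    using zero_less_one by (intro exI conjI)
qed

text \<open>The difference \<open>L\<close> of two derivatives is a derivative of the zero function.
  It vanishes on each \<open>u\<close> within \<open>c\<close> of \<open>e\<close>, because
  \<open>x + s u\<close> stays in \<open>S\<close> for small \<open>s\<close>. Such \<open>u\<close>
  fill a ball, and a linear map that vanishes on a ball is zero.\<close>

lemma fat_derivative_unique:
  assumes S: "fat S" "x \<in> S"
    and f: "(f has_derivative f') (at x within S)" "(f has_derivative f'') (at x within S)"
  shows "f' = f''"
proof -
  define L where "L = (\<lambda>v. f' v - f'' v)"
  have L: "((\<lambda>_. 0) has_derivative L) (at x within S)"
    using has_derivative_diff[OF f] unfolding L_def by simp
  then have lin: "bounded_linear L" by (rule has_derivative_bounded_linear)
  obtain e c d where c: "c > 0" "d > 0" "\<forall>s. 0 < s \<and> s \<le> d \<longrightarrow> ball (x + s *\<^sub>R e) (c * s) \<subseteq> S"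
    using fatD[OF S] by (elim exE conjE)
  have zero: "L u = 0" if u: "norm (u - e) < c" for u
  proof -
    have sub: "(\<lambda>s. x + s *\<^sub>R u) ` {0..d} \<subseteq> S"
    proof clarify
      fix s :: real assume s: "s \<in> {0..d}"
      show "x + s *\<^sub>R u \<in> S"
      proof (cases "s = 0")
        case False
        then have "s > 0" using s by auto
        have "x + s *\<^sub>R e - (x + s *\<^sub>R u) = s *\<^sub>R (e - u)" by (simp add: algebra_simps)
        then have "dist (x + s *\<^sub>R e) (x + s *\<^sub>R u) = s * norm (u - e)"
          using \<open>s > 0\<close> by (simp add: dist_norm norm_minus_commute)
        also have "\<dots> < c * s" using u \<open>s > 0\<close> by simp
        finally show ?thesis using c(3)[rule_format, of s] s \<open>s > 0\<close> by auto
      qed (use S in simp)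
    qed
    have "((\<lambda>s. x + s *\<^sub>R u) has_derivative (\<lambda>s. s *\<^sub>R u)) (at 0 within {0..d})"
      by (auto intro!: derivative_eq_intros)
    moreover have "((\<lambda>_. 0) has_derivative L) (at (x + 0 *\<^sub>R u) within (\<lambda>s. x + s *\<^sub>R u) ` {0..d})"
      using has_derivative_subset[OF L sub] by simp
    ultimately have "(((\<lambda>_. 0) \<circ> (\<lambda>s. x + s *\<^sub>R u)) has_derivative (L \<circ> (\<lambda>s. s *\<^sub>R u))) (at 0 within {0..d})"
      by (rule diff_chain_within)
    then have "((\<lambda>_. 0) has_vector_derivative L u) (at 0 within cbox 0 d)"
      unfolding has_vector_derivative_def o_def
      by (simp add: linear_simps(5)[OF lin])
    moreover have "((\<lambda>_. 0) has_vector_derivative 0) (at 0 within cbox 0 d)"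
      by (rule has_vector_derivative_const)
    ultimately show ?thesis
      using vector_derivative_unique_within_closed_interval[of 0 d 0 "\<lambda>_. 0" "L u" 0] c by auto
  qed
  have "L v = 0" for v
  proof -
    \<comment> \<open>Small enough for \<open>e + t v\<close> to point into the cone still; the
      \<open>+ 1\<close> covers \<open>v = 0\<close>.\<close>
    define t where "t = c / (2 * (norm v + 1))"
    have "t > 0" using c by (simp add: t_def add_nonneg_pos)
    have "norm (t *\<^sub>R v) < c"
    proof -
      have "norm (t *\<^sub>R v) = t * norm v" using \<open>t > 0\<close> by simp
      also have "\<dots> < t * (2 * (norm v + 1))" using \<open>t > 0\<close>
        by (intro mult_strict_left_mono) (auto intro: add_nonneg_pos)
      also have "\<dots> = c" using norm_ge_zero[of v] unfolding t_def by (simp add: field_simps add_nonneg_eq_0_iff)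
      finally show ?thesis .
    qed
    then have "L (e + t *\<^sub>R v) = 0" "L e = 0" using zero[of "e + t *\<^sub>R v"] zero[of e] c by auto
    then have "t *\<^sub>R L v = 0" using linear_simps(1,5)[OF lin] by simp
    then show ?thesis using \<open>t > 0\<close> by simp
  qed
  then show ?thesis unfolding L_def by (auto simp: fun_eq_iff)
qed

text \<open>\<open>frechet_derivative\<close> is a choice among the possible derivatives. On a fat
  set any derivative that can be exhibited is the chosen one, and the explicit computations below
  rest on this.\<close>

lemma frechet_derivative_fat:
  assumes "fat S" "x \<in> S" "(f has_derivative f') (at x within S)"
  shows "frechet_derivative f (at x within S) = f'"
proof (rule fat_derivative_unique[OF assms(1,2) _ assms(3)])
  show "(f has_derivative frechet_derivative f (at x within S)) (at x within S)"
    using differentiableI[OF assms(3)] unfolding frechet_derivative_works .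
qed

lemma frechet_derivative_cong_within:
  assumes "\<And>y. y \<in> S \<Longrightarrow> f y = g y" "x \<in> S"
  shows "frechet_derivative f (at x within S) = frechet_derivative g (at x within S)"
  unfolding frechet_derivative_def
  using assms by (metis (no_types, lifting) has_derivative_transform)

section \<open>Closure properties of smoothness of finite and infinite order\<close>

lemma C_k_on_cong:
  assumes "\<And>y. y \<in> S \<Longrightarrow> f y = g y"
  shows "C_k_on n S f \<longleftrightarrow> C_k_on n S g"
  using assms
proof (induction n arbitrary: f g)
  case 0
  then show ?case by (simp cong: continuous_on_cong)
next
  case (Suc n)
  have "f differentiable_on S \<longleftrightarrow> g differentiable_on S"
    unfolding differentiable_on_def differentiable_def
    using Suc.prems by (metis (no_types, lifting) has_derivative_transform)
  moreover have "C_k_on n S (\<lambda>x. frechet_derivative f (at x within S) v) \<longleftrightarrow>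
      C_k_on n S (\<lambda>x. frechet_derivative g (at x within S) v)" for v
    by (rule Suc.IH) (simp add: frechet_derivative_cong_within[OF Suc.prems])
  ultimately show ?case by simp
qed

lemma smooth_on_cong:
  assumes "\<And>y. y \<in> S \<Longrightarrow> f y = g y"
  shows "smooth_on S f \<longleftrightarrow> smooth_on S g"
  unfolding smooth_on_def by (simp only: C_k_on_cong[of S f g, OF assms])

lemma C_k_on_SucI:
  assumes "fat S" "\<And>x. x \<in> S \<Longrightarrow> (f has_derivative f' x) (at x within S)"
    and "\<And>v. C_k_on n S (\<lambda>x. f' x v)"
  shows "C_k_on (Suc n) S f"
proof -
  have "C_k_on n S (\<lambda>x. frechet_derivative f (at x within S) v)" for v
    using assms(3)[of v] by (rule C_k_on_cong[THEN iffD1, rotated])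
      (simp add: frechet_derivative_fat[OF assms(1) _ assms(2)])
  then show ?thesis using assms(2) by (auto simp: differentiable_on_def differentiable_def)
qed

lemma C_k_on_Suc_derivative:
  "C_k_on (Suc n) S f \<Longrightarrow> x \<in> S \<Longrightarrow>
    (f has_derivative frechet_derivative f (at x within S)) (at x within S)"
  by (auto simp: differentiable_on_def frechet_derivative_works)

lemma C_k_on_Suc_imp: "C_k_on (Suc n) S f \<Longrightarrow> C_k_on n S f"
proof (induction n arbitrary: f)
  case 0
  then show ?case by (simp add: differentiable_imp_continuous_on)
next
  case (Suc n)
  show ?case
    unfolding C_k_on.simps(2)[of n]
    using Suc.prems Suc.IH unfolding C_k_on.simps(2)[of "Suc n"] by blast
qed

lemma C_k_on_const:
  assumes "fat S" shows "C_k_on n S (\<lambda>_. c)"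
proof (induction n arbitrary: c)
  case (Suc n)
  show ?case by (rule C_k_on_SucI[OF assms has_derivative_const]) (rule Suc)
qed simp

lemma C_k_on_add:
  assumes "fat S"
  shows "C_k_on n S f \<Longrightarrow> C_k_on n S g \<Longrightarrow> C_k_on n S (\<lambda>x. f x + g x)"
proof (induction n arbitrary: f g)
  case 0
  then show ?case by (simp add: continuous_on_add)
next
  case (Suc n)
  show ?case
    by (rule C_k_on_SucI[OF assms has_derivative_add[OF C_k_on_Suc_derivative[OF Suc.prems(1)]
            C_k_on_Suc_derivative[OF Suc.prems(2)]]])
      (use Suc in auto)
qed

lemma C_k_on_bilinear:
  assumes "fat S" "bounded_bilinear B"
  shows "C_k_on n S f \<Longrightarrow> C_k_on n S g \<Longrightarrow> C_k_on n S (\<lambda>x. B (f x) (g x))"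
proof (induction n arbitrary: f g)
  case 0
  then show ?case using bounded_bilinear.continuous_on[OF assms(2)] by simp
next
  case (Suc n)
  \<comment> \<open>The derivative of \<open>B f g\<close> still contains \<open>f\<close> and
    \<open>g\<close> undifferentiated, so the induction hypothesis needs them at order
    \<open>n\<close> as well.\<close>
  have "C_k_on n S f" "C_k_on n S g" using Suc.prems C_k_on_Suc_imp by auto
  then show ?case using Suc
    by (intro C_k_on_SucI[OF assms(1) bounded_bilinear.FDERIV[OF assms(2)
            C_k_on_Suc_derivative[OF Suc.prems(1)] C_k_on_Suc_derivative[OF Suc.prems(2)]]])
      (auto intro!: C_k_on_add assms)
qed

lemma C_k_on_linear:
  assumes "fat S" "bounded_linear L"
  shows "C_k_on n S f \<Longrightarrow> C_k_on n S (\<lambda>x. L (f x))"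
proof (induction n arbitrary: f)
  case 0
  then show ?case using bounded_linear.continuous_on[OF assms(2)] by simp
next
  case (Suc n)
  show ?case
    by (rule C_k_on_SucI[OF assms(1) bounded_linear.has_derivative[OF assms(2)
            C_k_on_Suc_derivative[OF Suc.prems]]]) (use Suc in auto)
qed

lemma C_k_on_inverse:
  fixes f :: "'a::real_normed_vector \<Rightarrow> real"
  assumes "fat S" "\<And>x. x \<in> S \<Longrightarrow> f x \<noteq> 0"
  shows "C_k_on n S f \<Longrightarrow> C_k_on n S (\<lambda>x. inverse (f x))"
proof (induction n)
  case 0
  then show ?case using assms by (simp add: continuous_on_inverse)
next
  case (Suc n)
  have "C_k_on n S (\<lambda>x. inverse (f x))" using Suc C_k_on_Suc_imp by auto
  then have "C_k_on n S (\<lambda>x. (-1) * (inverse (f x) * frechet_derivative f (at x within S) v * inverse (f x)))" for v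
    using Suc.prems assms(1)
    by (intro C_k_on_bilinear[OF assms(1) bounded_bilinear_mult] C_k_on_const) auto
  then show ?case
    by (intro C_k_on_SucI[OF assms(1) Deriv.has_derivative_inverse[OF assms(2) C_k_on_Suc_derivative[OF Suc.prems]]])
      auto
qed

text \<open>Affine substitutions cover restrictions to subsets, translations, time slices and
  functions of a single coordinate. Smoothness of general compositions, which would call for a chain
  rule of higher order, is thereby avoided.\<close>

lemma C_k_on_affine:
  assumes "fat R" "bounded_linear L" "\<And>x. x \<in> R \<Longrightarrow> c + L x \<in> S"
  shows "C_k_on n S f \<Longrightarrow> C_k_on n R (\<lambda>x. f (c + L x))"
proof (induction n arbitrary: f)
  case 0
  have "continuous_on R (\<lambda>x. c + L x)"
    by (intro continuous_on_add continuous_on_const linear_continuous_on assms(2))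
  moreover have "continuous_on ((\<lambda>x. c + L x) ` R) f"
    using 0 assms(3) by (auto intro: continuous_on_subset)
  ultimately have "continuous_on R (f \<circ> (\<lambda>x. c + L x))"
    by (rule continuous_on_compose)
  then show ?case by (simp add: o_def)
next
  case (Suc n)
  have "((\<lambda>x. f (c + L x)) has_derivative
      (\<lambda>v. frechet_derivative f (at (c + L x) within S) (L v))) (at x within R)" if "x \<in> R" for x
  proof -
    have "((\<lambda>x. c + L x) has_derivative L) (at x within R)"
      using bounded_linear_imp_has_derivative[OF assms(2)] by (auto intro!: derivative_eq_intros)
    moreover have "(f has_derivative frechet_derivative f (at (c + L x) within S))
        (at (c + L x) within (\<lambda>x. c + L x) ` R)"
      using C_k_on_Suc_derivative[OF Suc.prems] assms(3) that by (blast intro: has_derivative_subset)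
    ultimately show ?thesis using diff_chain_within by (fastforce simp: o_def)
  qed
  then show ?case
  proof (rule C_k_on_SucI[OF assms(1)])
    fix v show "C_k_on n R (\<lambda>x. frechet_derivative f (at (c + L x) within S) (L v))"
      using Suc by auto
  qed
qed

lemma C_k_on_subset:
  assumes "fat R" "R \<subseteq> S" "C_k_on n S f" shows "C_k_on n R f"
  using C_k_on_affine[OF assms(1) bounded_linear_ident, of 0 S n f] assms by auto

lemma smooth_on_const: "fat S \<Longrightarrow> smooth_on S (\<lambda>_. c)"
  and smooth_on_add: "fat S \<Longrightarrow> smooth_on S f \<Longrightarrow> smooth_on S g \<Longrightarrow> smooth_on S (\<lambda>x. f x + g x)"
  and smooth_on_bilinear: "fat S \<Longrightarrow> bounded_bilinear B \<Longrightarrow> smooth_on S f' \<Longrightarrow> smooth_on S g' \<Longrightarrow>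
    smooth_on S (\<lambda>x. B (f' x) (g' x))"
  and smooth_on_linear: "fat S \<Longrightarrow> bounded_linear L \<Longrightarrow> smooth_on S h \<Longrightarrow> smooth_on S (\<lambda>x. L (h x))"
  unfolding smooth_on_def by (simp_all add: C_k_on_const C_k_on_add C_k_on_bilinear C_k_on_linear)

lemma smooth_on_inverse:
  fixes f :: "'a::real_normed_vector \<Rightarrow> real"
  shows "fat S \<Longrightarrow> (\<And>x. x \<in> S \<Longrightarrow> f x \<noteq> 0) \<Longrightarrow> smooth_on S f \<Longrightarrow> smooth_on S (\<lambda>x. inverse (f x))"
  unfolding smooth_on_def by (simp add: C_k_on_inverse)

lemma smooth_on_affine:
  "fat R \<Longrightarrow> bounded_linear L \<Longrightarrow> (\<And>x. x \<in> R \<Longrightarrow> c + L x \<in> S) \<Longrightarrow> smooth_on S f \<Longrightarrow>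
    smooth_on R (\<lambda>x. f (c + L x))"
  unfolding smooth_on_def using C_k_on_affine by blast

lemma smooth_on_comp_linear:
  "fat R \<Longrightarrow> bounded_linear L \<Longrightarrow> (\<And>x. x \<in> R \<Longrightarrow> L x \<in> S) \<Longrightarrow> smooth_on S f \<Longrightarrow>
    smooth_on R (\<lambda>x. f (L x))"
  using smooth_on_affine[of R L 0 S f] by simp

lemma smooth_on_subset: "fat R \<Longrightarrow> R \<subseteq> S \<Longrightarrow> smooth_on S f \<Longrightarrow> smooth_on R f"
  unfolding smooth_on_def using C_k_on_subset by blast

lemma smooth_on_ident: "fat S \<Longrightarrow> bounded_linear L \<Longrightarrow> smooth_on S L"
  unfolding smooth_on_def
proof
  fix n assume S: "fat S" and L: "bounded_linear L"
  show "C_k_on n S L"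
  proof (cases n)
    case 0
    then show ?thesis using L by (simp add: linear_continuous_on)
  next
    case (Suc m)
    show ?thesis unfolding Suc
      by (rule C_k_on_SucI[OF S bounded_linear_imp_has_derivative[OF L]]) (rule C_k_on_const[OF S])
  qed
qed

lemma smooth_on_has_derivative:
  "smooth_on S f \<Longrightarrow> x \<in> S \<Longrightarrow> (f has_derivative frechet_derivative f (at x within S)) (at x within S)"
  unfolding smooth_on_def using C_k_on_Suc_derivative by blast

lemma smooth_on_frechet_derivative:
  "smooth_on S f \<Longrightarrow> smooth_on S (\<lambda>x. frechet_derivative f (at x within S) v)"
  unfolding smooth_on_def using C_k_on.simps(2) by blast

lemma smooth_on_continuous: "smooth_on S f \<Longrightarrow> continuous_on S f"
  unfolding smooth_on_def using C_k_on.simps(1) by blast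

text \<open>Coinduction: if the class is closed under differentiation in fixed directions, the
  derivatives of all orders of its members exist. This suits functions whose derivatives stay in a
  known family although no formula for the n-th one is at hand.\<close>

lemma smooth_on_coinduct:
  assumes "fat S" "P f"
    and step: "\<And>f. P f \<Longrightarrow> \<exists>f'. (\<forall>x\<in>S. (f has_derivative f' x) (at x within S)) \<and> (\<forall>v. P (\<lambda>x. f' x v))"
  shows "smooth_on S f"
proof -
  have "C_k_on n S f" if "P f" for n f
    using that
  proof (induction n arbitrary: f)
    case 0
    then show ?case using step
      by (auto intro!: differentiable_imp_continuous_on simp: differentiable_on_def differentiable_def) blast
  next
    case (Suc n)
    obtain f' where "\<forall>x\<in>S. (f has_derivative f' x) (at x within S)" "\<forall>v. P (\<lambda>x. f' x v)"
      using step[OF Suc.prems] by blast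
    then show ?case using Suc.IH by (intro C_k_on_SucI[OF assms(1), of f f']) auto
  qed
  then show ?thesis using assms(2) by (simp add: smooth_on_def)
qed

lemmas smooth_on_mult = smooth_on_bilinear[OF _ bounded_bilinear_mult]
lemmas smooth_on_scaleR = smooth_on_bilinear[OF _ bounded_bilinear_scaleR]
lemmas smooth_on_inner = smooth_on_bilinear[OF _ bounded_bilinear_inner]

lemma smooth_on_minus: "fat S \<Longrightarrow> smooth_on S f \<Longrightarrow> smooth_on S (\<lambda>x. - f x)"
  by (rule smooth_on_linear[OF _ bounded_linear_minus[OF bounded_linear_ident]])

lemma smooth_on_diff: "fat S \<Longrightarrow> smooth_on S f \<Longrightarrow> smooth_on S g \<Longrightarrow> smooth_on S (\<lambda>x. f x - g x)"
  using smooth_on_add[of S f "\<lambda>x. - g x"] smooth_on_minus by auto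

lemma smooth_on_divide:
  fixes f g :: "'a::real_normed_vector \<Rightarrow> real"
  shows "fat S \<Longrightarrow> (\<And>x. x \<in> S \<Longrightarrow> g x \<noteq> 0) \<Longrightarrow> smooth_on S f \<Longrightarrow> smooth_on S g \<Longrightarrow>
    smooth_on S (\<lambda>x. f x / g x)"
  unfolding divide_inverse by (intro smooth_on_mult smooth_on_inverse)

lemma smooth_on_sum:
  "fat S \<Longrightarrow> (\<And>i. i \<in> I \<Longrightarrow> smooth_on S (f i)) \<Longrightarrow> smooth_on S (\<lambda>x. \<Sum>i\<in>I. f i x)"
  by (induction I rule: infinite_finite_induct) (auto intro: smooth_on_add smooth_on_const)

lemma smooth_on_prod:
  fixes f :: "'i \<Rightarrow> 'a::real_normed_vector \<Rightarrow> real"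
  shows "fat S \<Longrightarrow> (\<And>i. i \<in> I \<Longrightarrow> smooth_on S (f i)) \<Longrightarrow> smooth_on S (\<lambda>x. \<Prod>i\<in>I. f i x)"
  by (induction I rule: infinite_finite_induct) (auto intro: smooth_on_mult smooth_on_const)

text \<open>\<open>C_k_on\<close> only speaks of derivatives in fixed directions. Expanding
  \<open>u x\<close> in the basis reduces a direction that varies with \<open>x\<close> to finitely
  many fixed ones.\<close>

lemma smooth_on_frechet_derivative_field:
  fixes u :: "'a::euclidean_space \<Rightarrow> 'a" and f :: "'a \<Rightarrow> 'b::real_normed_vector"
  assumes "fat S" "smooth_on S f" "smooth_on S u"
  shows "smooth_on S (\<lambda>x. frechet_derivative f (at x within S) (u x))"
proof -
  have "frechet_derivative f (at x within S) (u x) =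
      (\<Sum>b\<in>Basis. (u x \<bullet> b) *\<^sub>R frechet_derivative f (at x within S) b)" if "x \<in> S" for x
  proof -
    have lin: "linear (frechet_derivative f (at x within S))"
      by (rule has_derivative_linear[OF smooth_on_has_derivative[OF assms(2) that]])
    have "frechet_derivative f (at x within S) (\<Sum>b\<in>Basis. (u x \<bullet> b) *\<^sub>R b) =
        (\<Sum>b\<in>Basis. (u x \<bullet> b) *\<^sub>R frechet_derivative f (at x within S) b)"
      using lin by (simp add: linear_sum linear_scale)
    then show ?thesis by (simp add: euclidean_representation)
  qed
  moreover have "smooth_on S (\<lambda>x. \<Sum>b\<in>Basis. (u x \<bullet> b) *\<^sub>R frechet_derivative f (at x within S) b)"
    by (intro smooth_on_sum assms smooth_on_scaleR smooth_on_inner smooth_on_const smooth_on_frechet_derivative)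
  ultimately show ?thesis by (simp cong: smooth_on_cong)
qed

subsection \<open>Bump functions\<close>

lemma poly_over_exp_tendsto_0: "((\<lambda>x::real. poly p x / exp x) \<longlongrightarrow> 0) at_top"
proof -
  have "((\<lambda>x. \<Sum>i\<le>degree p. coeff p i * (x ^ i / exp x)) \<longlongrightarrow> (\<Sum>i\<le>degree p. coeff p i * 0)) at_top"
    by (intro tendsto_intros tendsto_power_div_exp_0)
  then show ?thesis by (simp add: poly_altdef sum_divide_distrib)
qed

text \<open>The classical flat function exp(-1/x), continued by 0. The polynomial factor in 1/x
  closes the family under differentiation.\<close>

definition flat_exp :: "real poly \<Rightarrow> real \<Rightarrow> real" where
  "flat_exp p x = (if x > 0 then poly p (1 / x) / exp (1 / x) else 0)"

lemma flat_exp_tendsto_0: "(flat_exp p \<longlongrightarrow> 0) (at 0)"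
proof (rule filterlim_split_at)
  show "(flat_exp p \<longlongrightarrow> 0) (at_left 0)"
    by (rule tendsto_eventually) (auto simp: flat_exp_def eventually_at_filter)
  have "((\<lambda>x. poly p (inverse x) / exp (inverse x)) \<longlongrightarrow> 0) (at_right 0)"
    by (rule filterlim_compose[OF poly_over_exp_tendsto_0 filterlim_inverse_at_top_right])
  then show "(flat_exp p \<longlongrightarrow> 0) (at_right 0)"
    by (rule Lim_transform_eventually) (auto simp: flat_exp_def eventually_at_filter inverse_eq_divide)
qed

text \<open>With y = 1/x, the derivative of p(y) exp(-y) in x is y^2 (p(y) - p'(y)) exp(-y);
  \<open>[:0, 0, 1:]\<close> is the polynomial y^2.\<close>

lemma DERIV_flat_exp:
  "(flat_exp p has_real_derivative flat_exp ([:0, 0, 1:] * (p - pderiv p)) x) (at x)"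
proof (cases "x = 0")
  case True
  \<comment> \<open>At 0 the difference quotient is itself in the family, with \<open>p\<close>
    multiplied by the variable, and hence tends to 0.\<close>
  have "((\<lambda>h. (flat_exp p (0 + h) - flat_exp p 0) / h) \<longlongrightarrow> 0) (at 0)"
    by (rule Lim_transform_eventually[OF flat_exp_tendsto_0[of "[:0, 1:] * p"]])
      (auto simp: flat_exp_def eventually_at_filter)
  then show ?thesis using True by (simp add: DERIV_def flat_exp_def)
next
  case False
  show ?thesis
  proof (cases "x > 0")
    case True
    have "((\<lambda>x. poly p (1 / x) / exp (1 / x)) has_real_derivative
        flat_exp ([:0, 0, 1:] * (p - pderiv p)) x) (at x)"
      using True by (auto intro!: derivative_eq_intros DERIV_chain'[of "\<lambda>x. 1 / x", OF _ poly_DERIV]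
          simp: flat_exp_def field_simps power2_eq_square)
    then show ?thesis
      by (rule has_field_derivative_transform_within_open[of _ _ _ "{0<..}"])
        (use True in \<open>auto simp: flat_exp_def\<close>)
  next
    case neg: False
    have "((\<lambda>x. 0) has_real_derivative flat_exp ([:0, 0, 1:] * (p - pderiv p)) x) (at x)"
      using neg by (simp add: flat_exp_def)
    then show ?thesis
      by (rule has_field_derivative_transform_within_open[of _ _ _ "{..<0}"])
        (use neg False in \<open>auto simp: flat_exp_def\<close>)
  qed
qed

lemma smooth_on_flat_exp: "smooth_on UNIV (flat_exp p)"
proof (rule smooth_on_coinduct[where P = "\<lambda>f. \<exists>p. f = flat_exp p"])
  fix f assume "\<exists>p. f = flat_exp p"
  then obtain p where f: "f = flat_exp p" by blast
  define q where "q = [:0, 0, 1:] * (p - pderiv p)"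
  have "(f has_derivative (\<lambda>v. flat_exp q x * v)) (at x)" for x
    using DERIV_flat_exp[of p x] unfolding f q_def has_field_derivative_def .
  moreover have "\<exists>r. (\<lambda>x. flat_exp q x * v) = flat_exp r" for v
    by (rule exI[of _ "smult v q"]) (auto simp: flat_exp_def)
  ultimately show "\<exists>f'. (\<forall>x\<in>UNIV. (f has_derivative f' x) (at x)) \<and> (\<forall>v. \<exists>p. (\<lambda>x. f' x v) = flat_exp p)"
    by (intro exI[of _ "\<lambda>x v. flat_exp q x * v"]) blast
qed (auto intro: fat_open)

definition bump :: "real \<Rightarrow> real \<Rightarrow> real" where
  "bump d x = flat_exp 1 (d + x) * flat_exp 1 (d - x)"

lemma smooth_on_bump: "smooth_on UNIV (bump d)"
proof -
  have [simp]: "fat (UNIV :: real set)" by (simp add: fat_open)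
  have "smooth_on UNIV (\<lambda>x. flat_exp 1 (d + (- x)))"
    by (rule smooth_on_affine[OF _ bounded_linear_minus[OF bounded_linear_ident] _ smooth_on_flat_exp]) auto
  moreover have "smooth_on UNIV (\<lambda>x. flat_exp 1 (d + x))"
    by (rule smooth_on_affine[OF _ bounded_linear_ident _ smooth_on_flat_exp]) auto
  ultimately have "smooth_on UNIV (\<lambda>x. flat_exp 1 (d + x) * flat_exp 1 (d + (- x)))"
    by (intro smooth_on_mult) auto
  then show ?thesis by (simp add: bump_def [abs_def])
qed

lemma bump_nonneg: "bump d x \<ge> 0"
  and bump_pos: "\<bar>x\<bar> < d \<Longrightarrow> bump d x > 0"
  and bump_eq_0: "\<bar>x\<bar> \<ge> d \<Longrightarrow> bump d x = 0"
  by (auto simp: bump_def flat_exp_def abs_if split: if_splits)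

text \<open>Integrating a bump along a coordinate axis yields this function, the longitudinal
  profile of a smeared segment. Its smoothness is inherited from its derivative.\<close>

lemma bump_antiderivative:
  obtains \<Psi> where "smooth_on UNIV \<Psi>" "\<And>x. (\<Psi> has_real_derivative bump d x) (at x)"
    "\<And>x y. x \<le> -d \<Longrightarrow> y \<le> -d \<Longrightarrow> \<Psi> x = \<Psi> y" "\<And>x y. x \<ge> d \<Longrightarrow> y \<ge> d \<Longrightarrow> \<Psi> x = \<Psi> y"
proof -
  have "isCont (bump d) x" for x
    using smooth_on_continuous[OF smooth_on_bump] by (simp add: continuous_on_eq_continuous_at)
  then obtain \<Psi> where \<Psi>: "\<And>x. (\<Psi> has_real_derivative bump d x) (at x)"
    using einterval_antiderivative[of "-\<infinity>" "\<infinity>" "bump d"]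
    by (auto simp: has_real_derivative_iff_has_vector_derivative)
  have smooth: "smooth_on UNIV \<Psi>"
    unfolding smooth_on_def
  proof
    fix n show "C_k_on n UNIV \<Psi>"
    proof (cases n)
      case 0
      then show ?thesis using \<Psi> DERIV_isCont by (auto simp: continuous_on_eq_continuous_at)
    next
      case (Suc m)
      have "C_k_on m UNIV (\<lambda>x. bump d x * v)" for v
        using smooth_on_bump[of d] unfolding smooth_on_def
        by (intro C_k_on_bilinear[OF _ bounded_bilinear_mult] C_k_on_const fat_open[OF open_UNIV]) simp
      then show ?thesis unfolding Suc using \<Psi>
        by (intro C_k_on_SucI[where f' = "\<lambda>x v. bump d x * v"])
          (auto simp: has_field_derivative_def fat_open)
    qed
  qed
  have zero: "(\<Psi> has_derivative (\<lambda>_. 0)) (at x within S)" if "\<bar>x\<bar> \<ge> d" for x S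
    using \<Psi>[of x] bump_eq_0[OF that] by (auto simp: has_field_derivative_def lambda_zero[symmetric] intro: has_derivative_at_withinI)
  have 1: "\<Psi> x = \<Psi> y" if "x \<le> -d" "y \<le> -d" for x y
    by (rule has_derivative_zero_unique[of "{..-d}" \<Psi>])
      (use that zero in \<open>auto simp: abs_if\<close>)
  have 2: "\<Psi> x = \<Psi> y" if "x \<ge> d" "y \<ge> d" for x y
    by (rule has_derivative_zero_unique[of "{d..}" \<Psi>])
      (use that zero in \<open>auto simp: abs_if\<close>)
  show thesis by (rule that[OF smooth \<Psi> 1 2])
qed

subsection \<open>Integrals depending on a parameter\<close>

text \<open>The derivative is uniformly continuous on the compact cylinder, so between
  \<open>s\<close> and \<open>s'\<close> it differs from its value at \<open>s\<close> by at most
  \<open>e\<close>, and the mean value inequality applies. Uniformity in \<open>x\<close> serves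
  twice: for derivatives under an integral, and for time derivatives of potentials.\<close>

lemma difference_quotient_uniform:
  fixes f f' :: "real \<Rightarrow> 'a::metric_space \<Rightarrow> 'b::real_normed_vector"
  assumes K: "compact K" and cont: "continuous_on ({a..b} \<times> K) (\<lambda>(s, x). f' s x)"
    and f: "\<And>s x. s \<in> {a..b} \<Longrightarrow> x \<in> K \<Longrightarrow> ((\<lambda>s. f s x) has_vector_derivative f' s x) (at s within {a..b})"
    and e: "e > 0"
  shows "\<exists>d>0. \<forall>s\<in>{a..b}. \<forall>s'\<in>{a..b}. \<bar>s' - s\<bar> < d \<longrightarrow>
    (\<forall>x\<in>K. norm (f s' x - f s x - (s' - s) *\<^sub>R f' s x) \<le> e * \<bar>s' - s\<bar>)"
proof -
  have "uniformly_continuous_on ({a..b} \<times> K) (\<lambda>(s, x). f' s x)"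
    by (intro compact_uniformly_continuous cont compact_Times compact_Icc K)
  from this[unfolded uniformly_continuous_on_def, rule_format, OF e]
  obtain d where d: "d > 0" "\<And>p q. p \<in> {a..b} \<times> K \<Longrightarrow> q \<in> {a..b} \<times> K \<Longrightarrow> dist q p < d \<Longrightarrow>
      dist (case q of (s, x) \<Rightarrow> f' s x) (case p of (s, x) \<Rightarrow> f' s x) < e" by blast
  have "norm (f s' x - f s x - (s' - s) *\<^sub>R f' s x) \<le> e * \<bar>s' - s\<bar>"
    if s: "s \<in> {a..b}" "s' \<in> {a..b}" "\<bar>s' - s\<bar> < d" and x: "x \<in> K" for s s' x
  proof -
    have sub: "closed_segment s s' \<subseteq> {a..b}"
      using s by (simp add: closed_segment_subset)
    have "norm (f s' x - f s x - (s' - s) *\<^sub>R f' s x) \<le> norm (s' - s) * e"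
    proof (rule vector_differentiable_bound_linearization[where S = "closed_segment s s'"])
      fix r assume r: "r \<in> closed_segment s s'"
      then show "((\<lambda>s. f s x) has_vector_derivative f' r x) (at r within closed_segment s s')"
        using f[OF _ x] sub by (blast intro: has_vector_derivative_within_subset)
      have "\<bar>r - s\<bar> \<le> \<bar>s' - s\<bar>" using r by (auto simp: closed_segment_eq_real_ivl split: if_splits)
      then have "dist (r, x) (s, x) < d" using s by (simp add: dist_Pair_Pair dist_real_def)
      then show "norm (f' r x - f' s x) \<le> e"
        using d(2)[of "(s, x)" "(r, x)"] r sub x s by (auto simp: dist_norm)
    qed auto
    then show ?thesis by (simp add: mult.commute)
  qed
  then show ?thesis using d(1) by blast
qed

lemma set_integrable_compact:
  fixes f :: "'a::euclidean_space \<Rightarrow> 'b::euclidean_space"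
  assumes "compact K" "continuous_on K f"
  shows "set_integrable lborel K f"
  unfolding set_integrable_def by (rule borel_integrable_compact[OF assms])

lemma set_integral_compact_bound:
  fixes f :: "'a::euclidean_space \<Rightarrow> 'b::euclidean_space"
  assumes "compact K" "continuous_on K f" "\<And>x. x \<in> K \<Longrightarrow> norm (f x) \<le> B"
  shows "norm (LINT x:K|lborel. f x) \<le> B * measure lborel K"
proof -
  have "norm (LINT x:K|lborel. f x) \<le> (LINT x:K|lborel. norm (f x))"
    by (intro set_integral_norm_bound set_integrable_compact assms)
  also have "\<dots> \<le> (LINT x:K|lborel. B)"
    by (intro set_integral_mono set_integrable_compact assms continuous_on_norm continuous_on_const)
  also have "\<dots> = B * measure lborel K"
    using assms(1) by (simp add: set_lebesgue_integral_def)
  finally show ?thesis .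
qed

lemma continuous_on_slice:
  assumes "continuous_on (S \<times> K) (\<lambda>(s, x). f s x)" "s \<in> S"
  shows "continuous_on K (f s)"
proof -
  have "continuous_on K ((\<lambda>(s, x). f s x) \<circ> Pair s)"
    by (intro continuous_on_compose continuous_intros continuous_on_subset[OF assms(1)]) (use assms(2) in auto)
  then show ?thesis by (simp add: o_def)
qed

lemma continuous_on_set_integral:
  fixes f :: "'a::metric_space \<Rightarrow> 'b::euclidean_space \<Rightarrow> 'c::euclidean_space"
  assumes S: "compact S" and K: "compact K" and cont: "continuous_on (S \<times> K) (\<lambda>(s, x). f s x)"
  shows "continuous_on S (\<lambda>s. LINT x:K|lborel. f s x)"
  unfolding continuous_on_iff
proof (intro ballI allI impI)
  fix s and e :: real assume s: "s \<in> S" and e: "e > 0"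
  \<comment> \<open>The \<open>+ 1\<close> keeps the quotient meaningful when \<open>K\<close> is a
    null set and makes the final inequality strict.\<close>
  define e' where "e' = e / (measure lborel K + 1)"
  have e': "e' > 0" using e by (simp add: e'_def add_nonneg_pos)
  have em: "e' * (measure lborel K + 1) = e"
    using measure_nonneg[of lborel K] by (simp add: e'_def add_nonneg_eq_0_iff)
  have "uniformly_continuous_on (S \<times> K) (\<lambda>(s, x). f s x)"
    by (intro compact_uniformly_continuous cont compact_Times S K)
  from this[unfolded uniformly_continuous_on_def, rule_format, OF e']
  obtain d where d: "d > 0" "\<And>p q. p \<in> S \<times> K \<Longrightarrow> q \<in> S \<times> K \<Longrightarrow> dist q p < d \<Longrightarrow>
      dist (case q of (s, x) \<Rightarrow> f s x) (case p of (s, x) \<Rightarrow> f s x) < e'" by blast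
  have "dist (LINT x:K|lborel. f s' x) (LINT x:K|lborel. f s x) < e" if s': "s' \<in> S" "dist s' s < d" for s'
  proof -
    have c: "continuous_on K (f s)" "continuous_on K (f s')"
      using continuous_on_slice[OF cont] s s' by auto
    have "(LINT x:K|lborel. f s' x) - (LINT x:K|lborel. f s x) = (LINT x:K|lborel. f s' x - f s x)"
      by (subst set_integral_diff) (auto intro: set_integrable_compact K c)
    also have "norm \<dots> \<le> e' * measure lborel K"
    proof (intro set_integral_compact_bound K continuous_on_diff c)
      fix x assume "x \<in> K"
      then show "norm (f s' x - f s x) \<le> e'"
        using d(2)[of "(s, x)" "(s', x)"] s s' by (auto simp: dist_Pair_Pair dist_norm)
    qed
    also have "\<dots> < e" using em e' by (simp add: algebra_simps)
    finally show ?thesis by (simp add: dist_norm)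
  qed
  then show "\<exists>d>0. \<forall>s'\<in>S. dist s' s < d \<longrightarrow> dist (LINT x:K|lborel. f s' x) (LINT x:K|lborel. f s x) < e"
    using d(1) by blast
qed

lemma has_vector_derivative_set_integral:
  fixes f f' :: "real \<Rightarrow> 'b::euclidean_space \<Rightarrow> 'c::euclidean_space"
  assumes K: "compact K" and cont: "continuous_on ({a..b} \<times> K) (\<lambda>(s, x). f' s x)"
    and f: "\<And>s x. s \<in> {a..b} \<Longrightarrow> x \<in> K \<Longrightarrow> ((\<lambda>s. f s x) has_vector_derivative f' s x) (at s within {a..b})"
    and cf: "\<And>s. s \<in> {a..b} \<Longrightarrow> continuous_on K (f s)"
    and s: "s \<in> {a..b}"
  shows "((\<lambda>s. LINT x:K|lborel. f s x) has_vector_derivative (LINT x:K|lborel. f' s x)) (at s within {a..b})"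
  unfolding has_vector_derivative_def
proof (rule has_derivativeI_sandwich[of 1])
  show "bounded_linear (\<lambda>h. h *\<^sub>R (LINT x:K|lborel. f' s x))" by (rule bounded_linear_scaleR_left)
  let ?I = "\<lambda>f. LINT x:K|lborel. f x"
  let ?r = "\<lambda>s'. norm (?I (f s') - ?I (f s) - (s' - s) *\<^sub>R ?I (f' s)) / norm (s' - s)"
  show "(?r \<longlongrightarrow> 0) (at s within {a..b})"
  proof (rule tendstoI)
    fix e :: real assume e: "e > 0"
    define e' where "e' = e / (measure lborel K + 1)"
    have e': "e' > 0" using e by (simp add: e'_def add_nonneg_pos)
    have em: "e' * (measure lborel K + 1) = e"
      using measure_nonneg[of lborel K] by (simp add: e'_def add_nonneg_eq_0_iff)
    obtain d where d: "d > 0" "\<And>s'. s' \<in> {a..b} \<Longrightarrow> \<bar>s' - s\<bar> < d \<Longrightarrow>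
        (\<forall>x\<in>K. norm (f s' x - f s x - (s' - s) *\<^sub>R f' s x) \<le> e' * \<bar>s' - s\<bar>)"
      using difference_quotient_uniform[OF K cont f e'] s by blast
    have "?r s' < e" if s': "s' \<in> {a..b}" "s' \<noteq> s" "dist s' s < d" for s'
    proof -
      have c: "continuous_on K (f s)" "continuous_on K (f s')" "continuous_on K (f' s)"
        using cf s s' continuous_on_slice[OF cont] by auto
      have i: "set_integrable lborel K (f s)" "set_integrable lborel K (f s')" "set_integrable lborel K (f' s)"
        by (auto intro: set_integrable_compact K c)
      have "?I (f s') - ?I (f s) - (s' - s) *\<^sub>R ?I (f' s) = (LINT x:K|lborel. f s' x - f s x - (s' - s) *\<^sub>R f' s x)"
        using i by (simp add: set_integral_diff)
      also have "norm \<dots> \<le> (e' * \<bar>s' - s\<bar>) * measure lborel K"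
        using d(2)[of s'] s' by (intro set_integral_compact_bound K continuous_on_diff continuous_on_scaleR
          continuous_on_const c) (auto simp: dist_real_def)
      finally have "?r s' \<le> e' * measure lborel K" using s' by (simp add: divide_simps mult_ac)
      also have "\<dots> < e" using em e' by (simp add: algebra_simps)
      finally show ?thesis .
    qed
    then show "eventually (\<lambda>s'. dist (?r s') 0 < e) (at s within {a..b})"
      using d(1) by (auto simp: eventually_at)
  qed
qed auto

lemma lborel_integral_translation:
  fixes f :: "'a::euclidean_space \<Rightarrow> 'b::{banach, second_countable_topology}"
  assumes "f \<in> borel_measurable borel"
  shows "(LINT x|lborel. f (c + x)) = (LINT x|lborel. f x)"
proof -
  have "(LINT x|distr lborel borel ((+) c). f x) = (LINT x|lborel. f (c + x))"
    by (rule integral_distr) (use assms in auto)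
  then show ?thesis by (simp add: lborel_distr_plus)
qed

lemma integral_eq_set_integral:
  fixes f :: "'a::euclidean_space \<Rightarrow> 'b::euclidean_space"
  assumes "\<And>x. x \<notin> K \<Longrightarrow> f x = 0"
  shows "(LINT x|lborel. f x) = (LINT x:K|lborel. f x)"
  unfolding set_lebesgue_integral_def
  by (rule Bochner_Integration.integral_cong) (use assms in \<open>auto simp: indicator_def\<close>)

text \<open>By translation invariance the integral of \<open>F (s v + x)\<close> over
  \<open>x\<close> is the same for all \<open>s\<close>; differentiating under the integral at
  \<open>s = 0\<close> gives the claim. This takes the place of the divergence theorem and involves
  no boundary.\<close>

lemma integral_directional_derivative_eq_0:
  fixes F :: "'a::euclidean_space \<Rightarrow> real"
  assumes F: "\<And>x. (F has_derivative F' x) (at x)" and cont: "continuous_on UNIV (\<lambda>x. F' x v)"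
    and K: "compact K" "\<And>x. x \<notin> K \<Longrightarrow> F x = 0"
  shows "(LINT x|lborel. F' x v) = 0"
proof -
  have contF: "continuous_on UNIV F"
    by (intro continuous_at_imp_continuous_on ballI has_derivative_continuous[OF F])
  have F'0: "F' x v = 0" if "x \<notin> K" for x
  proof -
    have "(F has_derivative (\<lambda>_. 0)) (at x)"
      by (rule has_derivative_transform_within_open[of "\<lambda>_. 0" _ _ _ "- K"])
        (use that K compact_imp_closed in auto)
    from has_derivative_unique[OF this F] show ?thesis by (simp add: fun_eq_iff)
  qed
  obtain R where R: "\<And>x. x \<in> K \<Longrightarrow> norm x \<le> R"
    using compact_imp_bounded[OF K(1)] by (auto simp: bounded_iff)
  \<comment> \<open>A ball that contains the supports of all translates with \<open>s\<close> in
    \<open>{0..1}\<close>, so that the domain of integration is fixed and compact.\<close>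
  define B where "B = cball (0::'a) (R + norm v)"
  have B: "compact B" by (simp add: B_def)
  have out: "F (s *\<^sub>R v + x) = 0" if "x \<notin> B" "s \<in> {0..1}" for x s
  proof -
    have "norm x \<le> norm (s *\<^sub>R v + x) + norm (s *\<^sub>R v)" using norm_diff_ineq[of x "s *\<^sub>R v"]
      by (simp add: add.commute)
    moreover have "norm (s *\<^sub>R v) \<le> norm v" using that by (simp add: mult_left_le_one_le)
    ultimately show ?thesis using R[of "s *\<^sub>R v + x"] K(2) that(1) by (force simp: B_def)
  qed
  have const: "(LINT x:B|lborel. F (s *\<^sub>R v + x)) = (LINT x|lborel. F x)" if "s \<in> {0..1}" for s
  proof -
    have "(LINT x:B|lborel. F (s *\<^sub>R v + x)) = (LINT x|lborel. F (s *\<^sub>R v + x))"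
      by (rule integral_eq_set_integral[symmetric]) (use out that in blast)
    then show ?thesis
      by (simp add: lborel_integral_translation[OF borel_measurable_continuous_onI[OF contF]])
  qed
  have "((\<lambda>s. LINT x:B|lborel. F (s *\<^sub>R v + x)) has_vector_derivative
      (LINT x:B|lborel. F' (0 *\<^sub>R v + x) v)) (at 0 within {0..1})"
  proof (rule has_vector_derivative_set_integral[OF B])
    show "continuous_on ({0..1} \<times> B) (\<lambda>(s, x). F' (s *\<^sub>R v + x) v)"
      unfolding case_prod_beta
      by (rule continuous_on_compose2[OF cont]) (auto intro!: continuous_intros)
    show "continuous_on B (\<lambda>x. F (s *\<^sub>R v + x))" for s
      by (rule continuous_on_compose2[OF contF]) (auto intro!: continuous_intros)
    fix s :: real and x
    have "((\<lambda>s. s *\<^sub>R v + x) has_derivative (\<lambda>h. h *\<^sub>R v)) (at s within {0..1})"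
      by (auto intro!: derivative_eq_intros)
    from has_derivative_compose[OF this F]
    show "((\<lambda>s. F (s *\<^sub>R v + x)) has_vector_derivative F' (s *\<^sub>R v + x) v) (at s within {0..1})"
      using linear_simps(5)[OF has_derivative_bounded_linear[OF F]]
      by (simp add: has_vector_derivative_def)
  qed auto
  moreover have "((\<lambda>s. LINT x:B|lborel. F (s *\<^sub>R v + x)) has_vector_derivative 0) (at 0 within {0..1})"
    by (rule has_vector_derivative_transform[OF _ _ has_vector_derivative_const]) (auto simp: const)
  ultimately have "(LINT x:B|lborel. F' (0 *\<^sub>R v + x) v) = 0"
    using vector_derivative_unique_within_closed_interval[of 0 1 0] by auto
  moreover have "(LINT x|lborel. F' x v) = (LINT x:B|lborel. F' x v)"
  proof (rule integral_eq_set_integral)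
    fix x assume "x \<notin> B"
    then have "R + norm v < norm x" unfolding B_def by simp
    then have "\<not> norm x \<le> R" using norm_ge_zero[of v] by linarith
    then show "F' x v = 0" using F'0 R by blast
  qed
  ultimately show ?thesis by simp
qed

subsection \<open>Solenoidal test fields\<close>

lemma smooth_on_component: "fat S \<Longrightarrow> smooth_on S f \<Longrightarrow> smooth_on S (\<lambda>x. f x $ i)"
  using smooth_on_linear[OF _ bounded_linear_vec_nth] .

lemma fat_UNIV: "fat UNIV"
  by (rule fat_open) simp

definition euclid_div :: "(real^'n \<Rightarrow> real^'n) \<Rightarrow> real^'n \<Rightarrow> real" where
  "euclid_div V x = (\<Sum>i\<in>UNIV. frechet_derivative V (at x) (axis i 1) $ i)"

text \<open>The fields are defined on the whole space and vanish off a compact part of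
  \<open>S\<close>. They can be integrated over the whole space without boundary terms, and a field
  paired with them matters only on \<open>S\<close>.\<close>

definition test_fields :: "(real^'n) set \<Rightarrow> (real^'n \<Rightarrow> real^'n) set" where
  "test_fields S = {V. smooth_on UNIV V \<and> (\<exists>K. compact K \<and> K \<subseteq> S \<and> (\<forall>x. x \<notin> K \<longrightarrow> V x = 0))}"

lemma euclid_div_eq:
  assumes "(V has_derivative V') (at x)"
  shows "euclid_div V x = (\<Sum>i\<in>UNIV. V' (axis i 1) $ i)"
  using frechet_derivative_at[OF assms] by (simp add: euclid_div_def)

lemma test_fields_has_derivative:
  "V \<in> test_fields S \<Longrightarrow> (V has_derivative frechet_derivative V (at x)) (at x)"
  unfolding test_fields_def using smooth_on_has_derivative[of UNIV V x] by simp

lemma test_fields_0: "(\<lambda>_. 0) \<in> test_fields S"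
  unfolding test_fields_def by (auto intro: smooth_on_const fat_UNIV)

lemma test_fields_add:
  assumes "V \<in> test_fields S" "W \<in> test_fields S" shows "(\<lambda>x. V x + W x) \<in> test_fields S"
proof -
  obtain K where "compact K" "K \<subseteq> S" "\<forall>x. x \<notin> K \<longrightarrow> V x = 0" using assms(1) by (auto simp: test_fields_def)
  moreover obtain L where "compact L" "L \<subseteq> S" "\<forall>x. x \<notin> L \<longrightarrow> W x = 0" using assms(2) by (auto simp: test_fields_def)
  ultimately have "\<exists>K. compact K \<and> K \<subseteq> S \<and> (\<forall>x. x \<notin> K \<longrightarrow> V x + W x = 0)"
    by (intro exI[of _ "K \<union> L"]) auto
  then show ?thesis using assms by (auto simp: test_fields_def intro: smooth_on_add fat_UNIV)
qed

lemma test_fields_minus: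
  assumes "V \<in> test_fields S" shows "(\<lambda>x. - V x) \<in> test_fields S"
  using assms by (auto simp: test_fields_def intro: smooth_on_minus fat_UNIV)

lemma euclid_div_add:
  assumes "V \<in> test_fields S" "W \<in> test_fields S"
  shows "euclid_div (\<lambda>x. V x + W x) x = euclid_div V x + euclid_div W x"
  by (subst euclid_div_eq[OF has_derivative_add[OF test_fields_has_derivative[OF assms(1)]
          test_fields_has_derivative[OF assms(2)]]])
    (simp add: euclid_div_def sum.distrib)

lemma euclid_div_minus:
  assumes "V \<in> test_fields S"
  shows "euclid_div (\<lambda>x. - V x) x = - euclid_div V x"
  by (subst euclid_div_eq[OF has_derivative_minus[OF test_fields_has_derivative[OF assms]]])
    (simp add: euclid_div_def sum_negf)

lemma integrable_test_field:
  assumes "V \<in> test_fields S" "continuous_on S \<beta>"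
  shows "integrable lborel (\<lambda>x. \<beta> x \<bullet> V x)"
proof -
  obtain K where K: "compact K" "K \<subseteq> S" "\<forall>x. x \<notin> K \<longrightarrow> V x = 0" using assms(1) by (auto simp: test_fields_def)
  have "continuous_on UNIV V" using assms(1) smooth_on_continuous by (auto simp: test_fields_def)
  then have "continuous_on K (\<lambda>x. \<beta> x \<bullet> V x)"
    using assms(2) K(2) by (intro continuous_on_inner) (auto intro: continuous_on_subset)
  from borel_integrable_compact[OF K(1) this] show ?thesis
    by (rule Bochner_Integration.integrable_cong[THEN iffD1, rotated -1]) (use K(3) in \<open>auto simp: indicator_def\<close>)
qed

text \<open>A product over the coordinates instead of a radial bump: integration along a coordinate
  axis then affects a single factor. It is not normalised; its mass is carried along as a
  factor.\<close>

definition mollifier :: "real \<Rightarrow> real^'n \<Rightarrow> real" where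
  "mollifier d x = (\<Prod>i\<in>UNIV. bump d (x $ i))"

lemma mollifier_nonneg: "mollifier d x \<ge> 0"
  unfolding mollifier_def by (intro prod_nonneg) (simp add: bump_nonneg)

lemma mollifier_eq_0: "\<bar>x $ i\<bar> \<ge> d \<Longrightarrow> mollifier d x = 0"
  unfolding mollifier_def by (simp add: prod_zero_iff) (use bump_eq_0 in blast)

lemma continuous_on_bump: "continuous_on S (bump d)"
  using smooth_on_continuous[OF smooth_on_bump] continuous_on_subset by blast

lemma continuous_on_mollifier:
  "continuous_on S f \<Longrightarrow> continuous_on S (\<lambda>x. mollifier d (f x))"
  unfolding mollifier_def
  by (intro continuous_on_prod continuous_on_compose2[OF continuous_on_bump[of UNIV]])
    (auto intro!: continuous_intros)

lemma mollifier_support: "mollifier d x \<noteq> 0 \<Longrightarrow> x \<in> cbox (\<chi> i. -d) (\<chi> i. d)"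
proof -
  assume "mollifier d x \<noteq> 0"
  then have "\<bar>x $ i\<bar> < d" for i using mollifier_eq_0[of d x i] by force
  then show ?thesis unfolding mem_box_cart by (auto simp: abs_less_iff less_imp_le) (metis less_imp_le minus_le_iff)
qed

lemma integrable_mollifier: "integrable lborel (mollifier d)"
proof -
  have "integrable lborel (\<lambda>x. indicator (cbox (\<chi> i. -d) (\<chi> i. d)) x *\<^sub>R mollifier d x)"
    by (rule borel_integrable_compact) (auto intro: continuous_on_mollifier continuous_on_id)
  then show ?thesis
    by (rule Bochner_Integration.integrable_cong[THEN iffD1, rotated -1])
      (use mollifier_support in \<open>auto simp: indicator_def\<close>)
qed

lemma integral_mollifier_pos:
  assumes "d > 0" shows "(LINT x|lborel. mollifier d (x::real^'n)) > 0"
proof -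
  have pos: "mollifier d (0::real^'n) > 0"
    unfolding mollifier_def by (intro prod_pos) (simp add: bump_pos assms)
  have cont: "isCont (mollifier d) (0::real^'n)"
    using continuous_on_mollifier[of UNIV "\<lambda>x::real^'n. x" d] by (simp add: continuous_on_eq_continuous_at)
  from mp[OF spec[OF cont[unfolded continuous_at_eps_delta]] half_gt_zero[OF pos]]
  obtain r where r: "r > 0"
      "\<forall>x::real^'n. dist x 0 < r \<longrightarrow> dist (mollifier d x) (mollifier d (0::real^'n)) < mollifier d (0::real^'n) / 2"
    by (elim exE conjE)
  define m where "m = mollifier d (0::real^'n) / 2"
  have "0 < m * measure lborel (ball (0::real^'n) r)"
    using content_ball_pos[OF r(1), of "0::real^'n"] pos by (simp add: m_def)
  also have "\<dots> = (LINT x|lborel. indicator (ball 0 r) (x::real^'n) *\<^sub>R m)"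
    by simp
  also have "\<dots> \<le> (LINT x|lborel. mollifier d (x::real^'n))"
  proof (rule integral_mono)
    show "integrable lborel (\<lambda>x. indicator (ball 0 r) (x::real^'n) *\<^sub>R m)"
      by (intro integrable_scaleR_left integrable_real_indicator) (auto simp: emeasure_bounded_finite[OF bounded_ball, unfolded infinity_ennreal_def])
    fix x :: "real^'n"
    show "indicator (ball 0 r) x *\<^sub>R m \<le> mollifier d x"
      using r(2)[rule_format, of x] mollifier_nonneg[of d x] by (auto simp: indicator_def dist_real_def dist_commute m_def abs_if split: if_splits)
  qed (rule integrable_mollifier)
  finally show ?thesis .
qed

lemma mollifier_split:
  "mollifier d x = bump d (x $ i) * (\<Prod>j\<in>UNIV-{i}. bump d (x $ j))"
  unfolding mollifier_def by (subst prod.remove[of _ i]) auto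

text \<open>Smearing the oriented segment from \<open>a\<close> to \<open>a + l e\<^sub>i\<close> gives a field whose divergence is the
  difference of two translated mollifiers. For axis-parallel segments it is an explicit product of
  one-variable functions, so that its smoothness needs no differentiation under an integral.\<close>

lemma segment_field:
  fixes a :: "real^'n"
  assumes "d > 0" "l \<ge> 0"
  obtains V where "smooth_on UNIV V"
    "\<forall>x. x \<notin> cbox (a - (\<chi> j. d)) (a + l *\<^sub>R axis i 1 + (\<chi> j. d)) \<longrightarrow> V x = 0"
    "\<forall>x. euclid_div V x = mollifier d (x - a) - mollifier d (x - (a + l *\<^sub>R axis i 1))"
    "\<forall>x. V x = (LINT s:{0..l}|lborel. mollifier d (x - (a + s *\<^sub>R axis i 1))) *\<^sub>R axis i 1"
proof -
  obtain \<Psi> where \<Psi>: "smooth_on UNIV \<Psi>" "\<And>x. (\<Psi> has_real_derivative bump d x) (at x)"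
    and const: "\<And>x y. x \<le> -d \<Longrightarrow> y \<le> -d \<Longrightarrow> \<Psi> x = \<Psi> y" "\<And>x y. x \<ge> d \<Longrightarrow> y \<ge> d \<Longrightarrow> \<Psi> x = \<Psi> y"
    using bump_antiderivative[of d] by metis
  \<comment> \<open>\<open>G\<close> is the integral of \<open>bump d (x $ i - (a $ i + s))\<close>
    over \<open>s\<close> from 0 to \<open>l\<close>; \<open>P\<close> collects the factors
    transverse to the segment.\<close>
  define G where "G x = \<Psi> (x $ i - a $ i) - \<Psi> (x $ i - (a $ i + l))" for x :: "real^'n"
  define P where "P x = (\<Prod>j\<in>UNIV-{i}. bump d (x $ j - a $ j))" for x :: "real^'n"
  define V where "V x = (G x * P x) *\<^sub>R axis i (1::real)" for x
  have aff: "smooth_on UNIV (\<lambda>x::real^'n. f (x $ j - c))" if "smooth_on UNIV f" for f :: "real \<Rightarrow> real" and j c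
    using smooth_on_affine[OF fat_UNIV bounded_linear_vec_nth[of j] _ that, of "-c"] by simp
  have smooth: "smooth_on UNIV V"
    unfolding V_def G_def P_def
    by (intro smooth_on_scaleR smooth_on_mult smooth_on_diff smooth_on_prod smooth_on_const fat_UNIV aff \<Psi> smooth_on_bump)
  have mol: "mollifier d (x - (a + s *\<^sub>R axis i 1)) = bump d (x $ i - (a $ i + s)) * P x" for x s
    unfolding P_def mollifier_split[of _ _ i] by (auto intro!: prod.cong simp: axis_def)
  have int: "V x = (LINT s:{0..l}|lborel. mollifier d (x - (a + s *\<^sub>R axis i 1))) *\<^sub>R axis i 1" for x
  proof -
    have "(LINT s|lborel. indicator {0..l} s *\<^sub>R (bump d (x $ i - (a $ i + s)) * P x)) =
        - \<Psi> (x $ i - (a $ i + l)) * P x - (- \<Psi> (x $ i - (a $ i + 0)) * P x)"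
    proof (rule integral_FTC_atLeastAtMost[OF assms(2)])
      show "continuous_on {0..l} (\<lambda>s. bump d (x $ i - (a $ i + s)) * P x)"
        by (intro continuous_intros continuous_on_compose2[OF continuous_on_bump[of UNIV]]) auto
      fix s :: real
      have "((\<lambda>s. - \<Psi> (x $ i - (a $ i + s)) * P x) has_real_derivative bump d (x $ i - (a $ i + s)) * P x) (at s)"
        by (auto intro!: derivative_eq_intros DERIV_chain'[of "\<lambda>s. x $ i - (a $ i + s)", OF _ \<Psi>(2)])
      then show "((\<lambda>s. - \<Psi> (x $ i - (a $ i + s)) * P x) has_vector_derivative bump d (x $ i - (a $ i + s)) * P x)
          (at s within {0..l})"
        by (simp add: has_real_derivative_iff_has_vector_derivative has_vector_derivative_at_within)
    qed
    then have "(LINT s:{0..l}|lborel. mollifier d (x - (a + s *\<^sub>R axis i 1))) = G x * P x"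
      by (simp add: G_def mol set_lebesgue_integral_def algebra_simps)
    then show ?thesis by (simp add: V_def)
  qed
  have supp: "V x = 0" if x: "x \<notin> cbox (a - (\<chi> j. d)) (a + l *\<^sub>R axis i 1 + (\<chi> j. d))" for x
  proof -
    have "mollifier d (x - (a + s *\<^sub>R axis i 1)) = 0" if s: "s \<in> {0..l}" for s
    proof (rule ccontr)
      assume "mollifier d (x - (a + s *\<^sub>R axis i 1)) \<noteq> 0"
      then have *: "\<bar>x $ j - (a $ j + s * axis i 1 $ j)\<bar> < d" for j
        using mollifier_eq_0[of d "x - (a + s *\<^sub>R axis i 1)" j] by force
      have "a $ j - d \<le> x $ j \<and> x $ j \<le> a $ j + l * axis i 1 $ j + d" for j
        using *[of j] s by (auto simp: axis_def abs_less_iff split: if_splits)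
      then show False using x unfolding mem_box_cart by auto
    qed
    then have "(LINT s:{0..l}|lborel. mollifier d (x - (a + s *\<^sub>R axis i 1))) = (LINT s:{0..l}|lborel. 0)"
      by (intro set_lebesgue_integral_cong) auto
    then show ?thesis unfolding int by (simp add: set_lebesgue_integral_def)
  qed
  have div: "euclid_div V x = mollifier d (x - a) - mollifier d (x - (a + l *\<^sub>R axis i 1))" for x
  proof -
    have G': "(G has_derivative (\<lambda>v. bump d (x $ i - a $ i) * v $ i - bump d (x $ i - (a $ i + l)) * v $ i)) (at x)"
      unfolding G_def
      by (auto intro!: derivative_eq_intros has_derivative_compose[of "\<lambda>x. x $ i - c" _ _ _ \<Psi> for c, OF _ \<Psi>(2)[unfolded has_field_derivative_def]]
          bounded_linear_imp_has_derivative bounded_linear_vec_nth)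
    define b where "b y = frechet_derivative (bump d) (at y)" for y
    have b: "(bump d has_derivative b y) (at y)" for y
      using smooth_on_has_derivative[OF smooth_on_bump, of y d] by (simp add: b_def)
    have P': "(P has_derivative (\<lambda>v. \<Sum>j\<in>UNIV-{i}. b (x $ j - a $ j) (v $ j) * (\<Prod>k\<in>UNIV-{i}-{j}. bump d (x $ k - a $ k)))) (at x)"
      unfolding P_def
      by (intro has_derivative_prod has_derivative_compose[OF _ b])
        (auto intro!: derivative_eq_intros bounded_linear_imp_has_derivative bounded_linear_vec_nth)
    have b0: "b y 0 = 0" for y using has_derivative_bounded_linear[OF b] linear_simps(3) by blast
    have "euclid_div V x = (\<Sum>j\<in>UNIV. ((G x * (\<Sum>k\<in>UNIV-{i}. b (x $ k - a $ k) (axis j 1 $ k) * (\<Prod>m\<in>UNIV-{i}-{k}. bump d (x $ m - a $ m)))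
        + (bump d (x $ i - a $ i) * axis j 1 $ i - bump d (x $ i - (a $ i + l)) * axis j 1 $ i) * P x) *\<^sub>R axis i 1) $ j)"
      unfolding V_def
      by (rule euclid_div_eq[OF has_derivative_scaleR_left[OF has_derivative_mult[OF G' P']]])
    also have "\<dots> = (\<Sum>j\<in>UNIV. if j = i then
        bump d (x $ i - a $ i) * P x - bump d (x $ i - (a $ i + l)) * P x else 0)"
    proof (rule sum.cong[OF refl])
      fix j
      \<comment> \<open>\<open>P\<close> does not depend on coordinate \<open>i\<close>, the only
        one along which \<open>V\<close> has a component, so the divergence comes from the
        derivative of \<open>G\<close> alone.\<close>
      have "(\<Sum>k\<in>UNIV-{i}. b (x $ k - a $ k) (axis j 1 $ k) * (\<Prod>m\<in>UNIV-{i}-{k}. bump d (x $ m - a $ m))) = 0" if "j = i"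
        by (rule sum.neutral) (use that b0 in \<open>auto simp: axis_def\<close>)
      then show "((G x * (\<Sum>k\<in>UNIV-{i}. b (x $ k - a $ k) (axis j 1 $ k) * (\<Prod>m\<in>UNIV-{i}-{k}. bump d (x $ m - a $ m)))
        + (bump d (x $ i - a $ i) * axis j 1 $ i - bump d (x $ i - (a $ i + l)) * axis j 1 $ i) * P x) *\<^sub>R axis i 1) $ j =
        (if j = i then bump d (x $ i - a $ i) * P x - bump d (x $ i - (a $ i + l)) * P x else 0)"
        by (auto simp: axis_def algebra_simps)
    qed
    also have "\<dots> = mollifier d (x - a) - mollifier d (x - (a + l *\<^sub>R axis i 1))"
      using mol[of x 0] mol[of x l] by simp
    finally show ?thesis .
  qed
  show thesis
    by (rule that[of V, OF smooth]) (intro allI impI supp div int; assumption)+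
qed

lemma coordinate_box_eq:
  fixes x a b :: "real^'n"
  shows "x \<in> cbox (a - (\<chi> j. d)) (b + (\<chi> j. d)) \<longleftrightarrow> (\<forall>j. a $ j - d \<le> x $ j \<and> x $ j \<le> b $ j + d)"
  by (simp add: mem_box_cart)

text \<open>By Fubini the pairing is an integral over \<open>s\<close> of
  \<open>\<beta> x $ i\<close> averaged against the mollifier centred at the point with parameter
  \<open>s\<close>. The mollifier lives within coordinate distance \<open>d\<close> of that point,
  so replacing the average by the value there costs at most \<open>e\<close> times the mass.\<close>

lemma segment_field_pairing:
  fixes a :: "real^'n" and \<beta> :: "real^'n \<Rightarrow> real^'n"
  assumes l: "l \<ge> 0" and C: "C = cbox (a - (\<chi> j. d)) (a + l *\<^sub>R axis i 1 + (\<chi> j. d))"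
    and cont: "continuous_on C \<beta>"
    and V: "\<And>x. x \<notin> C \<Longrightarrow> V x = 0"
      "\<And>x. V x = (LINT s:{0..l}|lborel. mollifier d (x - (a + s *\<^sub>R axis i 1))) *\<^sub>R axis i 1"
    and osc: "\<And>s x. s \<in> {0..l} \<Longrightarrow> (\<And>j. \<bar>x $ j - (a + s *\<^sub>R axis i 1) $ j\<bar> \<le> d) \<Longrightarrow>
      \<bar>\<beta> x $ i - \<beta> (a + s *\<^sub>R axis i 1) $ i\<bar> \<le> e"
    and d: "d > 0"
  shows "\<bar>(LINT x|lborel. \<beta> x \<bullet> V x) -
      (LINT s:{0..l}|lborel. \<beta> (a + s *\<^sub>R axis i 1) $ i) * (LINT x|lborel. mollifier d (x::real^'n))\<bar>
    \<le> e * l * (LINT x|lborel. mollifier d (x::real^'n))"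
proof -
  let ?p = "\<lambda>s. a + s *\<^sub>R axis i 1"
  define N where "N = (LINT x|lborel. mollifier d (x::real^'n))"
  \<comment> \<open>For \<open>s\<close> in \<open>{0..l}\<close> the mollifier already vanishes off
    \<open>C\<close>; the indicator confines the integrand to a compact set, on which it is
    continuous, so that Fubini applies.\<close>
  define f where "f s x = indicator ({0..l} \<times> C) (s, x) *\<^sub>R (\<beta> x $ i * mollifier d (x - ?p s))" for s x
  have inC: "x \<in> C" if "s \<in> {0..l}" "mollifier d (x - ?p s) \<noteq> 0" for s x
  proof -
    have *: "\<bar>x $ j - (a $ j + s * axis i 1 $ j)\<bar> < d" for j
      using mollifier_eq_0[of d "x - ?p s" j] that(2) by force
    have "a $ j - d \<le> x $ j \<and> x $ j \<le> (a + l *\<^sub>R axis i 1) $ j + d" for j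
      using *[of j] that(1) by (auto simp: axis_def abs_less_iff split: if_splits)
    then show ?thesis unfolding C coordinate_box_eq by blast
  qed
  have pC: "?p s \<in> C" if "s \<in> {0..l}" for s
    unfolding C coordinate_box_eq using that d by (auto simp: axis_def)
  have bi: "continuous_on C (\<lambda>x. \<beta> x $ i)" by (intro continuous_intros cont)
  have "continuous_on ({0..l} \<times> C) (\<lambda>(s, x). \<beta> x $ i * mollifier d (x - ?p s))"
    unfolding case_prod_beta
    by (intro continuous_on_mult continuous_on_mollifier continuous_on_compose2[OF bi] continuous_intros) auto
  then have "integrable lborel (\<lambda>z. indicator ({0..l} \<times> C) z *\<^sub>R (case z of (s, x) \<Rightarrow> \<beta> x $ i * mollifier d (x - ?p s)))"
    by (intro borel_integrable_compact) (auto simp: C compact_Times)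
  then have int_f: "integrable (lborel \<Otimes>\<^sub>M lborel) (\<lambda>(s, x). f s x)"
    unfolding f_def lborel_prod by (simp add: case_prod_unfold)
  from lborel_pair.Fubini_integral[OF int_f]
  have fub: "(LINT x|lborel. LINT s|lborel. f s x) = (LINT s|lborel. LINT x|lborel. f s x)" .
  have 1: "(LINT s|lborel. f s x) = \<beta> x \<bullet> V x" for x
  proof (cases "x \<in> C")
    case True
    have "(LINT s|lborel. f s x) = (LINT s|lborel. \<beta> x $ i * (indicator {0..l} s *\<^sub>R mollifier d (x - ?p s)))"
      by (rule Bochner_Integration.integral_cong) (auto simp: f_def True indicator_def)
    also have "\<dots> = \<beta> x $ i * (LINT s:{0..l}|lborel. mollifier d (x - ?p s))"
      unfolding set_lebesgue_integral_def by (rule integral_mult_right_zero)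
    finally show ?thesis unfolding V(2) by (simp add: inner_axis mult.commute)
  next
    case False
    then show ?thesis using V(1) by (simp add: f_def)
  qed
  define h where "h s = (LINT x|lborel. f s x)" for s
  have 2: "h s = 0" if "s \<notin> {0..l}" for s
  proof -
    have "f s x = 0" for x using that by (auto simp: f_def)
    then show ?thesis by (simp add: h_def)
  qed
  have trans: "integrable lborel (\<lambda>x. mollifier d (x - ?p s))" "(LINT x|lborel. mollifier d (x - ?p s)) = N" for s
  proof -
    have m: "mollifier d \<in> borel_measurable (borel :: (real^'n) measure)"
      using continuous_on_mollifier[of UNIV "\<lambda>x::real^'n. x" d] by (simp add: borel_measurable_continuous_onI)
    have "integrable (distr lborel borel ((+) (- ?p s))) (mollifier d)"
      unfolding lborel_distr_plus by (rule integrable_mollifier)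
    then have "integrable lborel (\<lambda>x. mollifier d (- ?p s + x))"
      by (subst (asm) integrable_distr_eq) (use m in auto)
    then show "integrable lborel (\<lambda>x. mollifier d (x - ?p s))" by (simp add: algebra_simps)
    show "(LINT x|lborel. mollifier d (x - ?p s)) = N"
      using lborel_integral_translation[OF m, of "- ?p s"] by (simp add: N_def algebra_simps)
  qed
  have 3: "\<bar>h s - \<beta> (?p s) $ i * N\<bar> \<le> e * N" if s: "s \<in> {0..l}" for s
  proof -
    have fs: "f s x = \<beta> x $ i * mollifier d (x - ?p s)" for x
      using inC[OF s, of x] s by (cases "x \<in> C") (auto simp: f_def)
    have "integrable lborel (\<lambda>x. indicator C x *\<^sub>R (\<beta> x $ i * mollifier d (x - ?p s)))"
      by (intro borel_integrable_compact continuous_on_mult bi continuous_on_mollifier continuous_intros) (simp add: C)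
    then have int: "integrable lborel (f s)"
      by (rule Bochner_Integration.integrable_cong[THEN iffD1, rotated -1])
        (use s in \<open>auto simp: f_def indicator_def\<close>)
    have "h s - \<beta> (?p s) $ i * N = (LINT x|lborel. f s x - \<beta> (?p s) $ i * mollifier d (x - ?p s))"
      unfolding h_def using int trans by (subst Bochner_Integration.integral_diff) auto
    also have "norm \<dots> \<le> (LINT x|lborel. e * mollifier d (x - ?p s))"
    proof (rule Bochner_Integration.integral_norm_bound_integral)
      show "integrable lborel (\<lambda>x. f s x - \<beta> (?p s) $ i * mollifier d (x - ?p s))"
        using int trans by auto
      show "integrable lborel (\<lambda>x. e * mollifier d (x - ?p s))" using trans by auto
      fix x
      show "norm (f s x - \<beta> (?p s) $ i * mollifier d (x - ?p s)) \<le> e * mollifier d (x - ?p s)"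
      proof (cases "mollifier d (x - ?p s) = 0")
        case False
        then have "\<bar>x $ j - ?p s $ j\<bar> \<le> d" for j
          using mollifier_eq_0[of d "x - ?p s" j] by force
        then have "\<bar>\<beta> x $ i - \<beta> (?p s) $ i\<bar> \<le> e" using osc[OF s] by blast
        then show ?thesis
          by (simp add: fs left_diff_distrib[symmetric] abs_mult mollifier_nonneg mult_right_mono)
      qed (simp add: fs)
    qed
    finally show ?thesis using trans by simp
  qed
  have ci: "continuous_on {0..l} (\<lambda>s. \<beta> (?p s) $ i * N)"
    by (intro continuous_intros continuous_on_compose2[OF cont]) (use pC in auto)
  have inth: "integrable lborel h"
    unfolding h_def using lborel_pair.integrable_fst'[OF int_f] by simp
  have "(LINT x|lborel. \<beta> x \<bullet> V x) = (LINT s|lborel. h s)"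
    using fub unfolding 1 h_def by simp
  also have "\<dots> = (LINT s:{0..l}|lborel. h s)"
    by (rule integral_eq_set_integral) (rule 2)
  finally have "(LINT x|lborel. \<beta> x \<bullet> V x) - (LINT s:{0..l}|lborel. \<beta> (?p s) $ i) * N =
      (LINT s:{0..l}|lborel. h s - \<beta> (?p s) $ i * N)"
  proof (subst set_integral_diff)
    show "set_integrable lborel {0..l} h"
      unfolding set_integrable_def using inth by (intro integrable_mult_indicator) auto
    show "set_integrable lborel {0..l} (\<lambda>s. \<beta> (?p s) $ i * N)"
      by (rule set_integrable_compact[OF compact_Icc ci])
  qed simp
  also have "norm \<dots> \<le> (LINT s:{0..l}|lborel. e * N)"
    unfolding set_lebesgue_integral_def
  proof (rule Bochner_Integration.integral_norm_bound_integral)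
    show "integrable lborel (\<lambda>s. indicator {0..l} s *\<^sub>R (h s - \<beta> (?p s) $ i * N))"
      unfolding scaleR_diff_right
      by (intro Bochner_Integration.integrable_diff integrable_mult_indicator inth
          borel_integrable_compact[OF compact_Icc ci]) simp
    show "integrable lborel (\<lambda>s. indicator {0..l} s *\<^sub>R (e * N))"
      by (intro borel_integrable_compact) auto
    fix s :: real
    show "norm (indicator {0..l} s *\<^sub>R (h s - \<beta> (?p s) $ i * N)) \<le> indicator {0..l} s *\<^sub>R (e * N)"
      using 3[of s] by (auto simp: indicator_def)
  qed
  also have "\<dots> = e * l * N" using l by (simp add: set_lebesgue_integral_def)
  finally show ?thesis by (simp add: N_def)
qed

text \<open>The field transports the mollifier at \<open>a\<close> to the mollifier at
  \<open>b\<close>. It need not come from a path, so that concatenation is mere addition of fields.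
  Value and error are both multiplied by the mass because the mollifier is not normalised.\<close>

definition mollified_path ::
  "(real^'n) set \<Rightarrow> (real^'n \<Rightarrow> real^'n) \<Rightarrow> real^'n \<Rightarrow> real^'n \<Rightarrow> real \<Rightarrow> real \<Rightarrow> real \<Rightarrow> bool" where
  "mollified_path S \<beta> a b c e d \<longleftrightarrow>
     (\<exists>V\<in>test_fields S. (\<forall>x. euclid_div V x = mollifier d (x - a) - mollifier d (x - b)) \<and>
       \<bar>(LINT x|lborel. \<beta> x \<bullet> V x) - c * (LINT x|lborel. mollifier d (x::real^'n))\<bar>
         \<le> e * (LINT x|lborel. mollifier d (x::real^'n)))"

text \<open>\<open>increment S \<beta> a b c\<close>: thin smeared paths from \<open>a\<close> to \<open>b\<close> inside \<open>S\<close> give the value \<open>c\<close> to the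
  line integral of \<open>\<beta>\<close>.\<close>

definition increment :: "(real^'n) set \<Rightarrow> (real^'n \<Rightarrow> real^'n) \<Rightarrow> real^'n \<Rightarrow> real^'n \<Rightarrow> real \<Rightarrow> bool" where
  "increment S \<beta> a b c \<longleftrightarrow> (\<forall>e>0. eventually (mollified_path S \<beta> a b c e) (at_right 0))"

lemma increment_refl:
  fixes S :: "(real^'n) set"
  shows "increment S \<beta> a a 0"
proof -
  have "mollified_path S \<beta> a a 0 e d" if "0 < e" "0 < d" for e d
    unfolding mollified_path_def
  proof (intro conjI bexI allI)
    show "(\<lambda>_. 0) \<in> test_fields S" by (rule test_fields_0)
    show "euclid_div (\<lambda>_. 0) x = mollifier d (x - a) - mollifier d (x - a)" for x
      by (subst euclid_div_eq[OF has_derivative_const]) simp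
  qed (use integral_mollifier_pos[OF \<open>0 < d\<close>, where 'n = 'n] that in \<open>simp add: less_imp_le\<close>)
  then show ?thesis
    unfolding increment_def by (intro allI impI eventually_mono[OF eventually_at_right_less])
qed

lemma increment_sym:
  fixes S :: "(real^'n) set"
  assumes "increment S \<beta> a b c" shows "increment S \<beta> b a (- c)"
proof -
  have "mollified_path S \<beta> b a (- c) e d" if path: "mollified_path S \<beta> a b c e d" for e d
  proof -
    from path[unfolded mollified_path_def] obtain V where
      V: "V \<in> test_fields S" "\<forall>x. euclid_div V x = mollifier d (x - a) - mollifier d (x - b)"
       "\<bar>(LINT x|lborel. \<beta> x \<bullet> V x) - c * (LINT x|lborel. mollifier d (x::real^'n))\<bar> \<le> e * (LINT x|lborel. mollifier d (x::real^'n))"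
      by (elim bexE conjE)
    show ?thesis
      unfolding mollified_path_def
      using V test_fields_minus[OF V(1)] euclid_div_minus[OF V(1)]
      by (intro bexI[of _ "\<lambda>x. - V x"]) (auto simp: abs_if split: if_splits)
  qed
  then show ?thesis using assms unfolding increment_def by (metis (mono_tags, lifting) eventually_mono)
qed

text \<open>The sources at \<open>b\<close> cancel only if both fields use the same
  \<open>d\<close>. For this reason an increment demands fields for all small \<open>d\<close> and
  not just for some.\<close>

lemma increment_trans:
  fixes S :: "(real^'n) set"
  assumes "increment S \<beta> a b c" "increment S \<beta> b p c'" "continuous_on S \<beta>"
  shows "increment S \<beta> a p (c + c')"
  unfolding increment_def
proof (intro allI impI)
  fix e :: real assume "e > 0"
  have path: "mollified_path S \<beta> a p (c + c') e d"
    if path: "mollified_path S \<beta> a b c (e / 2) d" "mollified_path S \<beta> b p c' (e / 2) d" for d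
  proof -
    from path(1)[unfolded mollified_path_def] obtain V where
      V: "V \<in> test_fields S" "\<forall>x. euclid_div V x = mollifier d (x - a) - mollifier d (x - b)"
       "\<bar>(LINT x|lborel. \<beta> x \<bullet> V x) - c * (LINT x|lborel. mollifier d (x::real^'n))\<bar> \<le> e / 2 * (LINT x|lborel. mollifier d (x::real^'n))"
      by (elim bexE conjE)
    from path(2)[unfolded mollified_path_def] obtain W where
      W: "W \<in> test_fields S" "\<forall>x. euclid_div W x = mollifier d (x - b) - mollifier d (x - p)"
       "\<bar>(LINT x|lborel. \<beta> x \<bullet> W x) - c' * (LINT x|lborel. mollifier d (x::real^'n))\<bar> \<le> e / 2 * (LINT x|lborel. mollifier d (x::real^'n))"
      by (elim bexE conjE)
    have "(LINT x|lborel. \<beta> x \<bullet> (V x + W x)) = (LINT x|lborel. \<beta> x \<bullet> V x) + (LINT x|lborel. \<beta> x \<bullet> W x)"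
      using integrable_test_field[OF V(1) assms(3)] integrable_test_field[OF W(1) assms(3)]
      by (simp add: inner_add_right)
    moreover have "e / 2 * N + e / 2 * N = e * N" for N :: real by simp
    ultimately have "\<bar>(LINT x|lborel. \<beta> x \<bullet> (V x + W x)) - (c + c') * (LINT x|lborel. mollifier d (x::real^'n))\<bar>
         \<le> e * (LINT x|lborel. mollifier d (x::real^'n))"
      using V(3) W(3) unfolding distrib_right by linarith
    then show ?thesis
      unfolding mollified_path_def
      using V(2) W(2) test_fields_add[OF V(1) W(1)] euclid_div_add[OF V(1) W(1)]
      by (intro bexI[of _ "\<lambda>x. V x + W x"]) auto
  qed
  have "e / 2 > 0" using \<open>e > 0\<close> by simp
  then have "eventually (mollified_path S \<beta> a b c (e / 2)) (at_right 0)"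
    "eventually (mollified_path S \<beta> b p c' (e / 2)) (at_right 0)"
    using assms(1,2) unfolding increment_def by auto
  then show "eventually (mollified_path S \<beta> a p (c + c') e) (at_right 0)"
    by eventually_elim (rule path)
qed

definition annihilates_solenoidal :: "(real^'n) set \<Rightarrow> (real^'n \<Rightarrow> real^'n) \<Rightarrow> bool" where
  "annihilates_solenoidal S \<beta> \<longleftrightarrow>
    (\<forall>V\<in>test_fields S. (\<forall>x. euclid_div V x = 0) \<longrightarrow> (LINT x|lborel. \<beta> x \<bullet> V x) = 0)"

text \<open>Two values for the same endpoints produce a loop, hence a field of zero divergence whose
  pairing with \<open>\<beta>\<close> vanishes. The tolerance \<open>e\<close>, half the gap between
  the values, then contradicts the error bound.\<close>

lemma increment_unique:
  fixes S :: "(real^'n) set"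
  assumes "increment S \<beta> a b c" "increment S \<beta> a b c'" "continuous_on S \<beta>" "annihilates_solenoidal S \<beta>"
  shows "c = c'"
proof (rule ccontr)
  assume "c \<noteq> c'"
  define e where "e = \<bar>c - c'\<bar> / 2"
  have e: "e > 0" using \<open>c \<noteq> c'\<close> by (simp add: e_def)
  have "increment S \<beta> a a (c + - c')" by (rule increment_trans[OF assms(1) increment_sym[OF assms(2)] assms(3)])
  then have "eventually (mollified_path S \<beta> a a (c + - c') e) (at_right 0)"
    using e unfolding increment_def by blast
  then have "eventually (\<lambda>d. 0 < d \<and> mollified_path S \<beta> a a (c + - c') e d) (at_right 0)"
    by (intro eventually_conj eventually_at_right_less)
  then obtain d where d: "0 < d" and path: "mollified_path S \<beta> a a (c + - c') e d"
    using eventually_happens trivial_limit_at_right_real by blast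
  from path[unfolded mollified_path_def] obtain V where
    V: "V \<in> test_fields S" "\<forall>x. euclid_div V x = mollifier d (x - a) - mollifier d (x - a)"
      "\<bar>(LINT x|lborel. \<beta> x \<bullet> V x) - (c + - c') * (LINT x|lborel. mollifier d (x::real^'n))\<bar> \<le> e * (LINT x|lborel. mollifier d (x::real^'n))"
    by (elim bexE conjE)
  define N where "N = (LINT x|lborel. mollifier d (x::real^'n))"
  have N: "N > 0" unfolding N_def by (rule integral_mollifier_pos[OF d])
  have "(LINT x|lborel. \<beta> x \<bullet> V x) = 0" using assms(4) V(1,2) unfolding annihilates_solenoidal_def by simp
  then have "\<bar>c - c'\<bar> * N \<le> e * N" using V(3) N unfolding N_def[symmetric] by (simp add: abs_mult)
  then have "\<bar>c - c'\<bar> \<le> e" using N by simp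
  then show False using e by (simp add: e_def)
qed

lemma increment_segment:
  fixes a :: "real^'n"
  assumes l: "l \<ge> 0" and d1: "d1 > 0" and cont: "continuous_on S \<beta>"
    and sub: "cbox (a - (\<chi> j. d1)) (a + l *\<^sub>R axis i 1 + (\<chi> j. d1)) \<subseteq> S" (is "?C \<subseteq> S")
  shows "increment S \<beta> a (a + l *\<^sub>R axis i 1) (LINT s:{0..l}|lborel. \<beta> (a + s *\<^sub>R axis i 1) $ i)"
  unfolding increment_def
proof (intro allI impI)
  fix e :: real assume e: "e > 0"
  \<comment> \<open>The error of the pairing will be \<open>e' * l\<close> times the mass; the
    \<open>+ 1\<close> admits a segment of length 0.\<close>
  define e' where "e' = e / (l + 1)"
  have e': "e' > 0" "e' * l \<le> e" using e l by (auto simp: e'_def field_simps add_nonneg_pos)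
  have contC: "continuous_on ?C \<beta>" using cont sub continuous_on_subset by blast
  have "uniformly_continuous_on ?C \<beta>"
    by (intro compact_uniformly_continuous contC compact_cbox)
  from this[unfolded uniformly_continuous_on_def, rule_format, OF e'(1)]
  obtain d2 where d2: "d2 > 0" "\<And>x y. x \<in> ?C \<Longrightarrow> y \<in> ?C \<Longrightarrow> dist y x < d2 \<Longrightarrow> dist (\<beta> y) (\<beta> x) < e'" by blast
  \<comment> \<open>Differences of at most \<open>d\<close> in every coordinate bound the Euclidean
    distance by \<open>CARD('n) * d\<close>.\<close>
  define d0 where "d0 = min d1 (d2 / real CARD('n))"
  have d0: "d0 > 0" using d1 d2 by (simp add: d0_def)
  have "mollified_path S \<beta> a (a + l *\<^sub>R axis i 1) (LINT s:{0..l}|lborel. \<beta> (a + s *\<^sub>R axis i 1) $ i) e d"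
    if d: "0 < d \<and> d < d0" for d
  proof -
    define C where "C = cbox (a - (\<chi> j. d)) (a + l *\<^sub>R axis i 1 + (\<chi> j. d))"
    have CC: "C \<subseteq> ?C"
    proof
      fix x assume "x \<in> C"
      then have *: "a $ j - d \<le> x $ j \<and> x $ j \<le> (a + l *\<^sub>R axis i 1) $ j + d" for j
        unfolding C_def coordinate_box_eq by blast
      have "d \<le> d1" using d by (simp add: d0_def)
      have "a $ j - d1 \<le> x $ j \<and> x $ j \<le> (a + l *\<^sub>R axis i 1) $ j + d1" for j
        using *[of j] \<open>d \<le> d1\<close> by linarith
      then show "x \<in> ?C" unfolding coordinate_box_eq by blast
    qed
    obtain V where V: "smooth_on UNIV V" "\<forall>x. x \<notin> C \<longrightarrow> V x = 0"
        "\<forall>x. euclid_div V x = mollifier d (x - a) - mollifier d (x - (a + l *\<^sub>R axis i 1))"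
        "\<forall>x. V x = (LINT s:{0..l}|lborel. mollifier d (x - (a + s *\<^sub>R axis i 1))) *\<^sub>R axis i 1"
      by (rule segment_field[OF conjunct1[OF d] l, of a i, folded C_def])
    have "V \<in> test_fields S"
      unfolding test_fields_def using V(1,2) CC sub by (auto simp: C_def intro!: exI[of _ C])
    moreover have "\<bar>(LINT x|lborel. \<beta> x \<bullet> V x) -
        (LINT s:{0..l}|lborel. \<beta> (a + s *\<^sub>R axis i 1) $ i) * (LINT x|lborel. mollifier d (x::real^'n))\<bar>
        \<le> e' * l * (LINT x|lborel. mollifier d (x::real^'n))"
    proof (rule segment_field_pairing[OF l C_def _ V(2)[rule_format] V(4)[rule_format]])
      show "continuous_on C \<beta>" using contC CC continuous_on_subset by blast
      fix s x assume s: "s \<in> {0..l}" and x: "\<And>j. \<bar>x $ j - (a + s *\<^sub>R axis i 1) $ j\<bar> \<le> d"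
      have "a $ j - d \<le> x $ j \<and> x $ j \<le> (a + l *\<^sub>R axis i 1) $ j + d" for j
        using x[of j] s by (auto simp: axis_def abs_le_iff split: if_splits)
      then have "x \<in> C" unfolding C_def coordinate_box_eq by blast
      moreover have "a + s *\<^sub>R axis i 1 \<in> C" unfolding C_def coordinate_box_eq using s d by (auto simp: axis_def)
      moreover have "dist x (a + s *\<^sub>R axis i 1) < d2"
      proof -
        have "norm (x - (a + s *\<^sub>R axis i 1)) \<le> (\<Sum>j\<in>UNIV. \<bar>(x - (a + s *\<^sub>R axis i 1)) $ j\<bar>)" by (rule norm_le_l1_cart)
        also have "\<dots> \<le> (\<Sum>j\<in>(UNIV::'n set). d)" using x by (intro sum_mono) simp
        also have "\<dots> < d2" using d by (simp add: d0_def field_simps)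
        finally show ?thesis by (simp add: dist_norm)
      qed
      ultimately have "dist (\<beta> x) (\<beta> (a + s *\<^sub>R axis i 1)) < e'" using d2(2) CC by blast
      moreover have "\<bar>(\<beta> x - \<beta> (a + s *\<^sub>R axis i 1)) $ i\<bar> \<le> norm (\<beta> x - \<beta> (a + s *\<^sub>R axis i 1))"
        by (rule component_le_norm_cart)
      ultimately show "\<bar>\<beta> x $ i - \<beta> (a + s *\<^sub>R axis i 1) $ i\<bar> \<le> e'" by (simp add: dist_norm)
    qed (use d in auto)
    moreover have "e' * l * (LINT x|lborel. mollifier d (x::real^'n)) \<le> e * (LINT x|lborel. mollifier d (x::real^'n))"
      using e'(2) integral_mollifier_pos[of d, where 'n = 'n] d by (intro mult_right_mono) auto
    ultimately show ?thesis unfolding mollified_path_def using V(3) by (intro bexI[of _ V]) auto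
  qed
  then show "eventually (mollified_path S \<beta> a (a + l *\<^sub>R axis i 1) (LINT s:{0..l}|lborel. \<beta> (a + s *\<^sub>R axis i 1) $ i) e) (at_right 0)"
    using d0 unfolding eventually_at_right_field by (intro exI[of _ d0]) simp
qed

subsection \<open>Potentials of fields annihilating solenoidal test fields\<close>

text \<open>Start and end lie in the box of half the size, so the segment thickened by
  \<open>r / 2\<close> stays inside \<open>B\<close>. Steps in the negative direction are obtained
  later by reversing positive ones.\<close>

lemma increment_axis_step:
  fixes a p :: "real^'n"
  assumes r: "r > 0" and B: "B = cbox (a - (\<chi> j. r)) (a + (\<chi> j. r))" "B \<subseteq> S"
    and cont: "continuous_on S \<beta>" and osc: "\<And>x i. x \<in> B \<Longrightarrow> \<bar>\<beta> x $ i - \<beta> a $ i\<bar> \<le> w"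
    and p: "\<And>j. \<bar>p $ j - a $ j\<bar> \<le> r / 2" "\<bar>p $ i + l - a $ i\<bar> \<le> r / 2" and l: "l \<ge> 0"
  shows "\<exists>c. increment S \<beta> p (p + l *\<^sub>R axis i 1) c \<and> \<bar>c - \<beta> a $ i * l\<bar> \<le> w * l"
proof (intro exI conjI)
  let ?c = "LINT s:{0..l}|lborel. \<beta> (p + s *\<^sub>R axis i 1) $ i"
  have pt: "(p + s *\<^sub>R axis i 1) $ j = (if j = i then p $ i + s else p $ j)" for s j
    by (simp add: axis_def)
  have seg: "p + s *\<^sub>R axis i 1 \<in> B" if s: "s \<in> {0..l}" for s
  proof -
    have "a $ j - r \<le> (p + s *\<^sub>R axis i 1) $ j \<and> (p + s *\<^sub>R axis i 1) $ j \<le> a $ j + r" for j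
      using p(1)[of j] p(2) s r unfolding pt by (smt (verit) atLeastAtMost_iff field_sum_of_halves)
    then show ?thesis unfolding B coordinate_box_eq by blast
  qed
  show "increment S \<beta> p (p + l *\<^sub>R axis i 1) ?c"
  proof (rule increment_segment[OF l _ cont])
    show "r / 2 > 0" using r by simp
    show "cbox (p - (\<chi> j. r / 2)) (p + l *\<^sub>R axis i 1 + (\<chi> j. r / 2)) \<subseteq> S"
    proof
      fix x assume "x \<in> cbox (p - (\<chi> j. r / 2)) (p + l *\<^sub>R axis i 1 + (\<chi> j. r / 2))"
      then have x: "p $ j - r / 2 \<le> x $ j \<and> x $ j \<le> (p + l *\<^sub>R axis i 1) $ j + r / 2" for j
        unfolding coordinate_box_eq by blast
      have "a $ j - r \<le> x $ j \<and> x $ j \<le> a $ j + r" for j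
        using x[of j] p(1)[of j] p(2) r l unfolding pt by (smt (verit) field_sum_of_halves)
      then have "x \<in> B" unfolding B coordinate_box_eq by blast
      then show "x \<in> S" using B(2) by blast
    qed
  qed
  have c: "continuous_on {0..l} (\<lambda>s. \<beta> (p + s *\<^sub>R axis i 1) $ i)"
    using seg B(2) by (intro continuous_intros continuous_on_compose2[OF cont]) auto
  have "?c - \<beta> a $ i * l = (LINT s:{0..l}|lborel. \<beta> (p + s *\<^sub>R axis i 1) $ i - \<beta> a $ i)"
    using l by (subst set_integral_diff) (auto intro!: set_integrable_compact c simp: set_lebesgue_integral_def)
  also have "norm \<dots> \<le> w * measure lborel {0..l}"
    by (rule set_integral_compact_bound) (use c seg osc in \<open>auto intro!: continuous_intros\<close>)
  finally show "\<bar>?c - \<beta> a $ i * l\<bar> \<le> w * l" using l by simp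
qed

text \<open>The coordinates of \<open>a\<close> are replaced by those of \<open>b\<close> one after
  the other. Every corner on the way stays in the half-size box, and the errors of the steps add up
  to \<open>w\<close> times the l1 distance.\<close>

lemma increment_box:
  fixes a b :: "real^'n"
  assumes r: "r > 0" and B: "B = cbox (a - (\<chi> j. r)) (a + (\<chi> j. r))" "B \<subseteq> S"
    and cont: "continuous_on S \<beta>" and osc: "\<And>x i. x \<in> B \<Longrightarrow> \<bar>\<beta> x $ i - \<beta> a $ i\<bar> \<le> w"
    and b: "\<And>j. \<bar>b $ j - a $ j\<bar> \<le> r / 2"
  shows "\<exists>c. increment S \<beta> a b c \<and> \<bar>c - \<beta> a \<bullet> (b - a)\<bar> \<le> w * (\<Sum>j\<in>UNIV. \<bar>b $ j - a $ j\<bar>)"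
proof -
  have "\<exists>c. increment S \<beta> a (\<chi> j. if j \<in> J then b $ j else a $ j) c \<and>
      \<bar>c - (\<Sum>j\<in>J. \<beta> a $ j * (b $ j - a $ j))\<bar> \<le> w * (\<Sum>j\<in>J. \<bar>b $ j - a $ j\<bar>)" if "finite J" for J
    using that
  proof (induction J)
    case empty
    have "(\<chi> j. if j \<in> {} then b $ j else a $ j) = a" by (simp add: vec_eq_iff)
    then show ?case using increment_refl[of S \<beta> a] by (intro exI[of _ 0]) simp
  next
    case (insert i J)
    define p where "p = (\<chi> j. if j \<in> J then b $ j else a $ j)"
    define q where "q = (\<chi> j. if j \<in> insert i J then b $ j else a $ j)"
    obtain c where c: "increment S \<beta> a p c"
      "\<bar>c - (\<Sum>j\<in>J. \<beta> a $ j * (b $ j - a $ j))\<bar> \<le> w * (\<Sum>j\<in>J. \<bar>b $ j - a $ j\<bar>)"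
      using insert.IH unfolding p_def by blast
    define l where "l = b $ i - a $ i"
    have pq: "q = p + l *\<^sub>R axis i 1" "p = q + (- l) *\<^sub>R axis i 1"
      using insert.hyps by (auto simp: p_def q_def l_def vec_eq_iff axis_def)
    have half: "\<bar>p $ j - a $ j\<bar> \<le> r / 2" "\<bar>q $ j - a $ j\<bar> \<le> r / 2" for j
      using b[of j] r by (auto simp: p_def q_def)
    have "\<exists>c'. increment S \<beta> p q c' \<and> \<bar>c' - \<beta> a $ i * l\<bar> \<le> w * \<bar>l\<bar>"
    proof (cases "l \<ge> 0")
      case True
      have "p $ i + l = q $ i" using pq(1) by (simp add: axis_def)
      then show ?thesis
        using increment_axis_step[OF r B cont osc half(1) _ True, of i] half(2)[of i] True
        unfolding pq(1)[symmetric] by simp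
    next
      \<comment> \<open>When the coordinate decreases, the step is taken from \<open>q\<close> to
        \<open>p\<close> and its increment is reversed.\<close>
      case False
      have "q $ i + - l = p $ i" using pq(2) by (simp add: axis_def)
      then have "\<exists>c'. increment S \<beta> q p c' \<and> \<bar>c' - \<beta> a $ i * (- l)\<bar> \<le> w * (- l)"
        using increment_axis_step[OF r B cont osc half(2), of i "-l"] half(1)[of i] False
        unfolding pq(2)[symmetric] by simp
      then obtain c' where c': "increment S \<beta> q p c'" "\<bar>c' - \<beta> a $ i * (- l)\<bar> \<le> w * (- l)" by blast
      have "\<bar>- c' - \<beta> a $ i * l\<bar> \<le> w * \<bar>l\<bar>" using c'(2) False by (simp add: abs_if split: if_splits)
      then show ?thesis using increment_sym[OF c'(1)] by blast
    qed
    then obtain c' where c': "increment S \<beta> p q c'" "\<bar>c' - \<beta> a $ i * l\<bar> \<le> w * \<bar>l\<bar>" by blast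
    have "increment S \<beta> a q (c + c')" by (rule increment_trans[OF c(1) c'(1) cont])
    moreover have "\<bar>c + c' - (\<Sum>j\<in>insert i J. \<beta> a $ j * (b $ j - a $ j))\<bar> \<le> w * (\<Sum>j\<in>insert i J. \<bar>b $ j - a $ j\<bar>)"
      using c(2) c'(2) insert.hyps unfolding l_def by (simp add: distrib_left)
    ultimately show ?case unfolding q_def by blast
  qed
  from this[of UNIV] show ?thesis by (simp add: inner_vec_def)
qed

lemma small_box:
  fixes a :: "real^'n"
  assumes "open S" "a \<in> S" "continuous_on S \<beta>" "w > 0"
  shows "\<exists>r>0. cbox (a - (\<chi> j. r)) (a + (\<chi> j. r)) \<subseteq> S \<and>
    (\<forall>x\<in>cbox (a - (\<chi> j. r)) (a + (\<chi> j. r)). \<forall>i. \<bar>(\<beta> x :: real^'m) $ i - \<beta> a $ i\<bar> \<le> w)"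
proof -
  obtain d1 where d1: "d1 > 0" "ball a d1 \<subseteq> S" using assms(1,2) open_contains_ball by blast
  obtain d2 where d2: "d2 > 0" "\<forall>x\<in>S. dist x a < d2 \<longrightarrow> dist (\<beta> x) (\<beta> a) < w"
    using assms(2-4) unfolding continuous_on_iff by blast
  define r where "r = min d1 d2 / (2 * real CARD('n))"
  have r: "r > 0" using d1 d2 by (simp add: r_def)
  have near: "dist x a < min d1 d2" if "x \<in> cbox (a - (\<chi> j. r)) (a + (\<chi> j. r))" for x
  proof -
    have "a $ j - r \<le> x $ j \<and> x $ j \<le> a $ j + r" for j
      using that unfolding coordinate_box_eq by blast
    then have j: "\<bar>(x - a) $ j\<bar> \<le> r" for j unfolding abs_le_iff vector_minus_component by (smt (verit))
    have "norm (x - a) \<le> (\<Sum>j\<in>UNIV. \<bar>(x - a) $ j\<bar>)" by (rule norm_le_l1_cart)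
    also have "\<dots> \<le> (\<Sum>j\<in>(UNIV::'n set). r)" using j by (intro sum_mono)
    also have "\<dots> = min d1 d2 / 2" by (simp add: r_def)
    also have "\<dots> < min d1 d2" using d1(1) d2(1) by linarith
    finally show ?thesis by (simp add: dist_norm)
  qed
  have sub: "cbox (a - (\<chi> j. r)) (a + (\<chi> j. r)) \<subseteq> S"
    using near d1 by (force simp: dist_commute)
  have "\<bar>\<beta> x $ i - \<beta> a $ i\<bar> \<le> w" if "x \<in> cbox (a - (\<chi> j. r)) (a + (\<chi> j. r))" for x i
  proof -
    have "dist (\<beta> x) (\<beta> a) < w" using near[OF that] d2 sub that by auto
    moreover have "\<bar>(\<beta> x - \<beta> a) $ i\<bar> \<le> norm (\<beta> x - \<beta> a)" by (rule component_le_norm_cart)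
    ultimately show ?thesis by (simp add: dist_norm)
  qed
  then show ?thesis using r sub by blast
qed

text \<open>The potential at \<open>b\<close> is the increment from a fixed \<open>x0\<close>: it
  exists by connectedness and is unique because \<open>\<beta>\<close> annihilates solenoidal
  fields. The error bound on short increments is then literally differentiability with gradient
  \<open>\<beta>\<close>.\<close>

lemma potential_of_annihilator:
  fixes S :: "(real^'n) set"
  assumes S: "open S" "connected S" and cont: "continuous_on S \<beta>" and ann: "annihilates_solenoidal S \<beta>"
  shows "\<exists>p. \<forall>x\<in>S. (p has_derivative (\<lambda>v. \<beta> x \<bullet> v)) (at x)"
proof (cases "S = {}")
  case False
  then obtain x0 where x0: "x0 \<in> S" by blast
  have local: "\<exists>d>0. \<forall>b. norm (b - a) < d \<longrightarrow> b \<in> S \<and>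
      (\<exists>c. increment S \<beta> a b c \<and> \<bar>c - \<beta> a \<bullet> (b - a)\<bar> \<le> e * norm (b - a))"
    if a: "a \<in> S" and e: "e > 0" for a e
  proof -
    \<comment> \<open>The box estimate is in terms of the l1 norm, which is at most
      \<open>CARD('n)\<close> times the Euclidean norm.\<close>
    define w where "w = e / real CARD('n)"
    have w: "w > 0" using e by (simp add: w_def)
    obtain r where r: "r > 0" "cbox (a - (\<chi> j. r)) (a + (\<chi> j. r)) \<subseteq> S"
        "\<forall>x\<in>cbox (a - (\<chi> j. r)) (a + (\<chi> j. r)). \<forall>i. \<bar>\<beta> x $ i - \<beta> a $ i\<bar> \<le> w"
      using small_box[OF S(1) a cont w] by blast
    have "b \<in> S \<and> (\<exists>c. increment S \<beta> a b c \<and> \<bar>c - \<beta> a \<bullet> (b - a)\<bar> \<le> e * norm (b - a))"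
      if b: "norm (b - a) < r / 2" for b
    proof
      have j: "\<bar>b $ j - a $ j\<bar> \<le> norm (b - a)" for j
        using component_le_norm_cart[of "b - a" j] by simp
      have jr: "\<bar>b $ j - a $ j\<bar> \<le> r / 2" for j using j[of j] b by linarith
      have "a $ j - r \<le> b $ j \<and> b $ j \<le> a $ j + r" for j using jr[of j] r(1) by (intro conjI; linarith)
      then have "b \<in> cbox (a - (\<chi> j. r)) (a + (\<chi> j. r))" unfolding coordinate_box_eq by blast
      then show "b \<in> S" using r(2) by blast
      obtain c where c: "increment S \<beta> a b c" "\<bar>c - \<beta> a \<bullet> (b - a)\<bar> \<le> w * (\<Sum>j\<in>UNIV. \<bar>b $ j - a $ j\<bar>)"
        using increment_box[OF r(1) refl r(2) cont _ jr, of w] r(3) by blast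
      have "(\<Sum>j\<in>UNIV. \<bar>b $ j - a $ j\<bar>) \<le> (\<Sum>j\<in>(UNIV::'n set). norm (b - a))" by (intro sum_mono j)
      then have "w * (\<Sum>j\<in>UNIV. \<bar>b $ j - a $ j\<bar>) \<le> w * (real CARD('n) * norm (b - a))"
        using w by (intro mult_left_mono) auto
      also have "\<dots> = e * norm (b - a)" by (simp add: w_def)
      finally show "\<exists>c. increment S \<beta> a b c \<and> \<bar>c - \<beta> a \<bullet> (b - a)\<bar> \<le> e * norm (b - a)"
        using c by (intro exI[of _ c]) auto
    qed
    then show ?thesis using r(1) by (intro exI[of _ "r / 2"]) auto
  qed
  \<comment> \<open>Admitting an increment is a symmetric and transitive relation that holds between
    nearby points, so it holds throughout a connected set; no chain of segments has to be
    constructed.\<close>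
  have ex: "\<exists>c. increment S \<beta> x0 b c" if "b \<in> S" for b
  proof (rule connected_equivalence_relation[OF S(2) x0 that])
    fix a assume a: "a \<in> S"
    obtain d where d: "d > 0" "\<forall>b. norm (b - a) < d \<longrightarrow> b \<in> S \<and> (\<exists>c. increment S \<beta> a b c)"
      using local[OF a zero_less_one] by blast
    show "\<exists>T. openin (top_of_set S) T \<and> a \<in> T \<and> (\<forall>x\<in>T. \<exists>c. increment S \<beta> a x c)"
      using d by (intro exI[of _ "S \<inter> ball a d"])
        (auto simp: a dist_norm norm_minus_commute openin_open_Int)
  qed (use increment_sym increment_trans cont in blast)+
  define p where "p b = (SOME c. increment S \<beta> x0 b c)" for b
  have p: "increment S \<beta> x0 b (p b)" if "b \<in> S" for b
    unfolding p_def using ex[OF that] by (rule someI_ex)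
  have "(p has_derivative (\<lambda>v. \<beta> a \<bullet> v)) (at a)" if a: "a \<in> S" for a
    unfolding has_derivative_at_alt
  proof (intro conjI allI impI bounded_linear_inner_right)
    fix e :: real assume "e > 0"
    then obtain d where d: "d > 0" "\<forall>b. norm (b - a) < d \<longrightarrow> b \<in> S \<and>
      (\<exists>c. increment S \<beta> a b c \<and> \<bar>c - \<beta> a \<bullet> (b - a)\<bar> \<le> e * norm (b - a))" using local[OF a] by blast
    have "norm (p b - p a - \<beta> a \<bullet> (b - a)) \<le> e * norm (b - a)" if b: "norm (b - a) < d" for b
    proof -
      obtain c where c: "b \<in> S" "increment S \<beta> a b c" "\<bar>c - \<beta> a \<bullet> (b - a)\<bar> \<le> e * norm (b - a)"
        using d(2) b by blast
      have "p b = p a + c"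
        by (rule increment_unique[OF p[OF c(1)] increment_trans[OF p[OF a] c(2) cont] cont ann])
      then show ?thesis using c(3) by simp
    qed
    then show "\<exists>d>0. \<forall>y. norm (y - a) < d \<longrightarrow> norm (p y - p a - \<beta> a \<bullet> (y - a)) \<le> e * norm (y - a)"
      using d(1) by blast
  qed
  then show ?thesis by blast
qed simp

subsection \<open>Domains with smooth boundary\<close>

text \<open>In contrast to \<open>fat\<close>, one axis, aperture and length serve all points of
  \<open>S\<close> near \<open>p\<close>, so that two nearby points can be moved in a common
  direction. As \<open>p\<close> is not asked to lie in \<open>S\<close>, the condition passes to
  the interior of a domain even when \<open>p\<close> is on its boundary.\<close>

definition uniform_cone :: "'a::real_normed_vector set \<Rightarrow> 'a \<Rightarrow> 'a \<Rightarrow> real \<Rightarrow> real \<Rightarrow> real \<Rightarrow> bool" where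
  "uniform_cone S p e c r s0 \<longleftrightarrow> c > 0 \<and> r > 0 \<and> s0 > 0 \<and>
     (\<forall>y\<in>S \<inter> ball p r. \<forall>s. 0 < s \<and> s \<le> s0 \<longrightarrow> ball (y + s *\<^sub>R e) (c * s) \<subseteq> S)"

lemma uniform_coneD:
  assumes "uniform_cone S p e c r s0"
  shows "c > 0" "r > 0" "s0 > 0"
    "y \<in> S \<Longrightarrow> dist p y < r \<Longrightarrow> 0 < s \<Longrightarrow> s \<le> s0 \<Longrightarrow> ball (y + s *\<^sub>R e) (c * s) \<subseteq> S"
  using assms unfolding uniform_cone_def by (simp_all add: Ball_def)

lemma uniform_cone_interior:
  assumes "uniform_cone S p e c r s0" shows "uniform_cone (interior S) p e c r s0"
  using assms interior_subset[of S] unfolding uniform_cone_def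
  by (auto intro!: interior_maximal[OF _ open_ball, THEN subsetD])

lemma has_derivative_gradient:
  fixes h :: "real^'n \<Rightarrow> real"
  assumes "(h has_derivative h') F"
  shows "(h has_derivative (\<lambda>v. (\<chi> i. h' (axis i 1)) \<bullet> v)) F"
proof -
  have lin: "linear h'" by (rule has_derivative_linear[OF assms])
  have "h' v = (\<chi> i. h' (axis i 1)) \<bullet> v" for v
  proof -
    have "h' v = h' (\<Sum>i\<in>UNIV. v $ i *s axis i 1)" by (simp add: basis_expansion)
    also have "\<dots> = (\<Sum>i\<in>UNIV. v $ i * h' (axis i 1))"
      using lin by (simp add: linear_sum linear_scale scalar_mult_eq_scaleR)
    finally show ?thesis by (simp add: inner_vec_def mult.commute)
  qed
  then have "h' = (\<lambda>v. (\<chi> i. h' (axis i 1)) \<bullet> v)" by (rule ext)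
  then show ?thesis using assms by simp
qed

text \<open>Moving from a point near \<open>p\<close> against the gradient of a boundary defining function decreases
  that function, hence stays in the domain.\<close>

lemma boundary_uniform_cone:
  fixes D :: "(real^'n) set"
  assumes bd: "boundary_defining D p U h"
  shows "\<exists>e c r s0. uniform_cone D p e c r s0"
proof -
  have U: "open U" "p \<in> U" "smooth_on U h" "D \<inter> U = {x\<in>U. h x \<le> 0}"
    and ne: "frechet_derivative h (at p) \<noteq> (\<lambda>_. 0)"
    using bd unfolding boundary_defining_def by auto
  define g where "g x = (\<chi> i. frechet_derivative h (at x within U) (axis i 1))" for x
  have h: "(h has_derivative (\<lambda>v. g x \<bullet> v)) (at x)" if "x \<in> U" for x
    using has_derivative_gradient[OF smooth_on_has_derivative[OF U(3) that]] at_within_open[OF that U(1)]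
    by (simp add: g_def)
  have contg: "continuous_on U g"
    unfolding g_def using smooth_on_continuous[OF smooth_on_frechet_derivative[OF U(3)]]
    by (intro continuous_on_vec_lambda) auto
  have "g p \<noteq> 0"
  proof
    assume "g p = 0"
    then have "(h has_derivative (\<lambda>v. 0)) (at p)" using h[OF U(2)] by simp
    then show False using ne frechet_derivative_at by metis
  qed
  define m where "m = norm (g p)"
  have m: "m > 0" using \<open>g p \<noteq> 0\<close> by (simp add: m_def)
  obtain R1 where R1: "R1 > 0" "ball p R1 \<subseteq> U" using U(1,2) open_contains_ball by blast
  have "m / 4 > 0" using m by simp
  then obtain R2 where R2: "R2 > 0" "\<forall>x\<in>U. dist x p < R2 \<longrightarrow> dist (g x) (g p) < m / 4"
    using contg U(2) unfolding continuous_on_iff by blast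
  define R where "R = min R1 R2"
  have R: "R > 0" using R1 R2 by (simp add: R_def)
  \<comment> \<open>Directions \<open>w\<close> within \<open>m / 4\<close> of \<open>- g p\<close>
    and gradients within \<open>m / 4\<close> of \<open>g p\<close> give a derivative of
    \<open>h\<close> along \<open>w\<close> of at most (5/16 + 1/4 - 1) m^2 < 0. The bound on
    \<open>s\<close> keeps the path within 5 R / 16 of \<open>y\<close>, hence within
    \<open>R\<close> of \<open>p\<close>.\<close>
  have "ball (y + s *\<^sub>R (- g p)) (m / 4 * s) \<subseteq> D"
    if y: "y \<in> D" "dist p y < R / 2" and s: "0 < s" "s \<le> R / (4 * m)" for y s
  proof
    fix q assume q: "q \<in> ball (y + s *\<^sub>R (- g p)) (m / 4 * s)"
    define w where "w = (1 / s) *\<^sub>R (q - y)"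
    have qw: "q = y + s *\<^sub>R w" using s by (simp add: w_def)
    have "s * norm (w + g p) = norm (s *\<^sub>R (w + g p))" using s by simp
    also have "s *\<^sub>R (w + g p) = q - (y + s *\<^sub>R (- g p))" by (simp add: qw algebra_simps)
    also have "norm \<dots> < s * (m / 4)" using q by (simp add: dist_norm norm_minus_commute mult.commute)
    finally have w: "norm (w + g p) < m / 4" using s by simp
    have "norm w \<le> norm (w + g p) + norm (g p)" using norm_triangle_ineq4[of "w + g p" "g p"] by simp
    then have nw: "norm w \<le> 5 / 4 * m" using w unfolding m_def by simp
    have near: "dist (y + t *\<^sub>R w) p < R" if t: "0 \<le> t" "t \<le> s" for t
    proof -
      have "t * norm w \<le> R / (4 * m) * (5 / 4 * m)" using t s nw m R by (intro mult_mono) auto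
      also have "\<dots> < R / 2" using m R by (simp add: field_simps)
      finally have "norm (t *\<^sub>R w) < R / 2" using t by simp
      moreover have "dist (y + t *\<^sub>R w) p \<le> dist p y + norm (t *\<^sub>R w)"
        using norm_triangle_ineq[of "y - p" "t *\<^sub>R w"] by (simp add: dist_norm norm_minus_commute algebra_simps)
      ultimately show ?thesis using y(2) by linarith
    qed
    have inU: "y + t *\<^sub>R w \<in> U" if "0 \<le> t" "t \<le> s" for t
      using near[OF that] R1 by (auto simp: R_def dist_commute)
    have neg: "g (y + t *\<^sub>R w) \<bullet> w < 0" if t: "0 \<le> t" "t \<le> s" for t
    proof -
      define a where "a = g (y + t *\<^sub>R w) - g p"
      have a: "norm a < m / 4" using R2 near[OF t] inU[OF t] by (auto simp: a_def R_def dist_norm)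
      have "g (y + t *\<^sub>R w) \<bullet> w = a \<bullet> w + g p \<bullet> (w + g p) - g p \<bullet> g p"
        by (simp add: a_def inner_diff_left inner_add_right)
      moreover have "a \<bullet> w \<le> m / 4 * (5 / 4 * m)"
      proof -
        have "a \<bullet> w \<le> norm a * norm w" by (rule norm_cauchy_schwarz)
        also have "\<dots> \<le> m / 4 * (5 / 4 * m)" using a nw m by (intro mult_mono) auto
        finally show ?thesis .
      qed
      moreover have "g p \<bullet> (w + g p) \<le> m * (m / 4)"
      proof -
        have "g p \<bullet> (w + g p) \<le> norm (g p) * norm (w + g p)" by (rule norm_cauchy_schwarz)
        also have "\<dots> \<le> m * (m / 4)" using w m unfolding m_def by (intro mult_left_mono) auto
        finally show ?thesis .
      qed
      moreover have "g p \<bullet> g p = m * m" by (simp add: m_def dot_square_norm power2_eq_square)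
      moreover have "m * m > 0" using m by simp
      ultimately show ?thesis by simp
    qed
    have "h (y + s *\<^sub>R w) < h (y + 0 *\<^sub>R w)"
    proof (rule DERIV_neg_imp_decreasing[OF s(1)])
      fix t :: real assume t: "0 \<le> t" "t \<le> s"
      have "((\<lambda>t. y + t *\<^sub>R w) has_derivative (\<lambda>k. k *\<^sub>R w)) (at t)"
        by (auto intro!: derivative_eq_intros)
      from has_derivative_compose[OF this h[OF inU[OF t]]]
      have "((\<lambda>t. h (y + t *\<^sub>R w)) has_real_derivative g (y + t *\<^sub>R w) \<bullet> w) (at t)"
        by (simp add: has_field_derivative_def mult_commute_abs)
      then show "\<exists>z. ((\<lambda>t. h (y + t *\<^sub>R w)) has_real_derivative z) (at t) \<and> z < 0"
        using neg[OF t] by blast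
    qed
    moreover have "h y \<le> 0" using y(1) inU[of 0] U(4) s by auto
    ultimately have "h q \<le> 0" by (simp add: qw)
    then show "q \<in> D" using inU[of s] U(4) s by (auto simp: qw)
  qed
  then have "uniform_cone D p (- g p) (m / 4) (R / 2) (R / (4 * m))"
    using m R unfolding uniform_cone_def by auto
  then show ?thesis by blast
qed

lemma smooth_domain_uniform_cone:
  fixes D :: "(real^'n) set"
  assumes D: "smooth_domain D" and p: "p \<in> D"
  shows "\<exists>e c r s0. uniform_cone D p e c r s0"
proof (cases "p \<in> interior D")
  case True
  then obtain r where r: "r > 0" "ball p r \<subseteq> D" unfolding mem_interior by blast
  \<comment> \<open>At an interior point the axis 0 will do: the cone is then a ball about
    \<open>y\<close>.\<close>
  have "ball (y + s *\<^sub>R 0) (1 * s) \<subseteq> D" if "dist p y < r / 2" "0 < s" "s \<le> r / 2" for y s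
  proof
    fix q assume "q \<in> ball (y + s *\<^sub>R 0) (1 * s)"
    then have "dist p q < r" using that dist_triangle[of p q y] by simp
    then show "q \<in> D" using r(2) by auto
  qed
  then have "uniform_cone D p 0 1 (r / 2) (r / 2)" using r(1) unfolding uniform_cone_def by auto
  then show ?thesis by blast
next
  case False
  then have "p \<in> frontier D" using p closure_subset by (auto simp: frontier_def)
  then obtain U h where "boundary_defining D p U h" using D unfolding smooth_domain_def by blast
  then show ?thesis by (rule boundary_uniform_cone)
qed

lemma smooth_domain_fat:
  fixes D :: "(real^'n) set"
  assumes "smooth_domain D" shows "fat D"
proof (rule fatI)
  fix x assume x: "x \<in> D"
  then obtain e c r s0 where "uniform_cone D x e c r s0" using smooth_domain_uniform_cone[OF assms] by blast
  note c = uniform_coneD[OF this]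
  have "\<forall>s. 0 < s \<and> s \<le> s0 \<longrightarrow> ball (x + s *\<^sub>R e) (c * s) \<subseteq> D" using c(2) c(4)[OF x] by simp
  then show "\<exists>e c d. c > 0 \<and> d > 0 \<and> (\<forall>s. 0 < s \<and> s \<le> d \<longrightarrow> ball (x + s *\<^sub>R e) (c * s) \<subseteq> D)"
    using c(1,3) by (intro exI[of _ e] exI[of _ c] exI[of _ s0] conjI)
qed

section \<open>Mean value inequalities and potentials up to the boundary\<close>

definition has_gradient_on :: "(real^'n) set \<Rightarrow> (real^'n \<Rightarrow> real) \<Rightarrow> (real^'n \<Rightarrow> real^'n) \<Rightarrow> bool" where
  "has_gradient_on S f \<beta> \<longleftrightarrow> (\<forall>x\<in>S. (f has_derivative (\<lambda>v. \<beta> x \<bullet> v)) (at x within S))"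

lemma has_gradient_on_diff:
  assumes "has_gradient_on S f \<beta>" "has_gradient_on S g \<gamma>"
  shows "has_gradient_on S (\<lambda>x. f x - g x) (\<lambda>x. \<beta> x - \<gamma> x)"
  using assms unfolding has_gradient_on_def inner_diff_left by (auto intro: has_derivative_diff)

lemma has_gradient_on_scale:
  assumes "has_gradient_on S f \<beta>"
  shows "has_gradient_on S (\<lambda>x. c * f x) (\<lambda>x. c *\<^sub>R \<beta> x)"
  using assms unfolding has_gradient_on_def inner_scaleR_left by (auto intro: has_derivative_mult_right)

lemma has_gradient_on_linear: "has_gradient_on S (\<lambda>x. w \<bullet> x) (\<lambda>_. w)"
  unfolding has_gradient_on_def by (auto intro!: derivative_eq_intros)

lemma gradient_bound_segment:
  assumes f: "has_gradient_on S f \<beta>" and sub: "closed_segment a b \<subseteq> S"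
    and B: "\<And>x. x \<in> closed_segment a b \<Longrightarrow> norm (\<beta> x) \<le> B"
  shows "\<bar>f b - f a\<bar> \<le> B * norm (b - a)"
proof -
  have "norm (f b - f a) \<le> B * norm (b - a)"
  proof (rule differentiable_bound[where S = "closed_segment a b"])
    fix x assume x: "x \<in> closed_segment a b"
    then have "(f has_derivative (\<lambda>v. \<beta> x \<bullet> v)) (at x within S)"
      using f sub unfolding has_gradient_on_def by blast
    then show "(f has_derivative (\<lambda>v. \<beta> x \<bullet> v)) (at x within closed_segment a b)"
      using sub by (rule has_derivative_subset)
    have "onorm (\<lambda>v. \<beta> x \<bullet> v) \<le> norm (\<beta> x)"
      by (rule onorm_bound) (auto simp: Cauchy_Schwarz_ineq2)
    then show "onorm (\<lambda>v. \<beta> x \<bullet> v) \<le> B" using B[OF x] by linarith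
  qed auto
  then show ?thesis by simp
qed

text \<open>A mean value inequality for sets that are not convex, with \<open>C\<close> as the price
  of a detour. The gradient bound is asked only within \<open>C * norm (y' - y)\<close> of
  \<open>y\<close>, so that continuity of the gradient at a point can be exploited; this gives
  differentiability and not merely a Lipschitz bound.\<close>

definition mean_value_near :: "(real^'n) set \<Rightarrow> real^'n \<Rightarrow> real \<Rightarrow> real \<Rightarrow> bool" where
  "mean_value_near S p d C \<longleftrightarrow> d > 0 \<and> C \<ge> 1 \<and>
     (\<forall>y\<in>S. \<forall>y'\<in>S. dist p y < d \<longrightarrow> dist p y' < d \<longrightarrow> (\<forall>f \<beta> B. has_gradient_on S f \<beta> \<longrightarrow>
       (\<forall>x\<in>S. dist y x \<le> C * norm (y' - y) \<longrightarrow> norm (\<beta> x) \<le> B) \<longrightarrow>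
       \<bar>f y' - f y\<bar> \<le> B * (C * norm (y' - y))))"

text \<open>Two nearby points are joined by going from both a short distance into the cone and then
  across, with total length comparable to their distance.\<close>

lemma uniform_cone_mean_value_near:
  fixes S :: "(real^'n) set"
  assumes "uniform_cone S p e c r s0"
  shows "\<exists>d C. mean_value_near S p d C"
proof -
  note cone = uniform_coneD[OF assms]
  \<comment> \<open>Length of the detour in units of \<open>l = norm (y' - y)\<close>: two legs of
    length \<open>s * norm e\<close> with \<open>s = 2 * l / c\<close>, and a crossing of length
    \<open>l\<close>.\<close>
  define C where "C = 1 + 4 * norm e / c"
  \<comment> \<open>Two points within \<open>d\<close> of \<open>p\<close> have
    \<open>l < 2 * d\<close>, which makes \<open>c * s = 2 * l\<close> smaller than
    \<open>c * s0\<close>, so the legs are not longer than the cone.\<close>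
  define d where "d = min r (c * s0 / 4)"
  have C: "C \<ge> 1" using cone(1) by (simp add: C_def)
  have d: "d > 0" using cone by (simp add: d_def)
  have "\<bar>f y' - f y\<bar> \<le> B * (C * norm (y' - y))"
    if y: "y \<in> S" "dist p y < d" "y' \<in> S" "dist p y' < d" and f: "has_gradient_on S f \<beta>"
      and B: "\<forall>x\<in>S. dist y x \<le> C * norm (y' - y) \<longrightarrow> norm (\<beta> x) \<le> B" for y y' f \<beta> B
  proof (cases "y' = y")
    case False
    define l where "l = norm (y' - y)"
    have l: "l > 0" using False by (simp add: l_def)
    \<comment> \<open>With this \<open>s\<close> the ball about \<open>y + s e\<close> provided by
      the cone has radius \<open>2 * l\<close>, and so it contains \<open>y' + s e\<close>, which is
      at distance \<open>l\<close>.\<close>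
    define s where "s = 2 * l / c"
    have s: "s > 0" "c * s = 2 * l" using l cone(1) by (auto simp: s_def)
    have "l < 2 * d" using y(2,4) dist_triangle2[of y' y p] by (simp add: l_def dist_norm norm_minus_commute)
    then have "c * s \<le> c * s0" unfolding s(2) d_def by simp
    then have ss0: "s \<le> s0" using cone(1) by simp
    have Cl: "C * l = l + 2 * (s * norm e)" by (simp add: C_def s_def field_simps)
    have vert: "z + t *\<^sub>R e \<in> S" if "z \<in> S" "dist p z < d" "0 \<le> t" "t \<le> s" for z t
    proof (cases "t = 0")
      case False
      then have "ball (z + t *\<^sub>R e) (c * t) \<subseteq> S" using cone(4)[of z t] that ss0 by (simp add: d_def)
      moreover have "z + t *\<^sub>R e \<in> ball (z + t *\<^sub>R e) (c * t)" using False that cone(1) by simp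
      ultimately show ?thesis by blast
    qed (use that in simp)
    have seg: "closed_segment z (z + s *\<^sub>R e) \<subseteq> S \<and> (\<forall>x\<in>closed_segment z (z + s *\<^sub>R e). dist z x \<le> s * norm e)"
      if "z \<in> S" "dist p z < d" for z
    proof -
      have "\<exists>t. 0 \<le> t \<and> t \<le> s \<and> x = z + t *\<^sub>R e" if "x \<in> closed_segment z (z + s *\<^sub>R e)" for x
      proof -
        obtain u where u: "0 \<le> u" "u \<le> 1" "x = (1 - u) *\<^sub>R z + u *\<^sub>R (z + s *\<^sub>R e)"
          using \<open>x \<in> closed_segment z (z + s *\<^sub>R e)\<close> unfolding closed_segment_def by blast
        then have "x = z + (u * s) *\<^sub>R e" by (simp add: algebra_simps)
        then show ?thesis using u s by (intro exI[of _ "u * s"]) (auto simp: mult_left_le_one_le)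
      qed
      moreover have "dist z (z + t *\<^sub>R e) \<le> s * norm e" if "0 \<le> t" "t \<le> s" for t
        using that by (simp add: dist_norm mult_right_mono)
      ultimately show ?thesis using vert[OF that] by blast
    qed
    have mid: "closed_segment (y + s *\<^sub>R e) (y' + s *\<^sub>R e) \<subseteq> ball (y + s *\<^sub>R e) (c * s)"
      using l s by (intro closed_segment_subset convex_ball) (auto simp: dist_norm l_def norm_minus_commute)
    have "ball (y + s *\<^sub>R e) (c * s) \<subseteq> S" using cone(4)[of y s] y s ss0 by (simp add: d_def)
    with mid have midS: "closed_segment (y + s *\<^sub>R e) (y' + s *\<^sub>R e) \<subseteq> S" by blast
    have B': "norm (\<beta> x) \<le> B" if "x \<in> S" "dist y x \<le> C * l" for x using B that by (simp add: l_def)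
    have e0: "0 \<le> s * norm e" using s by simp
    have yy': "dist y y' = l" by (simp add: l_def dist_norm norm_minus_commute)
    have 1: "\<bar>f (y + s *\<^sub>R e) - f y\<bar> \<le> B * norm (y + s *\<^sub>R e - y)"
    proof (rule gradient_bound_segment[OF f])
      show "closed_segment y (y + s *\<^sub>R e) \<subseteq> S" using seg y by blast
      fix x assume "x \<in> closed_segment y (y + s *\<^sub>R e)"
      then have "x \<in> S" "dist y x \<le> s * norm e" using seg[OF y(1,2)] by auto
      then show "norm (\<beta> x) \<le> B" using e0 l by (intro B') (auto simp: Cl)
    qed
    have 3: "\<bar>f (y' + s *\<^sub>R e) - f y'\<bar> \<le> B * norm (y' + s *\<^sub>R e - y')"
    proof (rule gradient_bound_segment[OF f])
      show "closed_segment y' (y' + s *\<^sub>R e) \<subseteq> S" using seg y by blast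
      fix x assume "x \<in> closed_segment y' (y' + s *\<^sub>R e)"
      then have x: "x \<in> S" "dist y' x \<le> s * norm e" using seg[OF y(3,4)] by auto
      have "dist y x \<le> l + s * norm e" using dist_triangle[of y x y'] x(2) yy' by linarith
      then show "norm (\<beta> x) \<le> B" using e0 by (intro B'[OF x(1)]) (auto simp: Cl)
    qed
    have 2: "\<bar>f (y' + s *\<^sub>R e) - f (y + s *\<^sub>R e)\<bar> \<le> B * norm (y' + s *\<^sub>R e - (y + s *\<^sub>R e))"
    proof (rule gradient_bound_segment[OF f midS])
      fix x assume x: "x \<in> closed_segment (y + s *\<^sub>R e) (y' + s *\<^sub>R e)"
      have "dist (y + s *\<^sub>R e) x \<le> dist (y + s *\<^sub>R e) (y' + s *\<^sub>R e)"
        using segment_bound(1)[OF x] by (simp add: dist_norm norm_minus_commute)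
      also have "\<dots> = l" using yy' by (simp add: dist_norm)
      finally have "dist (y + s *\<^sub>R e) x \<le> l" .
      moreover have "dist y (y + s *\<^sub>R e) = s * norm e" using s by (simp add: dist_norm)
      ultimately have "dist y x \<le> l + s * norm e" using dist_triangle[of y x "y + s *\<^sub>R e"] by linarith
      then show "norm (\<beta> x) \<le> B" using e0 midS x by (intro B') (auto simp: Cl)
    qed
    have "\<bar>f y' - f y\<bar> \<le> B * (s * norm e) + B * l + B * (s * norm e)"
      using 1 2 3 s by (simp add: l_def)
    also have "\<dots> = B * (C * l)" unfolding Cl by (simp add: algebra_simps)
    finally show ?thesis by (simp add: l_def)
  qed simp
  then have "mean_value_near S p d C" unfolding mean_value_near_def using C d by blast
  then show ?thesis by blast
qed

lemma mean_value_nearD: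
  assumes "mean_value_near S p d C" "y \<in> S" "dist p y < d" "y' \<in> S" "dist p y' < d" "has_gradient_on S f \<beta>"
    and "\<And>x. x \<in> S \<Longrightarrow> dist y x \<le> C * norm (y' - y) \<Longrightarrow> norm (\<beta> x) \<le> B"
  shows "\<bar>f y' - f y\<bar> \<le> B * (C * norm (y' - y))"
  using assms(1)[unfolded mean_value_near_def] assms(2-) by simp

lemma mean_value_near_pos: "mean_value_near S p d C \<Longrightarrow> d > 0 \<and> C \<ge> 1"
  unfolding mean_value_near_def by simp

lemma smooth_domain_mean_value:
  assumes "smooth_domain D" "p \<in> D"
  shows "\<exists>d C. mean_value_near D p d C" "\<exists>d C. mean_value_near (interior D) p d C"
proof -
  obtain e c r s0 where "uniform_cone D p e c r s0" using smooth_domain_uniform_cone[OF assms] by blast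
  then show "\<exists>d C. mean_value_near D p d C" "\<exists>d C. mean_value_near (interior D) p d C"
    using uniform_cone_mean_value_near uniform_cone_interior by blast+
qed

lemma smooth_domain_compact: "smooth_domain D \<Longrightarrow> compact D"
  and smooth_domain_closed: "smooth_domain D \<Longrightarrow> closed D"
  and smooth_domain_connected: "smooth_domain D \<Longrightarrow> connected D"
  and smooth_domain_nonempty: "smooth_domain D \<Longrightarrow> D \<noteq> {}"
  unfolding smooth_domain_def by (auto intro: compact_imp_closed)

text \<open>Two distinct interior points are exhibited within distance \<open>r\<close>, since a
  single one might be \<open>x\<close> itself. They are the centre of a ball of the cone and a point
  halfway to its surface.\<close>

lemma fat_islimpt_interior:
  fixes S :: "(real^'n) set"
  assumes "fat S" "x \<in> S" shows "x islimpt interior S"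
  unfolding islimpt_approachable
proof (intro allI impI)
  fix r :: real assume r: "r > 0"
  obtain e c d where e: "c > 0" "d > 0" "\<forall>s. 0 < s \<and> s \<le> d \<longrightarrow> ball (x + s *\<^sub>R e) (c * s) \<subseteq> S"
    using fatD[OF assms] by (elim exE conjE)
  define s where "s = min d (r / (2 * (norm e + c)))"
  have pos: "norm e + c > 0" using e(1) by (simp add: add_nonneg_pos)
  have s: "0 < s" "s \<le> d" using e r pos by (auto simp: s_def)
  have "s * (norm e + c) \<le> r / (2 * (norm e + c)) * (norm e + c)"
    using pos by (intro mult_right_mono) (auto simp: s_def)
  also have "\<dots> = r / 2"
  proof -
    have "r / (2 * a) * a = r / 2" if "a > 0" for a :: real using that by simp
    from this[OF pos] show ?thesis .
  qed
  also have "\<dots> < r" using r by simp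
  finally have sr: "s * norm e + s * c < r" by (simp add: distrib_left)
  have "ball (x + s *\<^sub>R e) (c * s) \<subseteq> S" using e(3) s by simp
  then have sub: "ball (x + s *\<^sub>R e) (c * s) \<subseteq> interior S" by (rule interior_maximal) simp
  define u where "u = (axis undefined 1 :: real^'n)"
  have u: "norm u = 1" by (simp add: u_def norm_axis_1)
  have in_ball: "x + s *\<^sub>R e \<in> interior S" "x + s *\<^sub>R e + (c * s / 2) *\<^sub>R u \<in> interior S"
    using sub e(1) s u by (auto simp: dist_norm)
  have "dist (x + s *\<^sub>R e) x < r" using sr s e(1) by (simp add: dist_norm add_nonneg_pos) (smt (verit) mult_pos_pos)
  moreover have "dist (x + s *\<^sub>R e + (c * s / 2) *\<^sub>R u) x < r"
  proof -
    have "dist (x + s *\<^sub>R e + (c * s / 2) *\<^sub>R u) x = norm (s *\<^sub>R e + (c * s / 2) *\<^sub>R u)"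
      by (simp add: dist_norm add.assoc)
    also have "\<dots> \<le> s * norm e + c * s / 2"
      using norm_triangle_ineq[of "s *\<^sub>R e" "(c * s / 2) *\<^sub>R u"] s e(1) u by simp
    also have "\<dots> < r" using sr s e(1) by (smt (verit) field_sum_of_halves mult.commute mult_pos_pos)
    finally show ?thesis .
  qed
  moreover have "x + s *\<^sub>R e \<noteq> x + s *\<^sub>R e + (c * s / 2) *\<^sub>R u"
    using s e(1) u by auto
  ultimately show "\<exists>x'\<in>interior S. x' \<noteq> x \<and> dist x' x < r"
    using in_ball by metis
qed

text \<open>If the interior splits into open pieces \<open>A'\<close> and \<open>B'\<close>, their
  closures cover \<open>D\<close> and so meet at some \<open>p\<close>, as \<open>D\<close> is
  connected. Near \<open>p\<close> the mean value inequality for the interior applies to the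
  indicator of \<open>A'\<close>, whose gradient is 0 there, and forces equal values on both
  pieces.\<close>

lemma smooth_domain_interior_connected:
  fixes D :: "(real^'n) set"
  assumes D: "smooth_domain D" shows "connected (interior D)"
proof (rule ccontr)
  assume "\<not> connected (interior D)"
  then obtain A B where AB: "open A" "open B" "interior D \<subseteq> A \<union> B" "A \<inter> B \<inter> interior D = {}"
      "A \<inter> interior D \<noteq> {}" "B \<inter> interior D \<noteq> {}"
    unfolding connected_def by blast
  define A' B' where "A' = A \<inter> interior D" and "B' = B \<inter> interior D"
  have o: "open A'" "open B'" "A' \<inter> B' = {}" "interior D = A' \<union> B'" "A' \<noteq> {}" "B' \<noteq> {}"
    using AB by (auto simp: A'_def B'_def)
  have sub: "closure A' \<subseteq> D" "closure B' \<subseteq> D"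
    using smooth_domain_closed[OF D] interior_subset[of D]
    by (intro closure_minimal; auto simp: A'_def B'_def)+
  have cover: "D \<subseteq> closure A' \<union> closure B'"
  proof
    fix x assume "x \<in> D"
    then have "x islimpt interior D" by (rule fat_islimpt_interior[OF smooth_domain_fat[OF D]])
    then have "x \<in> closure (interior D)" by (simp add: closure_def)
    then show "x \<in> closure A' \<union> closure B'" by (simp add: o(4))
  qed
  have "closure A' \<inter> closure B' = {}"
  proof (rule ccontr)
    assume "closure A' \<inter> closure B' \<noteq> {}"
    then obtain p where p: "p \<in> closure A'" "p \<in> closure B'" by blast
    then have pD: "p \<in> D" using sub by blast
    obtain d C where mv: "mean_value_near (interior D) p d C" using smooth_domain_mean_value(2)[OF D pD] by blast
    then have d: "d > 0" using mean_value_near_pos by blast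
    obtain y where y: "y \<in> A'" "dist y p < d" using p(1) d closure_approachable by blast
    obtain y' where y': "y' \<in> B'" "dist y' p < d" using p(2) d closure_approachable by blast
    define f :: "real^'n \<Rightarrow> real" where "f = indicator A'"
    have "(f has_derivative (\<lambda>v. 0)) (at x within interior D)" if "x \<in> interior D" for x
    proof (cases "x \<in> A'")
      case True
      have "(f has_derivative (\<lambda>v. 0)) (at x)"
        by (rule has_derivative_transform_within_open[OF has_derivative_const o(1) True]) (simp add: f_def)
      then show ?thesis by (rule has_derivative_at_withinI)
    next
      case False
      then have "x \<in> B'" using that o(4) by blast
      have "(f has_derivative (\<lambda>v. 0)) (at x)"
        by (rule has_derivative_transform_within_open[OF has_derivative_const[of 0] o(2) \<open>x \<in> B'\<close>])
          (use o(3) in \<open>auto simp: f_def indicator_def\<close>)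
      then show ?thesis by (rule has_derivative_at_withinI)
    qed
    then have "has_gradient_on (interior D) f (\<lambda>_. 0)" by (simp add: has_gradient_on_def)
    then have "\<bar>f y' - f y\<bar> \<le> 0 * (C * norm (y' - y))"
      using y y' o(4) by (intro mean_value_nearD[OF mv]) (auto simp: dist_commute)
    moreover have "f y = 1" "f y' = 0" using y y' o(3) by (auto simp: f_def indicator_def)
    ultimately show False by simp
  qed
  then show False
    using smooth_domain_connected[OF D] cover sub o(5,6) closure_subset
    unfolding connected_closed by (metis closed_closure inf.absorb1 inf.absorb_iff2 inf_bot_right inf_commute subset_empty)
qed

text \<open>One \<open>K\<close> serves all functions. It plays the role of the length of a path
  from \<open>x\<close> to \<open>y\<close> inside \<open>D\<close>.\<close>

definition oscillation_bound :: "(real^'n) set \<Rightarrow> real^'n \<Rightarrow> real^'n \<Rightarrow> real \<Rightarrow> bool" where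
  "oscillation_bound D x y K \<longleftrightarrow> K \<ge> 0 \<and>
    (\<forall>f \<beta> B. has_gradient_on D f \<beta> \<longrightarrow> (\<forall>z\<in>D. norm (\<beta> z) \<le> B) \<longrightarrow> \<bar>f x - f y\<bar> \<le> K * B)"

lemma oscillation_bound_exists:
  fixes D :: "(real^'n) set"
  assumes D: "smooth_domain D" and x: "x \<in> D" "y \<in> D"
  shows "\<exists>K. oscillation_bound D x y K"
proof (rule connected_equivalence_relation[OF smooth_domain_connected[OF D] x])
  show "\<exists>K. oscillation_bound D y x K" if "\<exists>K. oscillation_bound D x y K" for x y
    using that unfolding oscillation_bound_def by (simp add: abs_minus_commute)
next
  fix x y z
  assume "\<exists>K. oscillation_bound D x y K" "\<exists>K. oscillation_bound D y z K"
  then obtain K L where K: "oscillation_bound D x y K" and L: "oscillation_bound D y z L" by (elim exE)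
  have "\<bar>f x - f z\<bar> \<le> (K + L) * B" if "has_gradient_on D f \<beta>" "\<forall>z\<in>D. norm (\<beta> z) \<le> B" for f \<beta> B
  proof -
    have "\<bar>f x - f y\<bar> \<le> K * B" "\<bar>f y - f z\<bar> \<le> L * B" using K L that unfolding oscillation_bound_def by simp_all
    then show ?thesis unfolding distrib_right by linarith
  qed
  then show "\<exists>K. oscillation_bound D x z K"
    using K L unfolding oscillation_bound_def by (intro exI[of _ "K + L"]) simp
next
  fix a assume a: "a \<in> D"
  obtain d C where mv: "mean_value_near D a d C" using smooth_domain_mean_value(1)[OF D a] by blast
  then have d: "d > 0" "C \<ge> 1" using mean_value_near_pos by blast+
  have "\<exists>K. oscillation_bound D a x K" if "x \<in> D \<inter> ball a d" for x
    unfolding oscillation_bound_def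
  proof (intro exI conjI allI impI)
    show "0 \<le> C * norm (a - x)" using d by simp
    fix f \<beta> B assume "has_gradient_on D f \<beta>" "\<forall>z\<in>D. norm (\<beta> z) \<le> B"
    then show "\<bar>f a - f x\<bar> \<le> C * norm (a - x) * B"
      using mean_value_nearD[OF mv _ _ a, of x f \<beta> B] d(1) that by (simp add: mult.commute)
  qed
  then show "\<exists>T. openin (top_of_set D) T \<and> a \<in> T \<and> (\<forall>x\<in>T. \<exists>K. oscillation_bound D a x K)"
    using a d(1) by (intro exI[of _ "D \<inter> ball a d"]) (simp add: openin_open_Int)
qed

lemma extend_potential:
  fixes D :: "(real^'n) set"
  assumes D: "smooth_domain D" and cont: "continuous_on D \<beta>" and p: "has_gradient_on (interior D) p \<beta>"
  shows "\<exists>P. has_gradient_on D P \<beta>"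
proof -
  let ?I = "interior D"
  have limpt: "x islimpt ?I" if "x \<in> D" for x by (rule fat_islimpt_interior[OF smooth_domain_fat[OF D] that])
  have IsubD: "x \<in> D" if "x \<in> ?I" for x using that interior_subset by blast
  text \<open>The increments of \<open>p\<close> near a point \<open>x\<close> of \<open>D\<close> are close to those of the linear function given
    by \<open>\<beta> x\<close>; this yields both the existence of boundary values and their differentiability.\<close>
  have est: "\<exists>d>0. \<forall>y\<in>?I. \<forall>y'\<in>?I. dist x y < d \<longrightarrow> dist x y' < d \<longrightarrow>
      \<bar>p y' - p y - \<beta> x \<bullet> (y' - y)\<bar> \<le> e * norm (y' - y)" if x: "x \<in> D" and e: "e > 0" for x e
  proof -
    obtain d C where mv: "mean_value_near ?I x d C" using smooth_domain_mean_value(2)[OF D x] by blast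
    then have d: "d > 0" "C \<ge> 1" using mean_value_near_pos by blast+
    have "e / C > 0" using e d by simp
    then obtain r where r: "r > 0" "\<forall>z\<in>D. dist z x < r \<longrightarrow> dist (\<beta> z) (\<beta> x) < e / C"
      using cont x unfolding continuous_on_iff by blast
    \<comment> \<open>Points within \<open>d'\<close> of \<open>x\<close> are less than
      \<open>2 * d'\<close> apart, so the detour between them stays within \<open>r / 2\<close> of
      \<open>y\<close>; as \<open>d' \<le> r / 4\<close>, it stays within \<open>r\<close> of
      \<open>x\<close>.\<close>
    define d' where "d' = min d (r / (4 * C))"
    have d': "d' > 0" using d r by (simp add: d'_def)
    have "\<bar>p y' - p y - \<beta> x \<bullet> (y' - y)\<bar> \<le> e * norm (y' - y)"
      if y: "y \<in> ?I" "y' \<in> ?I" "dist x y < d'" "dist x y' < d'" for y y'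
    proof -
      \<comment> \<open>Subtracting the linear function with gradient \<open>\<beta> x\<close>
        leaves the gradient \<open>\<beta> z - \<beta> x\<close>, which is small near
        \<open>x\<close>.\<close>
      have "\<bar>(p y' - \<beta> x \<bullet> y') - (p y - \<beta> x \<bullet> y)\<bar> \<le> e / C * (C * norm (y' - y))"
      proof (rule mean_value_nearD[OF mv _ _ _ _ has_gradient_on_diff[OF p has_gradient_on_linear]])
        fix z assume z: "z \<in> ?I" "dist y z \<le> C * norm (y' - y)"
        have "norm (y' - y) < 2 * d'" using y dist_triangle2[of y' y x] by (simp add: dist_norm norm_minus_commute)
        then have "C * norm (y' - y) < C * (2 * d')" using d by simp
        also have "\<dots> \<le> r / 2" using d by (simp add: d'_def min_def field_simps)
        finally have "dist y z < r / 2" using z(2) by linarith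
        moreover have "d' \<le> r / 4" using d r(1) unfolding d'_def
          by (intro min.coboundedI2) (simp add: field_simps)
        ultimately have "dist z x < r" using y(3) dist_triangle[of z x y] r(1) by (simp add: dist_commute)
        then show "norm (\<beta> z - \<beta> x) \<le> e / C" using r(2) IsubD[OF z(1)] by (force simp: dist_norm)
      qed (use y in \<open>auto simp: d'_def\<close>)
      then show ?thesis using d by (simp add: inner_diff_right algebra_simps)
    qed
    then show ?thesis using d' by blast
  qed
  have lim: "\<exists>l. (p \<longlongrightarrow> l) (at x within ?I)" if x: "x \<in> D" for x
  proof -
    obtain d where d: "d > 0" "\<forall>y\<in>?I. \<forall>y'\<in>?I. dist x y < d \<longrightarrow> dist x y' < d \<longrightarrow>
      \<bar>p y' - p y - \<beta> x \<bullet> (y' - y)\<bar> \<le> 1 * norm (y' - y)" using est[OF x zero_less_one] by blast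
    have "uniformly_continuous_on (?I \<inter> ball x d) p"
    proof (rule lipschitz_on_uniformly_continuous[of "norm (\<beta> x) + 1"], rule lipschitz_onI)
      fix y y' assume "y \<in> ?I \<inter> ball x d" "y' \<in> ?I \<inter> ball x d"
      then have "\<bar>p y - p y' - \<beta> x \<bullet> (y - y')\<bar> \<le> norm (y - y')" using d(2) by auto
      moreover have "\<bar>\<beta> x \<bullet> (y - y')\<bar> \<le> norm (\<beta> x) * norm (y - y')" by (rule Cauchy_Schwarz_ineq2)
      ultimately show "dist (p y) (p y') \<le> (norm (\<beta> x) + 1) * dist y y'"
        by (simp add: dist_norm distrib_right)
    qed simp
    moreover have "x \<in> closure (?I \<inter> ball x d)"
      unfolding closure_approachable
    proof (intro allI impI)
      fix e :: real assume "e > 0"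
      then have "min d e > 0" using d(1) by simp
      then obtain z where "z \<in> ?I" "dist z x < min d e"
        using limpt[OF x] unfolding islimpt_approachable by blast
      then show "\<exists>z\<in>?I \<inter> ball x d. dist z x < e" by (auto simp: dist_commute)
    qed
    ultimately obtain l where "(p \<longlongrightarrow> l) (at x within (?I \<inter> ball x d))"
      using uniformly_continuous_on_extension_at_closure by metis
    then have "(p \<longlongrightarrow> l) (at x within ?I)"
      using at_within_nhd[of x "ball x d" "?I \<inter> ball x d" ?I] d(1) by auto
    then show ?thesis by blast
  qed
  define P where "P x = (SOME l. (p \<longlongrightarrow> l) (at x within ?I))" for x
  have P: "(p \<longlongrightarrow> P x) (at x within ?I)" if "x \<in> D" for x
    unfolding P_def using lim[OF that] by (rule someI_ex)
  have seq: "\<exists>f. (\<forall>n. f n \<in> ?I) \<and> f \<longlonglongrightarrow> x \<and> (\<lambda>n. p (f n)) \<longlonglongrightarrow> P x" if xD: "x \<in> D" for x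
  proof -
    obtain f where f: "\<forall>n. f n \<in> ?I - {x}" "f \<longlonglongrightarrow> x"
      using limpt[OF xD] unfolding islimpt_sequential by blast
    then have "(p \<circ> f) \<longlonglongrightarrow> P x" using P[OF xD] unfolding tendsto_at_iff_sequentially by blast
    then show ?thesis using f by (intro exI[of _ f]) (auto simp: o_def)
  qed
  \<comment> \<open>Both points are limits of interior sequences along which the increment estimate
    holds; being non-strict, it survives in the limit.\<close>
  have "(P has_derivative (\<lambda>v. \<beta> x \<bullet> v)) (at x within D)" if x: "x \<in> D" for x
    unfolding has_derivative_within_alt
  proof (intro conjI allI impI bounded_linear_inner_right)
    fix e :: real assume "e > 0"
    then obtain d where d: "d > 0" "\<forall>y\<in>?I. \<forall>y'\<in>?I. dist x y < d \<longrightarrow> dist x y' < d \<longrightarrow>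
      \<bar>p y' - p y - \<beta> x \<bullet> (y' - y)\<bar> \<le> e * norm (y' - y)" using est[OF x] by blast
    have "norm (P x' - P x - \<beta> x \<bullet> (x' - x)) \<le> e * norm (x' - x)" if x': "x' \<in> D" "norm (x' - x) < d" for x'
    proof -
      obtain f where f: "\<forall>n. f n \<in> ?I" "f \<longlonglongrightarrow> x" "(\<lambda>n. p (f n)) \<longlonglongrightarrow> P x" using seq[OF x] by blast
      obtain f' where f': "\<forall>n. f' n \<in> ?I" "f' \<longlonglongrightarrow> x'" "(\<lambda>n. p (f' n)) \<longlonglongrightarrow> P x'" using seq[OF x'(1)] by blast
      have "x' \<in> ball x d" using x'(2) by (simp add: dist_norm norm_minus_commute)
      then have "eventually (\<lambda>n. f' n \<in> ball x d) sequentially" using f'(2) topological_tendstoD[OF f'(2) open_ball] by blast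
      moreover have "eventually (\<lambda>n. f n \<in> ball x d) sequentially"
        using topological_tendstoD[OF f(2) open_ball, of x d] d(1) by simp
      ultimately have "eventually (\<lambda>n. norm (p (f' n) - p (f n) - \<beta> x \<bullet> (f' n - f n)) \<le> e * norm (f' n - f n)) sequentially"
        by eventually_elim (use d(2) f(1) f'(1) in auto)
      then show ?thesis
        by (rule tendsto_le[OF sequentially_bot _ _, rotated -1]) (intro tendsto_intros f f')+
    qed
    then show "\<exists>d>0. \<forall>y\<in>D. norm (y - x) < d \<longrightarrow> norm (P y - P x - \<beta> x \<bullet> (y - x)) \<le> e * norm (y - x)"
      using d(1) by blast
  qed
  then show ?thesis unfolding has_gradient_on_def by blast
qed

lemma annihilator_has_potential:
  fixes D :: "(real^'n) set"
  assumes D: "smooth_domain D" and cont: "continuous_on D \<beta>" and ann: "annihilates_solenoidal (interior D) \<beta>"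
  shows "\<exists>P. has_gradient_on D P \<beta>"
proof -
  obtain p where "\<forall>x\<in>interior D. (p has_derivative (\<lambda>v. \<beta> x \<bullet> v)) (at x)"
    using potential_of_annihilator[OF open_interior smooth_domain_interior_connected[OF D] _ ann]
      continuous_on_subset[OF cont interior_subset] by blast
  then have "has_gradient_on (interior D) p \<beta>"
    unfolding has_gradient_on_def by (auto intro: has_derivative_at_withinI)
  then show ?thesis by (rule extend_potential[OF D cont])
qed

subsection \<open>Time-dependent potentials\<close>

locale space_time =
  fixes D :: "(real^'n) set" and T :: real
  assumes D: "smooth_domain D" and T: "0 < T"
begin

lemma fat_D: "fat D"
  by (rule smooth_domain_fat[OF D])

lemma fat_space_time: "fat ({0..T} \<times> D)"
  by (intro fat_Times fat_Icc T fat_D)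

lemma time_smooth_has_derivative:
  assumes "time_smooth D T f" "t \<in> {0..T}" "x \<in> D"
  shows "((\<lambda>(t, x). f t x) has_derivative
    frechet_derivative (\<lambda>(t, x). f t x) (at (t, x) within {0..T} \<times> D)) (at (t, x) within {0..T} \<times> D)"
  using assms smooth_on_has_derivative unfolding time_smooth_def by blast

lemma time_smooth_continuous: "time_smooth D T f \<Longrightarrow> continuous_on ({0..T} \<times> D) (\<lambda>(t, x). f t x)"
  unfolding time_smooth_def by (rule smooth_on_continuous)

lemma time_deriv_eq:
  assumes "((\<lambda>s. f s x) has_vector_derivative f') (at t within {0..T})" "t \<in> {0..T}"
  shows "time_deriv T f t x = f'"
  unfolding time_deriv_def
  using vector_derivative_within_cbox[of 0 T t "\<lambda>s. f s x" f'] assms T by simp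

lemma time_deriv_frechet:
  assumes "time_smooth D T f" "t \<in> {0..T}" "x \<in> D"
  shows "((\<lambda>s. f s x) has_vector_derivative time_deriv T f t x) (at t within {0..T})"
    and "time_deriv T f t x = frechet_derivative (\<lambda>(t, x). f t x) (at (t, x) within {0..T} \<times> D) (1, 0)"
proof -
  let ?f' = "frechet_derivative (\<lambda>(t, x). f t x) (at (t, x) within {0..T} \<times> D)"
  have 1: "((\<lambda>s. (s, x)) has_derivative (\<lambda>h. (h, 0))) (at t within {0..T})"
    by (auto intro!: derivative_eq_intros)
  have 2: "((\<lambda>(t, x). f t x) has_derivative ?f') (at (t, x) within (\<lambda>s. (s, x)) ` {0..T})"
    by (rule has_derivative_subset[OF time_smooth_has_derivative[OF assms]]) (use assms(3) in auto)
  have lin: "?f' (h, 0) = h *\<^sub>R ?f' (1, 0)" for h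
    using linear_simps(5)[OF has_derivative_bounded_linear[OF time_smooth_has_derivative[OF assms]], of h "(1, 0)"]
    by simp
  have *: "((\<lambda>s. f s x) has_vector_derivative ?f' (1, 0)) (at t within {0..T})"
    using diff_chain_within[OF 1 2] unfolding has_vector_derivative_def ext[OF lin, symmetric] o_def by simp
  then show eq: "time_deriv T f t x = ?f' (1, 0)" by (rule time_deriv_eq[OF _ assms(2)])
  show "((\<lambda>s. f s x) has_vector_derivative time_deriv T f t x) (at t within {0..T})"
    unfolding eq by (rule *)
qed

lemma time_smooth_time_deriv:
  assumes "time_smooth D T f" shows "time_smooth D T (time_deriv T f)"
proof -
  have "smooth_on ({0..T} \<times> D) (\<lambda>p. frechet_derivative (\<lambda>(t, x). f t x) (at p within {0..T} \<times> D) (1, 0))"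
    using assms unfolding time_smooth_def by (rule smooth_on_frechet_derivative)
  then show ?thesis
    unfolding time_smooth_def
    by (rule smooth_on_cong[THEN iffD1, rotated]) (auto simp: time_deriv_frechet(2)[OF assms])
qed

lemma time_smooth_slice:
  assumes "time_smooth D T f" "t \<in> {0..T}" shows "smooth_on D (f t)"
proof -
  have "smooth_on D (\<lambda>x. (\<lambda>(t, x). f t x) ((t, 0) + (0, x)))"
    by (rule smooth_on_affine[OF fat_D _ _ assms(1)[unfolded time_smooth_def]])
      (use assms(2) in \<open>auto intro!: bounded_linear_intros\<close>)
  then show ?thesis by simp
qed

lemma frechet_derivative_slice:
  assumes "time_smooth D T f" "t \<in> {0..T}" "x \<in> D"
  shows "frechet_derivative (f t) (at x within D) v =
    frechet_derivative (\<lambda>(t, x). f t x) (at (t, x) within {0..T} \<times> D) (0, v)"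
proof -
  let ?f' = "frechet_derivative (\<lambda>(t, x). f t x) (at (t, x) within {0..T} \<times> D)"
  have 1: "((\<lambda>x. (t, x)) has_derivative (\<lambda>h. (0, h))) (at x within D)"
    by (auto intro!: derivative_eq_intros)
  have 2: "((\<lambda>(t, x). f t x) has_derivative ?f') (at (t, x) within (\<lambda>x. (t, x)) ` D)"
    by (rule has_derivative_subset[OF time_smooth_has_derivative[OF assms]]) (use assms(2) in auto)
  have "(f t has_derivative (\<lambda>v. ?f' (0, v))) (at x within D)"
    using diff_chain_within[OF 1 2] by (simp add: o_def)
  from frechet_derivative_fat[OF fat_D assms(3) this] show ?thesis by simp
qed

text \<open>In space-time the spatial direction \<open>u t x\<close> is the direction
  \<open>(0, u t x)\<close>, so joint smoothness follows from that of a single map on the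
  cylinder.\<close>

lemma time_smooth_directional:
  fixes f :: "real \<Rightarrow> real^'n \<Rightarrow> 'b::real_normed_vector"
  assumes f: "time_smooth D T f" and u: "time_smooth D T u"
  shows "time_smooth D T (\<lambda>t x. frechet_derivative (f t) (at x within D) (u t x))"
proof -
  have "smooth_on ({0..T} \<times> D) (\<lambda>p. (0 :: real, case p of (t, x) \<Rightarrow> u t x))"
    using smooth_on_linear[OF fat_space_time _ u[unfolded time_smooth_def], of "\<lambda>v. (0 :: real, v)"]
    by (simp add: bounded_linear_intros)
  from smooth_on_frechet_derivative_field[OF fat_space_time f[unfolded time_smooth_def] this]
  show ?thesis unfolding time_smooth_def
    by (rule smooth_on_cong[THEN iffD1, rotated]) (auto simp: frechet_derivative_slice[OF f])
qed

lemma time_smooth_bilinear: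
  assumes "bounded_bilinear B" "time_smooth D T f" "time_smooth D T g"
  shows "time_smooth D T (\<lambda>t x. B (f t x) (g t x))"
  using smooth_on_bilinear[OF fat_space_time assms(1) assms(2,3)[unfolded time_smooth_def]]
  unfolding time_smooth_def by (simp add: case_prod_unfold)

lemmas time_smooth_mult = time_smooth_bilinear[OF bounded_bilinear_mult]
  and time_smooth_scaleR = time_smooth_bilinear[OF bounded_bilinear_scaleR]
  and time_smooth_inner = time_smooth_bilinear[OF bounded_bilinear_inner]

lemma time_smooth_add:
  "time_smooth D T f \<Longrightarrow> time_smooth D T g \<Longrightarrow> time_smooth D T (\<lambda>t x. f t x + g t x)"
  using smooth_on_add[OF fat_space_time, of "\<lambda>(t, x). f t x" "\<lambda>(t, x). g t x"]
  unfolding time_smooth_def by (simp add: case_prod_unfold)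

lemma time_smooth_diff:
  "time_smooth D T f \<Longrightarrow> time_smooth D T g \<Longrightarrow> time_smooth D T (\<lambda>t x. f t x - g t x)"
  using smooth_on_diff[OF fat_space_time, of "\<lambda>(t, x). f t x" "\<lambda>(t, x). g t x"]
  unfolding time_smooth_def by (simp add: case_prod_unfold)

lemma time_smooth_minus: "time_smooth D T f \<Longrightarrow> time_smooth D T (\<lambda>t x. - f t x)"
  using smooth_on_minus[OF fat_space_time, of "\<lambda>(t, x). f t x"]
  unfolding time_smooth_def by (simp add: case_prod_unfold)

lemma time_smooth_sum:
  "(\<And>i. i \<in> I \<Longrightarrow> time_smooth D T (f i)) \<Longrightarrow> time_smooth D T (\<lambda>t x. \<Sum>i\<in>I. f i t x)"
  using smooth_on_sum[OF fat_space_time, of I "\<lambda>i (t, x). f i t x"]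
  unfolding time_smooth_def by (simp add: case_prod_unfold)

lemma time_smooth_divide:
  fixes f g :: "real \<Rightarrow> real^'n \<Rightarrow> real"
  shows "time_smooth D T f \<Longrightarrow> time_smooth D T g \<Longrightarrow> (\<And>t x. t \<in> {0..T} \<Longrightarrow> x \<in> D \<Longrightarrow> g t x \<noteq> 0) \<Longrightarrow>
    time_smooth D T (\<lambda>t x. f t x / g t x)"
  using smooth_on_divide[OF fat_space_time, of "\<lambda>(t, x). g t x" "\<lambda>(t, x). f t x"]
  unfolding time_smooth_def by (auto simp: case_prod_unfold)

lemma time_smooth_space:
  assumes "smooth_on D f" shows "time_smooth D T (\<lambda>_. f)"
  using smooth_on_comp_linear[OF fat_space_time bounded_linear_snd _ assms]
  unfolding time_smooth_def by (simp add: case_prod_unfold mem_Times_iff)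

lemma time_smooth_const: "time_smooth D T (\<lambda>_ _. c)"
  by (intro time_smooth_space smooth_on_const fat_D)

lemma time_smooth_time:
  assumes "smooth_on UNIV a" shows "time_smooth D T (\<lambda>t _. a t)"
  using smooth_on_comp_linear[OF fat_space_time bounded_linear_fst _ assms]
  unfolding time_smooth_def by (simp add: case_prod_unfold)

definition annihilator_family :: "(real \<Rightarrow> real^'n \<Rightarrow> real^'n) \<Rightarrow> bool" where
  "annihilator_family \<beta> \<longleftrightarrow> time_smooth D T \<beta> \<and> (\<forall>t\<in>{0..T}. annihilates_solenoidal (interior D) (\<beta> t))"

text \<open>For a fixed test field the pairing is 0 at all times, so its time derivative, taken
  under the integral, is 0 too. Hence \<open>\<beta>\<close> can be differentiated in time any
  number of times without leaving the class of fields that have potentials.\<close>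

lemma annihilator_family_time_deriv:
  assumes \<beta>: "annihilator_family \<beta>" shows "annihilator_family (time_deriv T \<beta>)"
proof -
  have sm: "time_smooth D T \<beta>" using \<beta> unfolding annihilator_family_def by blast
  note sm' = time_smooth_time_deriv[OF sm]
  have "(LINT x|lborel. time_deriv T \<beta> t x \<bullet> V x) = 0"
    if t: "t \<in> {0..T}" and V: "V \<in> test_fields (interior D)" and div: "\<forall>x. euclid_div V x = 0" for t V
  proof -
    obtain K where K: "compact K" "K \<subseteq> interior D" "\<forall>x. x \<notin> K \<longrightarrow> V x = 0" using V by (auto simp: test_fields_def)
    have KD: "K \<subseteq> D" using K(2) interior_subset by blast
    have contV: "continuous_on S V" for S
      using V smooth_on_continuous continuous_on_subset unfolding test_fields_def by blast
    have eq: "(LINT x|lborel. \<gamma> x \<bullet> V x) = (LINT x:K|lborel. \<gamma> x \<bullet> V x)" for \<gamma>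
      by (rule integral_eq_set_integral) (use K(3) in simp)
    have "((\<lambda>s. LINT x:K|lborel. \<beta> s x \<bullet> V x) has_vector_derivative
        (LINT x:K|lborel. time_deriv T \<beta> t x \<bullet> V x)) (at t within {0..T})"
    proof (rule has_vector_derivative_set_integral[OF K(1) _ _ _ t])
      have "continuous_on ({0..T} \<times> K) (\<lambda>(s, x). time_deriv T \<beta> s x)"
        using time_smooth_continuous[OF sm'] KD by (auto intro: continuous_on_subset)
      then show "continuous_on ({0..T} \<times> K) (\<lambda>(s, x). time_deriv T \<beta> s x \<bullet> V x)"
        unfolding case_prod_unfold
        by (intro continuous_on_inner continuous_on_compose2[OF contV[of UNIV]] continuous_on_snd) auto
      show "continuous_on K (\<lambda>x. \<beta> s x \<bullet> V x)" if "s \<in> {0..T}" for s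
        using smooth_on_continuous[OF time_smooth_slice[OF sm that]] KD
        by (intro continuous_on_inner contV) (auto intro: continuous_on_subset)
      show "((\<lambda>s. \<beta> s x \<bullet> V x) has_vector_derivative time_deriv T \<beta> s x \<bullet> V x) (at s within {0..T})"
        if "s \<in> {0..T}" "x \<in> K" for s x
        using bounded_linear.has_vector_derivative[OF bounded_linear_inner_left time_deriv_frechet(1)[OF sm that(1)]] that(2) KD
        by blast
    qed
    moreover have "((\<lambda>s. LINT x:K|lborel. \<beta> s x \<bullet> V x) has_vector_derivative 0) (at t within {0..T})"
    proof (rule has_vector_derivative_transform[OF t _ has_vector_derivative_const])
      fix s assume "s \<in> {0..T}"
      then show "(LINT x:K|lborel. \<beta> s x \<bullet> V x) = 0"
        using \<beta> V div unfolding annihilator_family_def annihilates_solenoidal_def eq[symmetric] by blast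
    qed
    ultimately have "(LINT x:K|lborel. time_deriv T \<beta> t x \<bullet> V x) = 0"
      using vector_derivative_unique_within_closed_interval[of 0 T t] T t by auto
    then show ?thesis by (simp add: eq)
  qed
  then show ?thesis using sm' unfolding annihilator_family_def annihilates_solenoidal_def by blast
qed

definition base_point :: "real^'n" where
  "base_point = (SOME x. x \<in> D)"

lemma base_point: "base_point \<in> D"
  unfolding base_point_def using smooth_domain_nonempty[OF D] by (simp add: some_in_eq)

text \<open>At each time the gradient leaves an additive constant free. Fixing the value 0 at
  \<open>base_point\<close> prevents this constant from jumping in time.\<close>

definition potential :: "(real \<Rightarrow> real^'n \<Rightarrow> real^'n) \<Rightarrow> real \<Rightarrow> real^'n \<Rightarrow> real" where
  "potential \<beta> t = (SOME P. has_gradient_on D P (\<beta> t) \<and> P base_point = 0)"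

lemma potential:
  assumes \<beta>: "annihilator_family \<beta>" and t: "t \<in> {0..T}"
  shows "has_gradient_on D (potential \<beta> t) (\<beta> t)" "potential \<beta> t base_point = 0"
proof -
  have "continuous_on D (\<beta> t)"
    using \<beta> t smooth_on_continuous[OF time_smooth_slice] unfolding annihilator_family_def by blast
  then obtain P where P: "has_gradient_on D P (\<beta> t)"
    using annihilator_has_potential[OF D] \<beta> t unfolding annihilator_family_def by blast
  have "has_gradient_on D (\<lambda>x. P x - P base_point) (\<beta> t) \<and> P base_point - P base_point = 0"
    using P unfolding has_gradient_on_def by (auto intro!: derivative_eq_intros)
  then have "has_gradient_on D (potential \<beta> t) (\<beta> t) \<and> potential \<beta> t base_point = 0"
    unfolding potential_def by (rule someI[where x = "\<lambda>x. P x - P base_point"])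
  then show "has_gradient_on D (potential \<beta> t) (\<beta> t)" "potential \<beta> t base_point = 0" by auto
qed

text \<open>The expression to be bounded is itself a function that vanishes at
  \<open>base_point\<close>. Its gradient is the corresponding error for \<open>\<beta>\<close>,
  which is uniformly small on \<open>D\<close>, and the oscillation bound turns this into smallness
  at \<open>x\<close>.\<close>

lemma potential_time_derivative:
  assumes \<beta>: "annihilator_family \<beta>" and t: "t \<in> {0..T}" and x: "x \<in> D" and e: "e > 0"
  shows "\<exists>d>0. \<forall>t'\<in>{0..T}. \<bar>t' - t\<bar> < d \<longrightarrow>
    \<bar>potential \<beta> t' x - potential \<beta> t x - (t' - t) * potential (time_deriv T \<beta>) t x\<bar> \<le> e * \<bar>t' - t\<bar>"
proof -
  note \<beta>' = annihilator_family_time_deriv[OF \<beta>]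
  have sm: "time_smooth D T \<beta>" "time_smooth D T (time_deriv T \<beta>)"
    using \<beta> \<beta>' unfolding annihilator_family_def by blast+
  obtain K where K: "K \<ge> 0"
    "\<forall>f \<beta> B. has_gradient_on D f \<beta> \<longrightarrow> (\<forall>z\<in>D. norm (\<beta> z) \<le> B) \<longrightarrow> \<bar>f x - f base_point\<bar> \<le> K * B"
    using oscillation_bound_exists[OF D x base_point] unfolding oscillation_bound_def by blast
  define e' where "e' = e / (K + 1)"
  have e': "e' > 0" "K * e' \<le> e" using e K(1) by (auto simp: e'_def field_simps)
  obtain d where d: "d > 0" "\<forall>s\<in>{0..T}. \<forall>s'\<in>{0..T}. \<bar>s' - s\<bar> < d \<longrightarrow>
    (\<forall>x\<in>D. norm (\<beta> s' x - \<beta> s x - (s' - s) *\<^sub>R time_deriv T \<beta> s x) \<le> e' * \<bar>s' - s\<bar>)"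
    using difference_quotient_uniform[OF smooth_domain_compact[OF D] time_smooth_continuous[OF sm(2)]
        time_deriv_frechet(1)[OF sm(1)] e'(1)] by blast
  have "\<bar>potential \<beta> t' x - potential \<beta> t x - (t' - t) * potential (time_deriv T \<beta>) t x\<bar> \<le> e * \<bar>t' - t\<bar>"
    if t': "t' \<in> {0..T}" "\<bar>t' - t\<bar> < d" for t'
  proof -
    have "has_gradient_on D (\<lambda>x. potential \<beta> t' x - potential \<beta> t x - (t' - t) * potential (time_deriv T \<beta>) t x)
        (\<lambda>x. \<beta> t' x - \<beta> t x - (t' - t) *\<^sub>R time_deriv T \<beta> t x)"
      by (intro has_gradient_on_diff has_gradient_on_scale potential(1) \<beta> \<beta>' t t'(1))
    moreover have "\<forall>z\<in>D. norm (\<beta> t' z - \<beta> t z - (t' - t) *\<^sub>R time_deriv T \<beta> t z) \<le> e' * \<bar>t' - t\<bar>"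
      using d(2) t t' by blast
    ultimately have "\<bar>(potential \<beta> t' x - potential \<beta> t x - (t' - t) * potential (time_deriv T \<beta>) t x) -
      (potential \<beta> t' base_point - potential \<beta> t base_point - (t' - t) * potential (time_deriv T \<beta>) t base_point)\<bar>
        \<le> K * (e' * \<bar>t' - t\<bar>)"
      using K(2)[rule_format] by blast
    moreover have "K * (e' * \<bar>t' - t\<bar>) \<le> e * \<bar>t' - t\<bar>"
      using mult_right_mono[OF e'(2), of "\<bar>t' - t\<bar>"] by (simp add: mult.assoc)
    ultimately show ?thesis
      unfolding potential(2)[OF \<beta> t] potential(2)[OF \<beta> t'(1)] potential(2)[OF \<beta>' t] by simp
  qed
  then show ?thesis using d(1) by blast
qed

text \<open>The increment is split into a step in time at fixed \<open>x\<close> and a step in space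
  at time \<open>t'\<close>, each allotted half of \<open>e\<close>. The second step has gradient
  \<open>\<beta> t'\<close> instead of \<open>\<beta> t\<close>, hence the appeal to joint
  continuity of \<open>\<beta>\<close>.\<close>

lemma potential_has_derivative:
  assumes \<beta>: "annihilator_family \<beta>" and t: "t \<in> {0..T}" and x: "x \<in> D"
  shows "((\<lambda>(t, x). potential \<beta> t x) has_derivative
    (\<lambda>(r, v). r * potential (time_deriv T \<beta>) t x + \<beta> t x \<bullet> v)) (at (t, x) within {0..T} \<times> D)"
  unfolding has_derivative_within_alt
proof (intro conjI allI impI)
  show "bounded_linear (\<lambda>(r, v). r * potential (time_deriv T \<beta>) t x + \<beta> t x \<bullet> v)"
    unfolding case_prod_unfold by (intro bounded_linear_intros)
  fix e :: real assume e: "e > 0"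
  have sm: "time_smooth D T \<beta>" using \<beta> unfolding annihilator_family_def by blast
  obtain d C where mv: "mean_value_near D x d C" using smooth_domain_mean_value(1)[OF D x] by blast
  then have d: "d > 0" "C \<ge> 1" using mean_value_near_pos by blast+
  define e' where "e' = e / (2 * C)"
  have e': "e' > 0" "e' * C = e / 2" using e d by (auto simp: e'_def)
  obtain d1 where d1: "d1 > 0" "\<forall>q\<in>{0..T} \<times> D. dist q (t, x) < d1 \<longrightarrow>
      dist (case q of (s, y) \<Rightarrow> \<beta> s y) (\<beta> t x) < e'"
    using time_smooth_continuous[OF sm, unfolded continuous_on_iff, rule_format, of "(t, x)" e'] t x e'(1) by auto
  have "e / 2 > 0" using e by simp
  from potential_time_derivative[OF \<beta> t x this] obtain d2 where d2: "d2 > 0" "\<forall>t'\<in>{0..T}. \<bar>t' - t\<bar> < d2 \<longrightarrow>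
    \<bar>potential \<beta> t' x - potential \<beta> t x - (t' - t) * potential (time_deriv T \<beta>) t x\<bar> \<le> e / 2 * \<bar>t' - t\<bar>" by blast
  \<comment> \<open>As \<open>C \<ge> 1\<close>, both \<open>\<bar>t' - t\<bar>\<close> and the
    reach \<open>C * norm (x' - x)\<close> of the detour are then below
    \<open>d1 / 2\<close>.\<close>
  define d3 where "d3 = min (min d d2) (d1 / (2 * C))"
  have d3: "d3 > 0" using d d1 d2 by (simp add: d3_def)
  have "norm (potential \<beta> t' x' - potential \<beta> t x - ((t' - t) * potential (time_deriv T \<beta>) t x + \<beta> t x \<bullet> (x' - x)))
      \<le> e * norm ((t', x') - (t, x))"
    if t': "t' \<in> {0..T}" and x': "x' \<in> D" and near: "norm ((t', x') - (t, x)) < d3" for t' x'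
  proof -
    have n: "\<bar>t' - t\<bar> \<le> norm ((t', x') - (t, x))" "norm (x' - x) \<le> norm ((t', x') - (t, x))"
      using norm_fst_le[of "t' - t" "x' - x"] norm_snd_le[of "x' - x" "t' - t"] by simp_all
    then have small: "\<bar>t' - t\<bar> < d3" "norm (x' - x) < d3" using near by linarith+
    have "C * \<bar>t' - t\<bar> < C * d3" "C * norm (x' - x) < C * d3" using small d by simp_all
    moreover have "C * d3 \<le> C * (d1 / (2 * C))" using d by (intro mult_left_mono) (auto simp: d3_def)
    moreover have "C * (d1 / (2 * C)) = d1 / 2" using d by simp
    moreover have "\<bar>t' - t\<bar> \<le> C * \<bar>t' - t\<bar>" using d by (simp add: mult_le_cancel_right1)
    ultimately have small1: "\<bar>t' - t\<bar> < d1 / 2" "C * norm (x' - x) < d1 / 2" by linarith+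
    have "\<bar>(potential \<beta> t' x' - \<beta> t x \<bullet> x') - (potential \<beta> t' x - \<beta> t x \<bullet> x)\<bar> \<le> e' * (C * norm (x' - x))"
    proof (rule mean_value_nearD[OF mv x _ x' _ has_gradient_on_diff[OF potential(1)[OF \<beta> t'] has_gradient_on_linear]])
      show "dist x x < d" using d by simp
      show "dist x x' < d" using small by (simp add: d3_def dist_norm norm_minus_commute)
      fix z assume z: "z \<in> D" "dist x z \<le> C * norm (x' - x)"
      have "dist (t', z) (t, x) \<le> \<bar>t' - t\<bar> + dist z x"
        using sqrt_sum_squares_le_sum_abs[of "dist t' t" "dist z x"] by (simp add: dist_Pair_Pair dist_real_def)
      then have "dist (t', z) (t, x) < d1" using small1 z(2) by (simp add: dist_commute)
      then have "dist (\<beta> t' z) (\<beta> t x) < e'" using d1(2) t' z(1) by force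
      then show "norm (\<beta> t' z - \<beta> t x) \<le> e'" by (simp add: dist_norm)
    qed
    moreover have "e' * (C * norm (x' - x)) \<le> e / 2 * norm ((t', x') - (t, x))"
      unfolding mult.assoc[symmetric] e'(2) using n(2) e by (intro mult_left_mono) auto
    moreover have "\<bar>potential \<beta> t' x - potential \<beta> t x - (t' - t) * potential (time_deriv T \<beta>) t x\<bar> \<le> e / 2 * \<bar>t' - t\<bar>"
      using d2(2) t' small by (simp add: d3_def)
    moreover have "e / 2 * \<bar>t' - t\<bar> \<le> e / 2 * norm ((t', x') - (t, x))"
      using n(1) e by (intro mult_left_mono) auto
    ultimately show ?thesis
      unfolding inner_diff_right real_norm_def by (smt (verit) field_sum_of_halves distrib_right)
  qed
  then show "\<exists>d>0. \<forall>y\<in>{0..T} \<times> D. norm (y - (t, x)) < d \<longrightarrow>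
      norm ((case y of (t, x) \<Rightarrow> potential \<beta> t x) - (case (t, x) of (t, x) \<Rightarrow> potential \<beta> t x) -
        (case y - (t, x) of (r, v) \<Rightarrow> r * potential (time_deriv T \<beta>) t x + \<beta> t x \<bullet> v)) \<le> e * norm (y - (t, x))"
    using d3 by (intro exI[of _ d3]) auto
qed

text \<open>The derivative of the potential is made of \<open>\<beta>\<close> and of the potential
  of its time derivative, so the induction on the order has to run over all families at
  once.\<close>

lemma time_smooth_potential:
  assumes "annihilator_family \<beta>" shows "time_smooth D T (potential \<beta>)"
proof -
  have "C_k_on n ({0..T} \<times> D) (\<lambda>(t, x). potential \<beta> t x)" if "annihilator_family \<beta>" for n \<beta>
    using that
  proof (induction n arbitrary: \<beta>)
    case 0
    have "(\<lambda>(t, x). potential \<beta> t x) differentiable_on {0..T} \<times> D"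
      unfolding differentiable_on_def
      by (auto intro: differentiableI[OF potential_has_derivative[OF 0]])
    then show ?case by (simp add: differentiable_imp_continuous_on)
  next
    case (Suc n)
    show ?case
    proof (rule C_k_on_SucI[OF fat_space_time])
      fix p assume p: "p \<in> {0..T} \<times> D"
      obtain t x where tx: "p = (t, x)" by (cases p)
      show "((\<lambda>(t, x). potential \<beta> t x) has_derivative
        (\<lambda>w. fst w * (case p of (t, x) \<Rightarrow> potential (time_deriv T \<beta>) t x) + (case p of (t, x) \<Rightarrow> \<beta> t x) \<bullet> snd w))
          (at p within {0..T} \<times> D)"
        using potential_has_derivative[OF Suc.prems, of t x] p unfolding tx by (simp add: case_prod_unfold)
    next
      fix w :: "real \<times> (real^'n)"
      have 1: "C_k_on n ({0..T} \<times> D) (\<lambda>(t, x). \<beta> t x)"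
        using Suc.prems unfolding annihilator_family_def time_smooth_def smooth_on_def by blast
      note 2 = Suc.IH[OF annihilator_family_time_deriv[OF Suc.prems]]
      have "C_k_on n ({0..T} \<times> D) (\<lambda>p. fst w * (case p of (t, x) \<Rightarrow> potential (time_deriv T \<beta>) t x))"
        by (rule C_k_on_bilinear[OF fat_space_time bounded_bilinear_mult C_k_on_const[OF fat_space_time] 2])
      moreover have "C_k_on n ({0..T} \<times> D) (\<lambda>p. (case p of (t, x) \<Rightarrow> \<beta> t x) \<bullet> snd w)"
        by (rule C_k_on_bilinear[OF fat_space_time bounded_bilinear_inner 1 C_k_on_const[OF fat_space_time]])
      ultimately show "C_k_on n ({0..T} \<times> D) (\<lambda>p. fst w * (case p of (t, x) \<Rightarrow> potential (time_deriv T \<beta>) t x) +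
          (case p of (t, x) \<Rightarrow> \<beta> t x) \<bullet> snd w)"
        by (rule C_k_on_add[OF fat_space_time])
    qed
  qed
  then show ?thesis using assms unfolding time_smooth_def smooth_on_def by blast
qed

end

subsection \<open>Volume forms and divergence\<close>

lemma replace_vec_nth: "replace_vec V i w $ j = (if j = i then w else V $ j)"
  by (simp add: replace_vec_def)

lemma replace_vec_simps:
  "replace_vec V i (V $ i) = V"
  "replace_vec (replace_vec V i w) i z = replace_vec V i z"
  "i \<noteq> j \<Longrightarrow> replace_vec (replace_vec V i w) j z = replace_vec (replace_vec V j z) i w"
  by (simp_all add: vec_eq_iff replace_vec_nth)

lemma alternating_multilinearD:
  assumes "alternating_multilinear \<omega>"
  shows "linear (\<lambda>w. \<omega> (replace_vec V i w))"
    and "i \<noteq> j \<Longrightarrow> V $ i = V $ j \<Longrightarrow> \<omega> V = 0"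
  using assms unfolding alternating_multilinear_def by blast+

lemma alternating_multilinear_linear:
  assumes "alternating_multilinear \<omega>"
  shows "\<omega> (replace_vec V i (w + z)) = \<omega> (replace_vec V i w) + \<omega> (replace_vec V i z)"
    "\<omega> (replace_vec V i (c *\<^sub>R w)) = c * \<omega> (replace_vec V i w)"
    "\<omega> (replace_vec V i 0) = 0"
  using linear_add[OF alternating_multilinearD(1)[OF assms]] linear_scale[OF alternating_multilinearD(1)[OF assms]]
    linear_0[OF alternating_multilinearD(1)[OF assms]] by simp_all

lemma alternating_multilinear_swap:
  assumes \<omega>: "alternating_multilinear \<omega>" and kl: "k \<noteq> l"
  shows "\<omega> (replace_vec (replace_vec V k y) l z) + \<omega> (replace_vec (replace_vec V k z) l y) = 0"
proof -
  have eq: "\<omega> (replace_vec (replace_vec V k a) l a) = 0" for a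
    by (rule alternating_multilinearD(2)[OF \<omega> kl]) (simp add: replace_vec_nth)
  have add: "\<omega> (replace_vec (replace_vec V k (a + b)) l c) =
      \<omega> (replace_vec (replace_vec V k a) l c) + \<omega> (replace_vec (replace_vec V k b) l c)" for a b c
    unfolding replace_vec_simps(3)[OF kl] by (rule alternating_multilinear_linear[OF \<omega>])
  have "0 = \<omega> (replace_vec (replace_vec V k (y + z)) l (y + z))" by (simp add: eq)
  also have "\<dots> = \<omega> (replace_vec (replace_vec V k y) l z) + \<omega> (replace_vec (replace_vec V k z) l y)"
    by (simp only: alternating_multilinear_linear(1)[OF \<omega>] add eq)
  finally show ?thesis by simp
qed

lemma mat_1_nth: "mat 1 $ i = axis i (1::real)"
  by (simp add: vec_eq_iff mat_def axis_def)

text \<open>Row reduction brings \<open>V\<close> to cases that multilinearity and alternation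
  decide: a zero row, a diagonal matrix, or a row changed by a multiple of another.\<close>

lemma alternating_multilinear_eq_0:
  fixes \<omega> :: "(real^'n)^'n \<Rightarrow> real"
  assumes "alternating_multilinear \<omega>" "\<omega> (mat 1) = 0"
  shows "\<omega> V = 0"
proof -
  \<comment> \<open>The form is quantified inside the induction because the principle also swaps
    columns, that is, two coordinates of all vectors at once. Such a swap is absorbed into a new
    form.\<close>
  have "\<forall>\<omega>. alternating_multilinear \<omega> \<longrightarrow> \<omega> (mat 1) = 0 \<longrightarrow> \<omega> V = 0"
  proof (induction V rule: induct_matrix_row_operations)
    case (1 A i)
    then have "replace_vec A i 0 = A" by (simp add: vec_eq_iff replace_vec_nth row_def)
    then show ?case using alternating_multilinear_linear(3) by metis
  next
    case (2 A)
    have "\<omega> (\<chi> i. if i \<in> J then A $ i else axis i 1) = 0"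
      if "alternating_multilinear \<omega>" "\<omega> (mat 1) = 0" "finite J" for \<omega> J
      using that(3)
    proof induction
      case empty
      have "(\<chi> i. axis i (1::real)) = (mat 1 :: real^'n^'n)" by (simp add: vec_eq_iff mat_1_nth)
      then show ?case using that(2) by simp
    next
      case (insert k J)
      let ?V = "\<chi> i. if i \<in> J then A $ i else axis i 1"
      have "A $ k = A $ k $ k *\<^sub>R axis k 1" by (auto simp: vec_eq_iff axis_def intro: 2)
      then have "\<omega> (replace_vec ?V k (A $ k)) = \<omega> (replace_vec ?V k (A $ k $ k *\<^sub>R axis k 1))"
        by (rule arg_cong[where f = "\<lambda>z. \<omega> (replace_vec ?V k z)"])
      also have "\<dots> = A $ k $ k * \<omega> (replace_vec ?V k (axis k 1))"
        by (rule alternating_multilinear_linear(2)[OF that(1)])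
      also have "replace_vec ?V k (axis k 1) = ?V" using insert.hyps by (simp add: vec_eq_iff replace_vec_nth)
      finally have "\<omega> (replace_vec ?V k (A $ k)) = 0" using insert.IH by simp
      moreover have "(\<chi> i. if i \<in> insert k J then A $ i else axis i 1) = replace_vec ?V k (A $ k)"
        by (simp add: vec_eq_iff replace_vec_nth)
      ultimately show ?case by simp
    qed
    from this[where J = UNIV] show ?case by simp
  next
    case (3 A m n)
    show ?case
    proof (intro allI impI)
      fix \<omega> :: "(real^'n)^'n \<Rightarrow> real"
      assume \<omega>: "alternating_multilinear \<omega>" "\<omega> (mat 1) = 0"
      define \<sigma> where "\<sigma> w = (\<chi> j. w $ Transposition.transpose m n j)" for w :: "real^'n"
      define \<omega>' where "\<omega>' V = \<omega> (\<chi> i. \<sigma> (V $ i))" for V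
      have rep: "(\<chi> i. \<sigma> (replace_vec V k w $ i)) = replace_vec (\<chi> i. \<sigma> (V $ i)) k (\<sigma> w)" for V k w
        by (simp add: vec_eq_iff replace_vec_nth)
      have "linear \<sigma>" unfolding \<sigma>_def by (rule linearI) (simp_all add: vec_eq_iff)
      then have "linear (\<lambda>w. \<omega>' (replace_vec V k w))" for V k
        unfolding \<omega>'_def rep using linear_compose[OF _ alternating_multilinearD(1)[OF \<omega>(1)]] by (simp add: o_def)
      moreover have "\<omega>' V = 0" if "i \<noteq> j" "V $ i = V $ j" for V i j
        unfolding \<omega>'_def by (rule alternating_multilinearD(2)[OF \<omega>(1) that(1)]) (simp add: that(2))
      ultimately have "alternating_multilinear \<omega>'" unfolding alternating_multilinear_def by blast
      moreover have "\<omega>' (mat 1) = 0"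
      proof -
        \<comment> \<open>On the standard basis, swapping two coordinates amounts to swapping two
          vectors, which only changes the sign.\<close>
        have "(\<chi> i. \<sigma> (mat 1 $ i)) = replace_vec (replace_vec (mat 1) m (axis n 1)) n (axis m 1)"
          using 3(2)
          by (auto simp: vec_eq_iff \<sigma>_def replace_vec_nth mat_1_nth axis_def Transposition.transpose_def)
        moreover have "replace_vec (replace_vec (mat 1) m (axis m 1)) n (axis n 1) = mat 1"
          by (simp add: vec_eq_iff replace_vec_nth mat_1_nth)
        ultimately show ?thesis
          using alternating_multilinear_swap[OF \<omega>(1) 3(2), of "mat 1" "axis n 1" "axis m 1"] \<omega>(2)
          by (simp add: \<omega>'_def)
      qed
      ultimately have "\<omega>' A = 0" using 3(1) by blast
      then show "\<omega> (\<chi> i j. A $ i $ Transposition.transpose m n j) = 0" by (simp add: \<omega>'_def \<sigma>_def)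
    qed
  next
    case (4 A m n c)
    show ?case
    proof (intro allI impI)
      fix \<omega> :: "(real^'n)^'n \<Rightarrow> real"
      assume \<omega>: "alternating_multilinear \<omega>" "\<omega> (mat 1) = 0"
      have row: "row i A = A $ i" for i by (simp add: row_def vec_eq_iff)
      have "(\<chi> i. if i = m then row m A + c *\<^sub>R row n A else row i A) = replace_vec A m (A $ m + c *\<^sub>R A $ n)"
        by (simp add: vec_eq_iff replace_vec_nth row)
      moreover have "\<omega> (replace_vec A m (A $ n)) = 0"
        by (rule alternating_multilinearD(2)[OF \<omega>(1) 4(2)]) (simp add: replace_vec_nth)
      moreover have "\<omega> (replace_vec A m (A $ m)) = 0" using 4(1) \<omega> by (simp add: replace_vec_simps)
      ultimately show "\<omega> (\<chi> i. if i = m then row m A + c *\<^sub>R row n A else row i A) = 0"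
        by (simp add: alternating_multilinear_linear[OF \<omega>(1)])
    qed
  qed
  then show ?thesis using assms by blast
qed

text \<open>The combination \<open>\<eta>\<close> is built to vanish on the standard basis, hence
  vanishes identically: forms of top degree span one dimension.\<close>

lemma alternating_multilinear_proportional:
  fixes \<omega> \<omega>' :: "(real^'n)^'n \<Rightarrow> real"
  assumes "alternating_multilinear \<omega>" "alternating_multilinear \<omega>'"
  shows "\<omega> (mat 1) * \<omega>' V = \<omega>' (mat 1) * \<omega> V"
proof -
  define \<eta> where "\<eta> V = \<omega> (mat 1) * \<omega>' V - \<omega>' (mat 1) * \<omega> V" for V
  have "alternating_multilinear \<eta>"
    unfolding alternating_multilinear_def
  proof (intro conjI allI impI)
    fix V i
    show "linear (\<lambda>w. \<eta> (replace_vec V i w))"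
      unfolding \<eta>_def using alternating_multilinearD(1)[OF assms(1)] alternating_multilinearD(1)[OF assms(2)]
      by (intro linear_compose_sub linear_compose_scale_right[where 'b = real, simplified]) auto
  next
    fix V :: "(real^'n)^'n" and i j assume "i \<noteq> j" "V $ i = V $ j"
    then show "\<eta> V = 0"
      using alternating_multilinearD(2)[OF assms(1)] alternating_multilinearD(2)[OF assms(2)] by (simp add: \<eta>_def)
  qed
  then have "\<eta> V = 0" by (rule alternating_multilinear_eq_0) (simp add: \<eta>_def)
  then show ?thesis by (simp add: \<eta>_def)
qed

text \<open>The left side is again alternating and multilinear in \<open>V\<close>, so it is a
  multiple of \<open>\<omega>\<close>. On the standard basis only the \<open>i\<close>-th component
  of the image of the \<open>i\<close>-th vector counts, and the factor comes out as the trace of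
  \<open>A\<close>.\<close>

lemma alternating_multilinear_trace:
  fixes \<omega> :: "(real^'n)^'n \<Rightarrow> real"
  assumes \<omega>: "alternating_multilinear \<omega>" and ne: "\<omega> (mat 1) \<noteq> 0" and A: "linear A"
  shows "(\<Sum>i\<in>UNIV. \<omega> (replace_vec V i (A (V $ i)))) = (\<Sum>i\<in>UNIV. A (axis i 1) $ i) * \<omega> V"
proof -
  define \<eta> where "\<eta> V = (\<Sum>i\<in>UNIV. \<omega> (replace_vec V i (A (V $ i))))" for V
  have "alternating_multilinear \<eta>"
    unfolding alternating_multilinear_def
  proof (intro conjI allI impI)
    fix V k
    have "linear (\<lambda>w. \<omega> (replace_vec (replace_vec V k w) i (A (replace_vec V k w $ i))))" for i
    proof (cases "i = k")
      case True
      have "linear (\<lambda>w. \<omega> (replace_vec V k (A w)))"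
        using linear_compose[OF A alternating_multilinearD(1)[OF \<omega>]] by (simp add: o_def)
      then show ?thesis by (simp add: True replace_vec_nth replace_vec_simps)
    next
      case False
      then have "replace_vec (replace_vec V k w) i (A (replace_vec V k w $ i)) = replace_vec (replace_vec V i (A (V $ i))) k w" for w
        by (simp add: vec_eq_iff replace_vec_nth)
      then show ?thesis using alternating_multilinearD(1)[OF \<omega>] by simp
    qed
    then show "linear (\<lambda>w. \<eta> (replace_vec V k w))" unfolding \<eta>_def by (intro linear_compose_sum) auto
  next
    fix V :: "(real^'n)^'n" and k l assume kl: "k \<noteq> l" "V $ k = V $ l"
    let ?f = "\<lambda>i. \<omega> (replace_vec V i (A (V $ i)))"
    have "?f i = 0" if "i \<noteq> k" "i \<noteq> l" for i
      by (rule alternating_multilinearD(2)[OF \<omega> kl(1)]) (use that kl in \<open>simp add: replace_vec_nth\<close>)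
    then have "(\<Sum>i\<in>UNIV. ?f i) = (\<Sum>i\<in>{k, l}. ?f i)" by (intro sum.mono_neutral_right) auto
    also have "\<dots> = ?f k + ?f l" using kl by simp
    also have "?f k = \<omega> (replace_vec (replace_vec V k (A (V $ k))) l (V $ k))"
      using kl by (intro arg_cong[where f = \<omega>] vec_eq_iff[THEN iffD2]) (simp add: replace_vec_nth)
    also have "?f l = \<omega> (replace_vec (replace_vec V k (V $ k)) l (A (V $ k)))"
      using kl by (intro arg_cong[where f = \<omega>] vec_eq_iff[THEN iffD2]) (simp add: replace_vec_nth)
    finally show "\<eta> V = 0" using alternating_multilinear_swap[OF \<omega> kl(1)] by (simp add: \<eta>_def)
  qed
  from alternating_multilinear_proportional[OF \<omega> this, of V]
  have "\<omega> (mat 1) * \<eta> V = \<eta> (mat 1) * \<omega> V" .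
  moreover have "\<eta> (mat 1) = (\<Sum>i\<in>UNIV. A (axis i 1) $ i) * \<omega> (mat 1)"
  proof -
    have "\<omega> (replace_vec (mat 1) i w) = w $ i * \<omega> (mat 1)" for i w
    proof -
      have lin: "linear (\<lambda>w. \<omega> (replace_vec (mat 1) i w))" by (rule alternating_multilinearD(1)[OF \<omega>])
      have "\<omega> (replace_vec (mat 1) i w) = \<omega> (replace_vec (mat 1) i (\<Sum>j\<in>UNIV. w $ j *s axis j 1))"
        by (simp add: basis_expansion)
      also have "\<dots> = (\<Sum>j\<in>UNIV. w $ j * \<omega> (replace_vec (mat 1) i (axis j 1)))"
        by (simp only: scalar_mult_eq_scaleR linear_sum[OF lin] linear_scale[OF lin] real_scaleR_def)
      also have "\<dots> = (\<Sum>j\<in>UNIV. if j = i then w $ i * \<omega> (mat 1) else 0)"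
      proof (rule sum.cong[OF refl])
        fix j
        have "\<omega> (replace_vec (mat 1) i (axis j 1)) = 0" if "j \<noteq> i"
          by (rule alternating_multilinearD(2)[OF \<omega> that]) (use that in \<open>simp add: replace_vec_nth mat_1_nth\<close>)
        moreover have "replace_vec (mat 1) i (axis i 1) = mat 1" by (simp add: vec_eq_iff replace_vec_nth mat_1_nth)
        ultimately show "w $ j * \<omega> (replace_vec (mat 1) i (axis j 1)) = (if j = i then w $ i * \<omega> (mat 1) else 0)" by auto
      qed
      finally show ?thesis by simp
    qed
    then show ?thesis by (simp add: \<eta>_def mat_1_nth sum_distrib_right)
  qed
  ultimately have "\<omega> (mat 1) * \<eta> V = \<omega> (mat 1) * ((\<Sum>i\<in>UNIV. A (axis i 1) $ i) * \<omega> V)" by simp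
  then show ?thesis using ne by (simp add: \<eta>_def)
qed

lemma volume_form_mat_1:
  assumes "volume_form D \<nu>" "x \<in> D" shows "\<nu> x (mat 1) \<noteq> 0"
  using assms alternating_multilinear_eq_0 unfolding volume_form_def by blast

section \<open>Divergence in coordinates and tools for integration by parts\<close>

definition div_within :: "(real^'n) set \<Rightarrow> (real^'n \<Rightarrow> real^'n) \<Rightarrow> real^'n \<Rightarrow> real" where
  "div_within D X x = (\<Sum>i\<in>UNIV. frechet_derivative X (at x within D) (axis i 1) $ i)"

text \<open>The form is its density \<open>w y = \<nu> y (mat 1)\<close> times a constant form, so
  the Lie derivative multiplies it by the derivative of \<open>w\<close> along \<open>u\<close> over
  \<open>w\<close>, plus the trace of the derivative of \<open>u\<close>. This factor is div
  (\<open>w u\<close>) / \<open>w\<close>, and with it statements on volume forms become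
  Euclidean.\<close>

lemma divergence_eq:
  fixes D :: "(real^'n) set"
  assumes D: "fat D" and \<nu>: "volume_form D \<nu>" and u: "smooth_on D u" and x: "x \<in> D"
  shows "divergence D \<nu> u x = div_within D (\<lambda>y. \<nu> y (mat 1) *\<^sub>R u y) x / \<nu> x (mat 1)"
proof -
  define w where "w y = \<nu> y (mat 1)" for y
  define u' where "u' = frechet_derivative u (at x within D)"
  define w' where "w' = frechet_derivative w (at x within D)"
  have w0: "w y \<noteq> 0" if "y \<in> D" for y using volume_form_mat_1[OF \<nu> that] by (simp add: w_def)
  have alt: "alternating_multilinear (\<nu> y)" if "y \<in> D" for y using \<nu> that unfolding volume_form_def by blast
  have sw: "smooth_on D w" using \<nu> unfolding volume_form_def w_def by blast
  have u': "(u has_derivative u') (at x within D)" unfolding u'_def by (rule smooth_on_has_derivative[OF u x])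
  have w': "(w has_derivative w') (at x within D)" unfolding w'_def by (rule smooth_on_has_derivative[OF sw x])
  have \<nu>V: "\<nu> y V = \<nu> x V / w x * w y" if "y \<in> D" for y V
    using alternating_multilinear_proportional[OF alt[OF x] alt[OF that], of V] w0[OF x] by (simp add: w_def field_simps)
  define c where "c = w' (u x) / w x + (\<Sum>i\<in>UNIV. u' (axis i 1) $ i)"
  have lie: "lie_derivative D u \<nu> x V = c * \<nu> x V" for V
  proof -
    have "((\<lambda>y. \<nu> x V / w x * w y) has_derivative (\<lambda>v. \<nu> x V / w x * w' v)) (at x within D)"
      by (rule has_derivative_mult_right[OF w'])
    then have "((\<lambda>y. \<nu> y V) has_derivative (\<lambda>v. \<nu> x V / w x * w' v)) (at x within D)"
      by (rule has_derivative_transform[OF x, rotated]) (rule \<nu>V)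
    then have 1: "frechet_derivative (\<lambda>y. \<nu> y V) (at x within D) (u x) = \<nu> x V / w x * w' (u x)"
      by (simp add: frechet_derivative_fat[OF D x])
    show ?thesis
      unfolding lie_derivative_def 1 u'_def[symmetric]
        alternating_multilinear_trace[OF alt[OF x] volume_form_mat_1[OF \<nu> x] has_derivative_linear[OF u']]
      by (simp add: c_def algebra_simps)
  qed
  have "divergence D \<nu> u x = c"
    unfolding divergence_def
  proof (rule the_equality)
    fix d assume "\<forall>V. lie_derivative D u \<nu> x V = d * \<nu> x V"
    then have "c * \<nu> x (mat 1) = d * \<nu> x (mat 1)" unfolding lie by blast
    then show "d = c" using volume_form_mat_1[OF \<nu> x] by simp
  qed (simp add: lie)
  moreover have "div_within D (\<lambda>y. w y *\<^sub>R u y) x = w' (u x) + w x * (\<Sum>i\<in>UNIV. u' (axis i 1) $ i)"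
  proof -
    have "((\<lambda>y. w y *\<^sub>R u y) has_derivative (\<lambda>v. w x *\<^sub>R u' v + w' v *\<^sub>R u x)) (at x within D)"
      by (rule has_derivative_scaleR[OF w' u'])
    then have "div_within D (\<lambda>y. w y *\<^sub>R u y) x = (\<Sum>i\<in>UNIV. (w x *\<^sub>R u' (axis i 1) + w' (axis i 1) *\<^sub>R u x) $ i)"
      unfolding div_within_def by (simp only: frechet_derivative_fat[OF D x])
    also have "\<dots> = w x * (\<Sum>i\<in>UNIV. u' (axis i 1) $ i) + (\<chi> i. w' (axis i 1)) \<bullet> u x"
      by (simp add: sum.distrib sum_distrib_left inner_vec_def)
    also have "(\<chi> i. w' (axis i 1)) \<bullet> u x = w' (u x)"
      by (rule fun_cong[OF fat_derivative_unique[OF D x w' has_derivative_gradient[OF w']], symmetric])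
    finally show ?thesis by simp
  qed
  ultimately show ?thesis using w0[OF x] by (simp add: c_def w_def[symmetric] field_simps)
qed

lemma volume_form_scale:
  assumes D: "fat D" and \<mu>: "volume_form D \<mu>" and \<sigma>: "smooth_on D \<sigma>" "\<And>x. x \<in> D \<Longrightarrow> \<sigma> x \<noteq> 0"
  shows "volume_form D (scale_form \<sigma> \<mu>)"
  unfolding volume_form_def
proof (intro conjI ballI allI)
  fix x assume x: "x \<in> D"
  then have alt: "alternating_multilinear (\<mu> x)" using \<mu> unfolding volume_form_def by blast
  show "alternating_multilinear (scale_form \<sigma> \<mu> x)"
    unfolding alternating_multilinear_def scale_form_def
  proof (intro conjI allI impI)
    show "linear (\<lambda>w. \<sigma> x * \<mu> x (replace_vec V i w))" for V i
      unfolding real_scaleR_def[symmetric]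
      by (rule linear_compose_scale_right[OF alternating_multilinearD(1)[OF alt]])
    show "\<sigma> x * \<mu> x V = 0" if "i \<noteq> j" "V $ i = V $ j" for V i j
      using alternating_multilinearD(2)[OF alt that] by simp
  qed
  show "\<exists>V. scale_form \<sigma> \<mu> x V \<noteq> 0"
    using volume_form_mat_1[OF \<mu> x] \<sigma>(2)[OF x] by (auto simp: scale_form_def)
next
  fix V show "smooth_on D (\<lambda>x. scale_form \<sigma> \<mu> x V)"
    using \<mu> unfolding volume_form_def scale_form_def by (intro smooth_on_mult D \<sigma>) blast
qed

text \<open>As \<open>X\<close> has divergence 0, the integrand is the divergence of
  \<open>F X\<close>, which vanishes off a compact part of the interior. Continued by 0, each
  component of \<open>F X\<close> is continuously differentiable on the whole space, and its partial
  derivative integrates to 0.\<close>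

lemma integral_transport_eq_0:
  fixes D :: "(real^'n) set"
  assumes D: "fat D" and F: "smooth_on D F" and X: "smooth_on D X"
    and K: "compact K" "K \<subseteq> interior D" "\<And>x. x \<in> D \<Longrightarrow> x \<notin> K \<Longrightarrow> F x = (0::real)"
    and div: "\<And>x. x \<in> D \<Longrightarrow> div_within D X x = 0"
  shows "(LINT x:D|lborel. frechet_derivative F (at x within D) (X x)) = 0"
proof -
  define F' where "F' x = frechet_derivative F (at x within D)" for x
  define X' where "X' x = frechet_derivative X (at x within D)" for x
  have F': "(F has_derivative F' x) (at x within D)" if "x \<in> D" for x
    unfolding F'_def by (rule smooth_on_has_derivative[OF F that])
  have X': "(X has_derivative X' x) (at x within D)" if "x \<in> D" for x
    unfolding X'_def by (rule smooth_on_has_derivative[OF X that])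
  have ID: "x \<in> D" if "x \<in> interior D" for x using that interior_subset by blast
  have openK: "open (- K)" using compact_imp_closed[OF K(1)] by (simp add: open_Compl)
  have F'0: "F' x = (\<lambda>_. 0)" if x: "x \<in> D" "x \<notin> K" for x
  proof -
    have "((\<lambda>_. 0) has_derivative (\<lambda>_. 0)) (at x within D)" by (rule has_derivative_const)
    then have "(F has_derivative (\<lambda>_. 0)) (at x within D)"
    proof (rule has_derivative_transform_eventually)
      show "eventually (\<lambda>x'. 0 = F x') (at x within D)"
        unfolding eventually_at_topological
        by (intro exI[of _ "- K"] conjI openK ballI impI) (use x(2) K(3) in auto)
    qed (use x K in auto)
    then show ?thesis unfolding F'_def by (rule frechet_derivative_fat[OF D x(1)])
  qed
  \<comment> \<open>\<open>interior D\<close> and \<open>- K\<close> are open and cover the space;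
    on the first \<open>G i\<close> is a product of smooth functions, on the second it is 0.\<close>
  define G where "G i x = (if x \<in> interior D then F x * X x $ i else 0)" for i x
  define G' where "G' i x v = (if x \<in> interior D then F x * X' x v $ i + F' x v * X x $ i else 0)" for i x v
  have G'0: "G' i x v = 0" if "x \<notin> K" for i x v
    using F'0[OF ID that] K(3)[OF ID that] by (simp add: G'_def)
  have der: "(G i has_derivative G' i x) (at x)" for i x
  proof (cases "x \<in> interior D")
    case True
    have "(F has_derivative F' x) (at x)" "(X has_derivative X' x) (at x)"
      using F'[OF ID[OF True]] X'[OF ID[OF True]] at_within_interior[OF True] by simp_all
    then have "((\<lambda>x. F x * X x $ i) has_derivative (\<lambda>v. F x * X' x v $ i + F' x v * X x $ i)) (at x)"
      by (auto intro!: derivative_eq_intros bounded_linear.has_derivative[OF bounded_linear_vec_nth])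
    then have "(G i has_derivative (\<lambda>v. F x * X' x v $ i + F' x v * X x $ i)) (at x)"
      by (rule has_derivative_transform_within_open[OF _ open_interior True]) (simp add: G_def)
    then show ?thesis using True by (simp add: G'_def [abs_def])
  next
    case False
    then have "x \<in> - K" using K(2) by blast
    have "(G i has_derivative (\<lambda>_. 0)) (at x)"
      by (rule has_derivative_transform_within_open[OF has_derivative_const[of 0] openK \<open>x \<in> - K\<close>])
        (use K(3) ID in \<open>auto simp: G_def\<close>)
    then show ?thesis using False by (simp add: G'_def [abs_def])
  qed
  have cont: "continuous_on UNIV (\<lambda>x. G' i x v)" for i v
  proof -
    have "continuous_on D (\<lambda>x. F x * X' x v $ i + F' x v * X x $ i)"
      unfolding F'_def X'_def
      using F X by (intro smooth_on_continuous smooth_on_add smooth_on_mult smooth_on_component smooth_on_frechet_derivative D)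
    then have "continuous_on (interior D) (\<lambda>x. F x * X' x v $ i + F' x v * X x $ i)"
      using interior_subset continuous_on_subset by blast
    then have "continuous_on (interior D) (\<lambda>x. G' i x v)"
      by (rule continuous_on_eq) (simp add: G'_def)
    moreover have "continuous_on (- K) (\<lambda>x. G' i x v)"
      by (rule continuous_on_eq[OF continuous_on_const[of _ 0]]) (simp add: G'0)
    ultimately have "continuous_on (interior D \<union> - K) (\<lambda>x. G' i x v)"
      by (intro continuous_on_open_Un openK) auto
    moreover have "interior D \<union> - K = UNIV" using K(2) by blast
    ultimately show ?thesis by simp
  qed
  have int: "integrable lborel (\<lambda>x. G' i x v)" for i v
  proof -
    have "integrable lborel (\<lambda>x. indicator K x *\<^sub>R G' i x v)"
      by (rule borel_integrable_compact[OF K(1)]) (use cont continuous_on_subset in blast)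
    then show ?thesis
      by (rule Bochner_Integration.integrable_cong[THEN iffD1, rotated -1]) (use G'0 in \<open>auto simp: indicator_def\<close>)
  qed
  have zero: "(LINT x|lborel. G' i x v) = 0" for i v
    by (rule integral_directional_derivative_eq_0[OF der cont K(1)]) (use K(3) ID in \<open>auto simp: G_def\<close>)
  have sum: "(\<Sum>i\<in>UNIV. G' i x (axis i 1)) = indicator D x *\<^sub>R F' x (X x)" for x
  proof (cases "x \<in> interior D")
    case True
    have "F' x (X x) = (\<chi> i. F' x (axis i 1)) \<bullet> X x"
      using fat_derivative_unique[OF D ID[OF True] F'[OF ID[OF True]] has_derivative_gradient[OF F'[OF ID[OF True]]]]
      by metis
    then have "(\<Sum>i\<in>UNIV. G' i x (axis i 1)) = F x * div_within D X x + F' x (X x)"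
      using True by (simp add: G'_def sum.distrib div_within_def X'_def sum_distrib_left inner_vec_def)
    then show ?thesis using div ID[OF True] by simp
  next
    case False
    then have "x \<notin> K" using K(2) by blast
    then show ?thesis using False F'0[of x] by (simp add: G'_def indicator_def)
  qed
  have "(LINT x:D|lborel. F' x (X x)) = (LINT x|lborel. (\<Sum>i\<in>UNIV. G' i x (axis i 1)))"
    unfolding set_lebesgue_integral_def sum ..
  also have "\<dots> = (\<Sum>i\<in>UNIV. (LINT x|lborel. G' i x (axis i 1)))"
    by (rule Bochner_Integration.integral_sum) (rule int)
  finally show ?thesis by (simp add: zero F'_def)
qed

lemma fundamental_lemma_interval:
  fixes g :: "real \<Rightarrow> real"
  assumes T: "0 < T" and cont: "continuous_on {0..T} g"
    and zero: "\<And>a. smooth_on UNIV a \<Longrightarrow> a 0 = 0 \<Longrightarrow> a T = 0 \<Longrightarrow> (LINT t:{0..T}|lborel. a t * g t) = 0"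
    and t: "t \<in> {0..T}"
  shows "g t = 0"
proof -
  have pos: "\<not> h t0 > 0" if t0: "t0 \<in> {0<..<T}" and cont: "continuous_on {0..T} h"
    and zero: "\<And>a. smooth_on UNIV a \<Longrightarrow> a 0 = 0 \<Longrightarrow> a T = 0 \<Longrightarrow> (LINT t:{0..T}|lborel. a t * h t) = 0"
    for t0 and h :: "real \<Rightarrow> real"
  proof
    assume "h t0 > 0"
    then obtain d where d: "d > 0" "\<forall>s\<in>{0..T}. dist s t0 < d \<longrightarrow> dist (h s) (h t0) < h t0"
      using cont t0 unfolding continuous_on_iff by (metis atLeastAtMost_iff greaterThanLessThan_iff less_imp_le)
    \<comment> \<open>The bump about \<open>t0\<close> then vanishes at 0 and \<open>T\<close>, and
      within the interval it lives only at times where \<open>h\<close> is positive.\<close>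
    define r where "r = min d (min t0 (T - t0))"
    have r: "r > 0" using d t0 by (simp add: r_def)
    define a where "a t = bump r (t - t0)" for t
    have sa: "smooth_on UNIV a"
      using smooth_on_affine[OF fat_UNIV bounded_linear_ident _ smooth_on_bump, of "- t0" r]
      by (simp add: a_def [abs_def])
    have ends: "a 0 = 0" "a T = 0" unfolding a_def by (rule bump_eq_0; simp add: r_def)+
    have c: "continuous_on {0..T} (\<lambda>t. a t * h t)"
      using smooth_on_continuous[OF sa] cont continuous_on_subset by (intro continuous_on_mult) blast+
    have nonneg: "a t * h t \<ge> 0" if "t \<in> {0..T}" for t
    proof (cases "\<bar>t - t0\<bar> < r")
      case True
      then have "dist (h t) (h t0) < h t0" using d that by (simp add: r_def dist_real_def)
      then have "h t > 0" by (simp add: dist_real_def abs_less_iff)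
      then show ?thesis by (simp add: a_def bump_nonneg)
    next
      case False
      then show ?thesis by (simp add: a_def bump_eq_0)
    qed
    have "integral {0..T} (\<lambda>t. a t * h t) = 0"
      using zero[OF sa ends] set_borel_integral_eq_integral(2)[OF set_integrable_compact[OF compact_Icc c]] by simp
    then have "\<forall>t\<in>{0..T}. a t * h t = 0"
      using integral_eq_0_iff[OF c T] nonneg by simp
    then have "a t0 * h t0 = 0" using t0 by simp
    moreover have "a t0 > 0" using r by (simp add: a_def bump_pos)
    ultimately show False using \<open>h t0 > 0\<close> by simp
  qed
  have inner: "g s = 0" if s: "s \<in> {0<..<T}" for s
  proof -
    have "\<not> g s > 0" by (rule pos[OF s cont zero])
    moreover have "\<not> - g s > 0"
    proof (rule pos[OF s, where h = "\<lambda>s. - g s"])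
      show "continuous_on {0..T} (\<lambda>s. - g s)" by (intro continuous_intros cont)
      show "(LINT t:{0..T}|lborel. a t * - g t) = 0" if "smooth_on UNIV a" "a 0 = 0" "a T = 0" for a
        using zero[OF that] by (simp add: set_lebesgue_integral_def)
    qed
    ultimately show ?thesis by simp
  qed
  \<comment> \<open>The test functions vanish at 0 and \<open>T\<close>, so these two times are
    reached by continuity.\<close>
  have "closure {0<..<T} = {0..T}" using T by simp
  then show ?thesis using continuous_constant_on_closure[of "{0<..<T}" g 0 t] cont inner t by simp
qed

text \<open>Differentiation under the integral is applied to the space integral and then to the time
  integral. The two-sided interval \<open>{-a..a}\<close> makes the derivative within it a full
  derivative at 0.\<close>

lemma DERIV_iterated_integral:
  fixes f f' :: "real \<Rightarrow> real \<Rightarrow> 'b::euclidean_space \<Rightarrow> real"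
  assumes a: "a > 0" and K: "compact K"
    and cf: "continuous_on ({-a..a} \<times> {0..T} \<times> K) (\<lambda>(e, t, x). f e t x)"
    and cf': "continuous_on ({-a..a} \<times> {0..T} \<times> K) (\<lambda>(e, t, x). f' e t x)"
    and der: "\<And>e t x. e \<in> {-a..a} \<Longrightarrow> t \<in> {0..T} \<Longrightarrow> x \<in> K \<Longrightarrow> ((\<lambda>e. f e t x) has_real_derivative f' e t x) (at e)"
  shows "((\<lambda>e. LINT t:{0..T}|lborel. LINT x:K|lborel. f e t x) has_real_derivative
    (LINT t:{0..T}|lborel. LINT x:K|lborel. f' 0 t x)) (at 0)"
proof -
  have reassoc: "continuous_on (({-a..a} \<times> {0..T}) \<times> K) (\<lambda>(p, x). h (fst p) (snd p) x)"
    if "continuous_on ({-a..a} \<times> {0..T} \<times> K) (\<lambda>(e, t, x). h e t x)" for h :: "real \<Rightarrow> real \<Rightarrow> 'b \<Rightarrow> real"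
  proof -
    have "continuous_on (({-a..a} \<times> {0..T}) \<times> K) (\<lambda>q. (\<lambda>(e, t, x). h e t x) (fst (fst q), snd (fst q), snd q))"
      by (rule continuous_on_compose2[OF that]) (auto intro!: continuous_intros)
    then show ?thesis by (simp add: case_prod_unfold)
  qed
  have slice: "continuous_on ({-a..a} \<times> K) (\<lambda>(e, x). h e t x)"
    if "continuous_on ({-a..a} \<times> {0..T} \<times> K) (\<lambda>(e, t, x). h e t x)" "t \<in> {0..T}" for h :: "real \<Rightarrow> real \<Rightarrow> 'b \<Rightarrow> real" and t
  proof -
    have "continuous_on ({-a..a} \<times> K) (\<lambda>q. (\<lambda>(e, t, x). h e t x) (fst q, t, snd q))"
      by (rule continuous_on_compose2[OF that(1)]) (use that(2) in \<open>auto intro!: continuous_intros\<close>)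
    then show ?thesis by (simp add: case_prod_unfold)
  qed
  have ci: "continuous_on ({-a..a} \<times> {0..T}) (\<lambda>p. LINT x:K|lborel. h (fst p) (snd p) x)"
    if "continuous_on ({-a..a} \<times> {0..T} \<times> K) (\<lambda>(e, t, x). h e t x)" for h :: "real \<Rightarrow> real \<Rightarrow> 'b \<Rightarrow> real"
    by (rule continuous_on_set_integral[OF _ K reassoc[OF that]]) (intro compact_Times compact_Icc)
  have "((\<lambda>e. LINT t:{0..T}|lborel. LINT x:K|lborel. f e t x) has_vector_derivative
    (LINT t:{0..T}|lborel. LINT x:K|lborel. f' 0 t x)) (at 0 within {-a..a})"
  proof (rule has_vector_derivative_set_integral[OF compact_Icc])
    show "continuous_on ({-a..a} \<times> {0..T}) (\<lambda>(e, t). LINT x:K|lborel. f' e t x)"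
      using ci[OF cf'] by (simp add: case_prod_unfold)
    show "continuous_on {0..T} (\<lambda>t. LINT x:K|lborel. f e t x)" if "e \<in> {-a..a}" for e
      using continuous_on_slice[of "{-a..a}" "{0..T}" "\<lambda>e t. LINT x:K|lborel. f e t x" e] ci[OF cf] that
      by (simp add: case_prod_unfold)
    show "((\<lambda>e. LINT x:K|lborel. f e t x) has_vector_derivative (LINT x:K|lborel. f' e t x)) (at e within {-a..a})"
      if e: "e \<in> {-a..a}" and t: "t \<in> {0..T}" for e t
    proof (rule has_vector_derivative_set_integral[OF K slice[OF cf' t] _ _ e])
      show "((\<lambda>e. f e t x) has_vector_derivative f' e t x) (at e within {-a..a})" if "e \<in> {-a..a}" "x \<in> K" for e x
        using der[OF that(1) t that(2)] by (simp add: has_real_derivative_iff_has_vector_derivative has_vector_derivative_at_within)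
      show "continuous_on K (f e t)" if "e \<in> {-a..a}" for e
        by (rule continuous_on_slice[OF slice[OF cf t] that])
    qed
  qed (use a in simp)
  moreover have "at 0 within {-a..a} = at 0" by (rule at_within_interior) (use a in simp)
  ultimately show ?thesis by (simp add: has_real_derivative_iff_has_vector_derivative)
qed

subsection \<open>From the variational principle to a potential\<close>

lemma test_fields_scale:
  assumes "V \<in> test_fields S" shows "(\<lambda>x. c *\<^sub>R V x) \<in> test_fields S"
  using assms by (auto simp: test_fields_def intro: smooth_on_linear[OF fat_UNIV bounded_linear_scaleR_right])

lemma euclid_div_scale:
  assumes "V \<in> test_fields S"
  shows "euclid_div (\<lambda>x. c *\<^sub>R V x) x = c * euclid_div V x"
  by (subst euclid_div_eq[OF has_derivative_scaleR_right[OF test_fields_has_derivative[OF assms]]])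
    (simp add: euclid_div_def sum_distrib_left)

lemma grad_within_eq:
  assumes "fat D" "x \<in> D" "(f has_derivative (\<lambda>v. w \<bullet> v)) (at x within D)"
  shows "grad_within D f x = w"
  by (simp add: grad_within_def frechet_derivative_fat[OF assms] inner_axis vec_eq_iff)

lemma inner_grad_within:
  assumes "smooth_on D f" "x \<in> D"
  shows "grad_within D f x \<bullet> v = frechet_derivative f (at x within D) v"
proof -
  note der = smooth_on_has_derivative[OF assms]
  have lin: "linear (frechet_derivative f (at x within D))" by (rule has_derivative_linear[OF der])
  have "frechet_derivative f (at x within D) v = frechet_derivative f (at x within D) (\<Sum>i\<in>UNIV. v $ i *s axis i 1)"
    by (simp add: basis_expansion)
  also have "\<dots> = (\<Sum>i\<in>UNIV. v $ i * frechet_derivative f (at x within D) (axis i 1))"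
    by (simp only: scalar_mult_eq_scaleR linear_sum[OF lin] linear_scale[OF lin] real_scaleR_def)
  finally show ?thesis by (simp add: grad_within_def inner_vec_def mult.commute)
qed

lemma inner_transpose_derivative:
  fixes m :: "real^'n" and A :: "real^'n \<Rightarrow> real^'n"
  assumes lin: "linear A"
  shows "(\<chi> i. m \<bullet> A (axis i 1)) \<bullet> v = m \<bullet> A v"
proof -
  have "m \<bullet> A v = m \<bullet> A (\<Sum>i\<in>UNIV. v $ i *s axis i 1)" by (simp add: basis_expansion)
  also have "\<dots> = (\<Sum>i\<in>UNIV. v $ i * (m \<bullet> A (axis i 1)))"
    by (simp only: scalar_mult_eq_scaleR linear_sum[OF lin] linear_scale[OF lin] inner_sum_right inner_scaleR_right)
  finally show ?thesis by (simp add: inner_vec_def mult.commute)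
qed

locale weighted_space_time = space_time D T for D :: "(real^'n) set" and T +
  fixes \<mu> :: "'n top_form" and \<sigma> :: "real^'n \<Rightarrow> real"
  assumes \<mu>: "volume_form D \<mu>" and \<sigma>: "smooth_on D \<sigma>" and \<sigma>_pos: "x \<in> D \<Longrightarrow> \<sigma> x > 0"
begin

text \<open>The density of the weighted form with respect to Lebesgue measure. It carries the sign
  of the orientation, whereas integrals over \<open>D\<close> use its absolute value.\<close>

definition weight :: "real^'n \<Rightarrow> real" where
  "weight x = \<sigma> x * \<mu> x (mat 1)"

lemma smooth_on_weight: "smooth_on D weight"
  using \<mu> unfolding weight_def [abs_def] volume_form_def by (intro smooth_on_mult fat_D \<sigma>) blast

lemma weight_nonzero: "x \<in> D \<Longrightarrow> weight x \<noteq> 0"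
  using \<sigma>_pos volume_form_mat_1[OF \<mu>] unfolding weight_def by force

lemma weight_volume_form: "volume_form D (scale_form \<sigma> \<mu>)"
  by (rule volume_form_scale[OF fat_D \<mu> \<sigma>]) (use \<sigma>_pos in force)

text \<open>\<open>weight\<close> is continuous and without zeros on the connected \<open>D\<close>,
  so its sign is constant and can be taken out of integrals.\<close>

lemma abs_weight: "\<exists>s. s \<noteq> 0 \<and> (\<forall>x\<in>D. \<sigma> x * \<bar>\<mu> x (mat 1)\<bar> = s * weight x)"
proof -
  have conn: "connected (weight ` D)"
    by (intro connected_continuous_image smooth_on_continuous smooth_on_weight smooth_domain_connected D)
  have abs: "\<sigma> x * \<bar>\<mu> x (mat 1)\<bar> = \<bar>weight x\<bar>" if "x \<in> D" for x
    using \<sigma>_pos[OF that] by (simp add: weight_def abs_mult)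
  have "(\<forall>x\<in>D. weight x > 0) \<or> (\<forall>x\<in>D. weight x < 0)"
  proof (rule ccontr)
    assume "\<not> ?thesis"
    then obtain x y where xy: "x \<in> D" "y \<in> D" "weight x \<le> 0" "weight y \<ge> 0" by (auto simp: not_less)
    then have "0 \<in> weight ` D"
      using connected_contains_Icc[OF conn, of "weight x" "weight y"] by auto
    then show False using weight_nonzero by force
  qed
  then show ?thesis
  proof
    assume "\<forall>x\<in>D. weight x > 0"
    then show ?thesis using abs by (intro exI[of _ 1]) auto
  next
    assume "\<forall>x\<in>D. weight x < 0"
    then show ?thesis using abs by (intro exI[of _ "-1"]) auto
  qed
qed

lemma solenoidal_variation:
  assumes V: "V \<in> test_fields (interior D)" and div: "\<forall>x. euclid_div V x = 0"
  shows "(\<lambda>x. (1 / weight x) *\<^sub>R V x) \<in> X_vol D (scale_form \<sigma> \<mu>)"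
proof -
  obtain K where K: "K \<subseteq> interior D" "\<forall>x. x \<notin> K \<longrightarrow> V x = 0" using V by (auto simp: test_fields_def)
  have sV: "smooth_on D V" using V smooth_on_subset[OF fat_D] by (auto simp: test_fields_def)
  have sW: "smooth_on D (\<lambda>x. (1 / weight x) *\<^sub>R V x)"
    by (intro smooth_on_scaleR smooth_on_divide smooth_on_const smooth_on_weight fat_D sV weight_nonzero)
  have "divergence D (scale_form \<sigma> \<mu>) (\<lambda>x. (1 / weight x) *\<^sub>R V x) x = 0" if x: "x \<in> D" for x
  proof -
    have "frechet_derivative (\<lambda>y. scale_form \<sigma> \<mu> y (mat 1) *\<^sub>R (1 / weight y) *\<^sub>R V y) (at x within D) =
        frechet_derivative V (at x within D)"
      by (rule frechet_derivative_cong_within[OF _ x]) (use weight_nonzero in \<open>auto simp: scale_form_def weight_def\<close>)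
    also have "\<dots> = frechet_derivative V (at x)"
      by (rule frechet_derivative_fat[OF fat_D x has_derivative_at_withinI[OF test_fields_has_derivative[OF V]]])
    finally have "div_within D (\<lambda>y. scale_form \<sigma> \<mu> y (mat 1) *\<^sub>R (1 / weight y) *\<^sub>R V y) x = euclid_div V x"
      by (simp add: div_within_def euclid_div_def)
    then show ?thesis using divergence_eq[OF fat_D weight_volume_form sW x] div by simp
  qed
  moreover have "tangent_to_boundary D (\<lambda>x. (1 / weight x) *\<^sub>R V x)"
    unfolding tangent_to_boundary_def
  proof (intro ballI allI impI)
    fix p U h assume p: "p \<in> frontier D" and bd: "boundary_defining D p U h"
    \<comment> \<open>\<open>K\<close> lies in the interior, so the field vanishes on the boundary,
      where tangency becomes automatic.\<close>
    have "V p = 0" using p K by (auto simp: frontier_def)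
    have "(h has_derivative frechet_derivative h (at p within U)) (at p within U)"
      using bd unfolding boundary_defining_def by (intro smooth_on_has_derivative) auto
    then have "(h has_derivative frechet_derivative h (at p)) (at p)"
      using bd at_within_open unfolding boundary_defining_def by metis
    then show "frechet_derivative h (at p) ((1 / weight p) *\<^sub>R V p) = 0"
      using linear_0[OF has_derivative_linear] \<open>V p = 0\<close> by simp
  qed
  ultimately show ?thesis using sW unfolding X_vol_def by blast
qed

text \<open>Both divergences have the numerator div (\<open>weight u\<close>) and differ only in the
  density by which it is divided.\<close>

lemma X_vol_div:
  assumes u: "u \<in> X_vol D (scale_form \<sigma> \<mu>)" and x: "x \<in> D"
  shows "div_within D (\<lambda>y. weight y *\<^sub>R u y) x = 0" "divergence D \<mu> (\<lambda>y. \<sigma> y *\<^sub>R u y) x = 0"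
proof -
  have su: "smooth_on D u" and "divergence D (scale_form \<sigma> \<mu>) u x = 0" using u x unfolding X_vol_def by auto
  then have "div_within D (\<lambda>y. scale_form \<sigma> \<mu> y (mat 1) *\<^sub>R u y) x = 0"
    using divergence_eq[OF fat_D weight_volume_form su x] volume_form_mat_1[OF weight_volume_form x] by simp
  then show 1: "div_within D (\<lambda>y. weight y *\<^sub>R u y) x = 0" by (simp add: scale_form_def weight_def [abs_def])
  have "smooth_on D (\<lambda>y. \<sigma> y *\<^sub>R u y)" by (intro smooth_on_scaleR fat_D \<sigma> su)
  from divergence_eq[OF fat_D \<mu> this x] 1 show "divergence D \<mu> (\<lambda>y. \<sigma> y *\<^sub>R u y) x = 0"
    by (simp add: weight_def [abs_def] mult.commute)
qed

text \<open>The Euler--Poincar\'e equations for the momentum density \<open>m\<close> and the thermodynamic force \<open>n\<close> say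
  that this field is a gradient.\<close>

definition ep_residual ::
  "(real \<Rightarrow> real^'n \<Rightarrow> real^'n) \<Rightarrow> (real \<Rightarrow> real^'n \<Rightarrow> real) \<Rightarrow> (real \<Rightarrow> real^'n \<Rightarrow> real^'n) \<Rightarrow>
    (real \<Rightarrow> real^'n \<Rightarrow> real) \<Rightarrow> real \<Rightarrow> real^'n \<Rightarrow> real^'n" where
  "ep_residual m n u \<theta> t x =
    - (time_deriv T m t x + frechet_derivative (m t) (at x within D) (u t x)
      + (\<chi> i. m t x \<bullet> frechet_derivative (u t) (at x within D) (axis i 1))) - n t x *\<^sub>R grad_within D (\<theta> t) x"

lemma time_smooth_ep_residual:
  assumes m: "time_smooth D T m" and n: "time_smooth D T n" and u: "time_smooth D T u" and \<theta>: "time_smooth D T \<theta>"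
  shows "time_smooth D T (ep_residual m n u \<theta>)"
proof -
  have eq: "ep_residual m n u \<theta> t x = - (time_deriv T m t x + frechet_derivative (m t) (at x within D) (u t x)
      + (\<Sum>i\<in>UNIV. (m t x \<bullet> frechet_derivative (u t) (at x within D) (axis i 1)) *\<^sub>R axis i 1))
      - n t x *\<^sub>R (\<Sum>i\<in>UNIV. frechet_derivative (\<theta> t) (at x within D) (axis i 1) *\<^sub>R axis i 1)" for t x
  proof -
    have vec: "(\<chi> i. f i) = (\<Sum>i\<in>UNIV. f i *\<^sub>R axis i 1)" for f :: "'n \<Rightarrow> real"
      using basis_expansion[of "\<chi> i. f i"] by (simp add: scalar_mult_eq_scaleR)
    show ?thesis unfolding ep_residual_def grad_within_def vec ..
  qed
  show ?thesis unfolding eq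
    by (intro time_smooth_diff time_smooth_minus time_smooth_add time_smooth_sum time_smooth_scaleR time_smooth_inner
        time_smooth_time_deriv time_smooth_directional time_smooth_const m n u \<theta>)
qed

text \<open>For \<open>v = a W\<close> with \<open>W = V / weight\<close>, the integrand times
  \<open>weight\<close> is \<open>a' (m \<bullet> V) + a q\<close>. Over \<open>D\<close>,
  \<open>q\<close> integrates to \<open>G + M'\<close>, where \<open>G\<close> is the pairing of the
  residual with \<open>V\<close> and \<open>M'\<close> the time derivative of the pairing
  \<open>M\<close> of \<open>m\<close> with \<open>V\<close>. So the integral of
  \<open>(a M)' + a G\<close> over time vanishes; the first term drops out as \<open>a\<close> is 0
  at both ends, and \<open>a\<close> is otherwise arbitrary.\<close>

lemma ep_residual_annihilates:
  assumes m: "time_smooth D T m" and n: "time_smooth D T n" and u: "time_smooth D T u" and \<theta>: "time_smooth D T \<theta>"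
    and uX: "\<And>t. t \<in> {0..T} \<Longrightarrow> u t \<in> X_vol D (scale_form \<sigma> \<mu>)"
    and variation: "\<And>v. time_smooth D T v \<Longrightarrow> \<forall>t\<in>{0..T}. v t \<in> X_vol D (scale_form \<sigma> \<mu>) \<Longrightarrow>
      \<forall>x\<in>D. v 0 x = 0 \<and> v T x = 0 \<Longrightarrow>
      (LINT t:{0..T}|lborel. LINT x:D|lborel. (m t x \<bullet> EP_du D T u v t x + n t x * EP_dtheta D \<theta> v t x) *
        (\<sigma> x * \<bar>\<mu> x (mat 1)\<bar>)) = 0"
  shows "annihilator_family (ep_residual m n u \<theta>)"
  unfolding annihilator_family_def annihilates_solenoidal_def
proof (intro conjI ballI impI)
  let ?\<beta> = "ep_residual m n u \<theta>"
  show sm\<beta>: "time_smooth D T ?\<beta>" by (rule time_smooth_ep_residual[OF m n u \<theta>])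
  fix t0 V assume t0: "t0 \<in> {0..T}" and V: "V \<in> test_fields (interior D)" and div: "\<forall>x. euclid_div V x = 0"
  obtain K where K: "compact K" "K \<subseteq> interior D" "\<forall>x. x \<notin> K \<longrightarrow> V x = 0" using V by (auto simp: test_fields_def)
  have cD: "compact D" by (rule smooth_domain_compact[OF D])
  have sV: "smooth_on D V" using V smooth_on_subset[OF fat_D] by (auto simp: test_fields_def)
  define W where "W x = (1 / weight x) *\<^sub>R V x" for x
  have sW: "smooth_on D W"
    unfolding W_def by (intro smooth_on_scaleR smooth_on_divide smooth_on_const smooth_on_weight fat_D sV weight_nonzero)
  have wW: "weight x *\<^sub>R W x = V x" if "x \<in> D" for x using weight_nonzero[OF that] by (simp add: W_def)
  define M where "M t = (LINT x:D|lborel. m t x \<bullet> V x)" for t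
  define M' where "M' t = (LINT x:D|lborel. time_deriv T m t x \<bullet> V x)" for t
  define G where "G t = (LINT x:D|lborel. ?\<beta> t x \<bullet> V x)" for t
  define q where "q t x = weight x * (m t x \<bullet> bracket D (u t) W x) -
      n t x * frechet_derivative (\<theta> t) (at x within D) (V x)" for t x
  note sm_V = time_smooth_inner[OF _ time_smooth_space[OF sV]]
  have cont_int: "continuous_on {0..T} (\<lambda>t. LINT x:D|lborel. f t x \<bullet> V x)" if "time_smooth D T f" for f
    by (rule continuous_on_set_integral[OF compact_Icc cD time_smooth_continuous[OF sm_V[OF that]]])
  have int_space: "set_integrable lborel D f" if "smooth_on D f" for f :: "real^'n \<Rightarrow> real"
    by (rule set_integrable_compact[OF cD smooth_on_continuous[OF that]])
  have N: "(LINT x:D|lborel. q t x) = G t + M' t" if t: "t \<in> {0..T}" for t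
  proof -
    define F where "F x = m t x \<bullet> W x" for x
    have smt: "smooth_on D (m t)" and sut: "smooth_on D (u t)" and s\<theta>t: "smooth_on D (\<theta> t)"
      using time_smooth_slice m u \<theta> t by blast+
    have sF: "smooth_on D F" unfolding F_def by (intro smooth_on_inner fat_D smt sW)
    have sX: "smooth_on D (\<lambda>x. weight x *\<^sub>R u t x)" by (intro smooth_on_scaleR fat_D smooth_on_weight sut)
    have transport: "(LINT x:D|lborel. frechet_derivative F (at x within D) (weight x *\<^sub>R u t x)) = 0"
      by (rule integral_transport_eq_0[OF fat_D sF sX K(1,2)])
        (use K(3) X_vol_div(1)[OF uX[OF t]] in \<open>auto simp: F_def W_def\<close>)
    \<comment> \<open>The product rule for \<open>F = m \<bullet> W\<close> along
      \<open>weight u\<close> moves the derivative from \<open>W\<close>, where the bracket puts it,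
      to \<open>m\<close>. The transport term has integral 0 because \<open>weight u\<close> has
      divergence 0.\<close>
    have "q t x = frechet_derivative F (at x within D) (weight x *\<^sub>R u t x) + (?\<beta> t x \<bullet> V x + time_deriv T m t x \<bullet> V x)"
      if x: "x \<in> D" for x
    proof -
      define m' where "m' = frechet_derivative (m t) (at x within D)"
      define W' where "W' = frechet_derivative W (at x within D)"
      define u' where "u' = frechet_derivative (u t) (at x within D)"
      have m': "(m t has_derivative m') (at x within D)" and W': "(W has_derivative W') (at x within D)"
        and u': "(u t has_derivative u') (at x within D)"
        unfolding m'_def W'_def u'_def using smooth_on_has_derivative x smt sW sut by blast+
      have "frechet_derivative F (at x within D) = (\<lambda>v. m t x \<bullet> W' v + m' v \<bullet> W x)"
        unfolding F_def by (rule frechet_derivative_fat[OF fat_D x has_derivative_inner[OF m' W']])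
      then have "frechet_derivative F (at x within D) (weight x *\<^sub>R u t x) =
          weight x * (m t x \<bullet> W' (u t x)) + m' (u t x) \<bullet> V x"
        using linear_scale[OF has_derivative_linear[OF m']] linear_scale[OF has_derivative_linear[OF W']] wW[OF x]
        by (simp add: inner_scaleR_right[symmetric] del: inner_scaleR_right)
      moreover have "weight x * (m t x \<bullet> u' (W x)) = m t x \<bullet> u' (V x)"
        using linear_scale[OF has_derivative_linear[OF u'], of "weight x" "W x"] wW[OF x] by simp
      moreover have "?\<beta> t x \<bullet> V x = - (time_deriv T m t x \<bullet> V x + m' (u t x) \<bullet> V x + m t x \<bullet> u' (V x))
          - n t x * frechet_derivative (\<theta> t) (at x within D) (V x)"
        using inner_transpose_derivative[OF has_derivative_linear[OF u'], of "m t x" "V x"]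
        unfolding ep_residual_def m'_def[symmetric] u'_def[symmetric]
        by (simp add: inner_add_left inner_diff_left inner_grad_within[OF s\<theta>t x])
      ultimately show ?thesis
        unfolding q_def bracket_def W'_def[symmetric] u'_def[symmetric]
        by (simp add: inner_diff_right right_diff_distrib)
    qed
    then have "(LINT x:D|lborel. q t x) = (LINT x:D|lborel. frechet_derivative F (at x within D) (weight x *\<^sub>R u t x) +
        (?\<beta> t x \<bullet> V x + time_deriv T m t x \<bullet> V x))"
      by (intro set_lebesgue_integral_cong) (use borel_compact[OF cD] in auto)
    also have "\<dots> = 0 + (G t + M' t)"
    proof -
      have i: "set_integrable lborel D (\<lambda>x. frechet_derivative F (at x within D) (weight x *\<^sub>R u t x))"
        "set_integrable lborel D (\<lambda>x. ?\<beta> t x \<bullet> V x)" "set_integrable lborel D (\<lambda>x. time_deriv T m t x \<bullet> V x)"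
        using smooth_on_frechet_derivative_field[OF fat_D sF sX]
          time_smooth_slice[OF sm_V[OF sm\<beta>] t] time_smooth_slice[OF sm_V[OF time_smooth_time_deriv[OF m]] t]
        by (auto intro: int_space)
      then show ?thesis using transport by (simp add: set_integral_add G_def M'_def)
    qed
    finally show ?thesis by simp
  qed
  have dM: "(M has_vector_derivative M' t) (at t within {0..T})" if t: "t \<in> {0..T}" for t
    unfolding M_def [abs_def] M'_def
  proof (rule has_vector_derivative_set_integral[OF cD time_smooth_continuous[OF sm_V[OF time_smooth_time_deriv[OF m]]] _ _ t])
    show "((\<lambda>s. m s x \<bullet> V x) has_vector_derivative time_deriv T m s x \<bullet> V x) (at s within {0..T})"
      if "s \<in> {0..T}" "x \<in> D" for s x
      by (rule bounded_linear.has_vector_derivative[OF bounded_linear_inner_left time_deriv_frechet(1)[OF m that]])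
    show "continuous_on D (\<lambda>x. m s x \<bullet> V x)" if "s \<in> {0..T}" for s
      by (rule smooth_on_continuous[OF time_smooth_slice[OF sm_V[OF m] that]])
  qed
  have "(LINT t:{0..T}|lborel. a t * G t) = 0" if a: "smooth_on UNIV a" "a 0 = 0" "a T = 0" for a :: "real \<Rightarrow> real"
  proof -
    define a' where "a' t = frechet_derivative a (at t) 1" for t
    have ca: "continuous_on {0..T} a" "continuous_on {0..T} a'"
      using smooth_on_continuous[OF a(1)] smooth_on_continuous[OF smooth_on_frechet_derivative[OF a(1)], of 1]
      unfolding a'_def by (auto intro: continuous_on_subset)
    have da: "(a has_vector_derivative a' t) (at t within S)" for t S
    proof -
      have *: "(a has_derivative frechet_derivative a (at t)) (at t)" using smooth_on_has_derivative[OF a(1), of t] by simp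
      have "frechet_derivative a (at t) h = h *\<^sub>R a' t" for h
        using linear_scale[OF has_derivative_linear[OF *], of h 1] by (simp add: a'_def)
      then have "frechet_derivative a (at t) = (\<lambda>h. h *\<^sub>R a' t)" by (rule ext)
      with * have "(a has_vector_derivative a' t) (at t)" by (simp only: has_vector_derivative_def)
      then show ?thesis by (rule has_vector_derivative_at_within)
    qed
    define v where "v t x = a t *\<^sub>R W x" for t x
    have sv: "time_smooth D T v"
      unfolding v_def by (intro time_smooth_scaleR time_smooth_time time_smooth_space a sW)
    have vX: "\<forall>t\<in>{0..T}. v t \<in> X_vol D (scale_form \<sigma> \<mu>)"
    proof
      fix t
      have "v t = (\<lambda>x. (1 / weight x) *\<^sub>R a t *\<^sub>R V x)" by (auto simp: v_def W_def)
      then show "v t \<in> X_vol D (scale_form \<sigma> \<mu>)"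
        using solenoidal_variation[OF test_fields_scale[OF V]] euclid_div_scale[OF V] div by simp
    qed
    have ends: "\<forall>x\<in>D. v 0 x = 0 \<and> v T x = 0" using a by (simp add: v_def)
    \<comment> \<open>The variation is weighted with the absolute density, the identities above with
      the signed one; the constant \<open>s\<close> converts between them.\<close>
    obtain s where s: "s \<noteq> 0" "\<forall>x\<in>D. \<sigma> x * \<bar>\<mu> x (mat 1)\<bar> = s * weight x" using abs_weight by blast
    have inner: "(LINT x:D|lborel. (m t x \<bullet> EP_du D T u v t x + n t x * EP_dtheta D \<theta> v t x) * (\<sigma> x * \<bar>\<mu> x (mat 1)\<bar>)) =
        s * (a' t * M t + a t * (G t + M' t))" if t: "t \<in> {0..T}" for t
    proof -
      have "(m t x \<bullet> EP_du D T u v t x + n t x * EP_dtheta D \<theta> v t x) * (\<sigma> x * \<bar>\<mu> x (mat 1)\<bar>) =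
          s * (a' t * (m t x \<bullet> V x) + a t * q t x)" if x: "x \<in> D" for x
      proof -
        have "((\<lambda>s. v s x) has_vector_derivative a' t *\<^sub>R W x) (at t within {0..T})"
          unfolding v_def by (rule bounded_linear.has_vector_derivative[OF bounded_linear_scaleR_left da])
        then have 1: "time_deriv T v t x = a' t *\<^sub>R W x" by (rule time_deriv_eq[OF _ t])
        have W': "(W has_derivative frechet_derivative W (at x within D)) (at x within D)"
          by (rule smooth_on_has_derivative[OF sW x])
        have u': "(u t has_derivative frechet_derivative (u t) (at x within D)) (at x within D)"
          by (rule smooth_on_has_derivative[OF time_smooth_slice[OF u t] x])
        have \<theta>': "(\<theta> t has_derivative frechet_derivative (\<theta> t) (at x within D)) (at x within D)"
          by (rule smooth_on_has_derivative[OF time_smooth_slice[OF \<theta> t] x])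
        have v': "frechet_derivative (v t) (at x within D) = (\<lambda>w. a t *\<^sub>R frechet_derivative W (at x within D) w)"
          unfolding v_def by (rule frechet_derivative_fat[OF fat_D x has_derivative_scaleR_right[OF W']])
        have 2: "bracket D (u t) (v t) x = a t *\<^sub>R bracket D (u t) W x"
          unfolding bracket_def v' using linear_scale[OF has_derivative_linear[OF u']]
          by (simp add: v_def scaleR_diff_right)
        have 3: "EP_dtheta D \<theta> v t x * weight x = - a t * frechet_derivative (\<theta> t) (at x within D) (V x)"
        proof -
          have "weight x * frechet_derivative (\<theta> t) (at x within D) (W x) = frechet_derivative (\<theta> t) (at x within D) (V x)"
            using linear_scale[OF has_derivative_linear[OF \<theta>'], of "weight x" "W x"] wW[OF x] by simp
          then show ?thesis
            unfolding EP_dtheta_def v_def using linear_scale[OF has_derivative_linear[OF \<theta>'], of "a t" "W x"]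
            by (simp add: algebra_simps)
        qed
        have 4: "weight x * (m t x \<bullet> W x) = m t x \<bullet> V x"
          using wW[OF x] by (metis inner_scaleR_right)
        have "(m t x \<bullet> EP_du D T u v t x) * weight x = a' t * (m t x \<bullet> V x) + a t * (weight x * (m t x \<bullet> bracket D (u t) W x))"
          unfolding EP_du_def 1 2 4[symmetric] by (simp add: inner_add_right algebra_simps)
        then have eq: "(m t x \<bullet> EP_du D T u v t x + n t x * EP_dtheta D \<theta> v t x) * weight x = a' t * (m t x \<bullet> V x) + a t * q t x"
          using 3 unfolding q_def distrib_right mult.assoc by (simp add: algebra_simps)
        have "\<sigma> x * \<bar>\<mu> x (mat 1)\<bar> = s * weight x" using s(2) x by blast
        then show ?thesis by (simp only: mult.left_commute[of _ s "weight x"] eq)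
      qed
      then have "(LINT x:D|lborel. (m t x \<bullet> EP_du D T u v t x + n t x * EP_dtheta D \<theta> v t x) * (\<sigma> x * \<bar>\<mu> x (mat 1)\<bar>)) =
          (LINT x:D|lborel. s * (a' t * (m t x \<bullet> V x) + a t * q t x))"
        by (intro set_lebesgue_integral_cong) (use borel_compact[OF cD] in auto)
      also have "\<dots> = s * (a' t * M t + a t * (LINT x:D|lborel. q t x))"
      proof -
        have "smooth_on D (\<lambda>x. m t x \<bullet> V x)" by (rule time_smooth_slice[OF sm_V[OF m] t])
        moreover have "smooth_on D (q t)"
        proof -
          have sm: "smooth_on D (m t)" "smooth_on D (n t)" "smooth_on D (u t)" "smooth_on D (\<theta> t)"
            using time_smooth_slice[OF m t] time_smooth_slice[OF n t] time_smooth_slice[OF u t]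
              time_smooth_slice[OF \<theta> t] by auto
          show ?thesis
            unfolding q_def bracket_def
            by (intro smooth_on_diff smooth_on_mult smooth_on_inner fat_D smooth_on_weight
                smooth_on_frechet_derivative_field[OF fat_D sW sm(3)] smooth_on_frechet_derivative_field[OF fat_D sm(3) sW]
                smooth_on_frechet_derivative_field[OF fat_D sm(4) sV] sm)
        qed
        ultimately show ?thesis
          using int_space by (simp add: set_integral_add M_def)
      qed
      finally show ?thesis by (simp only: N[OF t])
    qed
    have cM: "continuous_on {0..T} M" "continuous_on {0..T} M'" "continuous_on {0..T} G"
      unfolding M_def [abs_def] M'_def [abs_def] G_def [abs_def]
      by (intro cont_int m time_smooth_time_deriv sm\<beta>)+
    have "0 = (LINT t:{0..T}|lborel. s * ((a' t * M t + a t * M' t) + a t * G t))"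
    proof (subst variation[OF sv vX ends, symmetric], rule set_lebesgue_integral_cong, simp, intro allI impI)
      fix t assume "t \<in> {0..T}"
      then show "(LINT x:D|lborel. (m t x \<bullet> EP_du D T u v t x + n t x * EP_dtheta D \<theta> v t x) * (\<sigma> x * \<bar>\<mu> x (mat 1)\<bar>)) =
          s * ((a' t * M t + a t * M' t) + a t * G t)"
        by (simp only: inner) (simp add: algebra_simps)
    qed
    also have "\<dots> = s * ((LINT t:{0..T}|lborel. a' t * M t + a t * M' t) + (LINT t:{0..T}|lborel. a t * G t))"
      using ca cM by (simp only: set_integral_mult_right)
        (subst set_integral_add; auto intro!: set_integrable_compact continuous_intros)
    finally have "(LINT t:{0..T}|lborel. a' t * M t + a t * M' t) + (LINT t:{0..T}|lborel. a t * G t) = 0"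
      using s(1) by simp
    \<comment> \<open>The integrand is the time derivative of \<open>a M\<close>.\<close>
    moreover have "(LINT t:{0..T}|lborel. a' t * M t + a t * M' t) = a T * M T - a 0 * M 0"
      unfolding set_lebesgue_integral_def
    proof (rule integral_FTC_atLeastAtMost)
      show "continuous_on {0..T} (\<lambda>t. a' t * M t + a t * M' t)" by (intro continuous_intros ca cM)
      show "((\<lambda>t. a t * M t) has_vector_derivative a' t * M t + a t * M' t) (at t within {0..T})"
        if "0 \<le> t" "t \<le> T" for t
        using has_vector_derivative_mult[OF da dM[of t]] that by (simp add: algebra_simps)
    qed (use T in simp)
    ultimately show ?thesis using a by simp
  qed
  then have "G t0 = 0"
    using fundamental_lemma_interval[OF T cont_int[OF sm\<beta>, folded G_def] _ t0] by blast
  moreover have "(LINT x|lborel. ?\<beta> t0 x \<bullet> V x) = G t0"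
    unfolding G_def by (rule integral_eq_set_integral) (use K interior_subset in \<open>force\<close>)
  ultimately show "(LINT x|lborel. ?\<beta> t0 x \<bullet> V x) = 0" by simp
qed

end

section \<open>Perturbed fields, advection, and the first variation of the action\<close>

context space_time
begin

lemma continuous_on_variation:
  assumes "time_smooth D T f"
  shows "continuous_on ({-a..a::real} \<times> {0..T} \<times> D) (\<lambda>z. f (fst (snd z)) (snd (snd z)))"
proof -
  have "continuous_on ({-a..a} \<times> {0..T} \<times> D) (\<lambda>z. (\<lambda>(t, x). f t x) (snd z))"
    by (rule continuous_on_compose2[OF time_smooth_continuous[OF assms]]) (auto intro!: continuous_intros)
  then show ?thesis by (simp add: case_prod_unfold)
qed

lemma time_smooth_EP_du:
  assumes "time_smooth D T u" "time_smooth D T v" shows "time_smooth D T (EP_du D T u v)"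
  unfolding EP_du_def [abs_def] bracket_def
  by (intro time_smooth_add time_smooth_diff time_smooth_time_deriv time_smooth_directional assms)

lemma time_smooth_EP_dtheta:
  assumes "time_smooth D T \<theta>" "time_smooth D T v" shows "time_smooth D T (EP_dtheta D \<theta> v)"
  unfolding EP_dtheta_def [abs_def] by (intro time_smooth_minus time_smooth_directional assms)

lemma smooth_curve_surj:
  assumes "smooth_curve_in_Diff_vol D \<nu> T \<phi>" "t \<in> {0..T}" "x \<in> D"
  obtains X where "X \<in> D" "x = \<phi> t X"
  using assms unfolding smooth_curve_in_Diff_vol_def Diff_vol_def bij_betw_def by blast

text \<open>\<open>\<theta>\<close> is constant along each trajectory of \<open>\<phi>\<close>. The
  chain rule along the space-time curve of \<open>X\<close> turns this into the transport equation
  at \<open>(t, \<phi> t X)\<close>, and every \<open>x\<close> in \<open>D\<close> is of the form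
  \<open>\<phi> t X\<close>.\<close>

lemma eulerian_advection:
  assumes \<phi>: "smooth_curve_in_Diff_vol D \<nu> T \<phi>" and e: "eulerian_fields D T \<phi> \<Theta>\<^sub>0 u \<theta>"
    and \<theta>: "time_smooth D T \<theta>" and t: "t \<in> {0..T}" and x: "x \<in> D"
  shows "time_deriv T \<theta> t x + u t x \<bullet> grad_within D (\<theta> t) x = 0"
proof -
  obtain X where X: "X \<in> D" "x = \<phi> t X" using smooth_curve_surj[OF \<phi> t x] by blast
  have s\<phi>: "time_smooth D T \<phi>" using \<phi> unfolding smooth_curve_in_Diff_vol_def by blast
  have in_D: "\<phi> s X \<in> D" if "s \<in> {0..T}" for s
    using \<phi> that X(1) unfolding smooth_curve_in_Diff_vol_def Diff_vol_def bij_betw_def by blast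
  let ?\<theta>' = "frechet_derivative (\<lambda>(t, x). \<theta> t x) (at (t, x) within {0..T} \<times> D)"
  have lin: "linear ?\<theta>'" by (rule has_derivative_linear[OF time_smooth_has_derivative[OF \<theta> t x]])
  have "((\<lambda>s. \<phi> s X) has_vector_derivative u t x) (at t within {0..T})"
    using time_deriv_frechet(1)[OF s\<phi> t X(1)] e t X unfolding eulerian_fields_def by simp
  then have 1: "((\<lambda>s. (s, \<phi> s X)) has_derivative (\<lambda>h. (h, h *\<^sub>R u t x))) (at t within {0..T})"
    unfolding has_vector_derivative_def by (intro has_derivative_Pair has_derivative_ident)
  have 2: "((\<lambda>(t, x). \<theta> t x) has_derivative ?\<theta>') (at (t, \<phi> t X) within (\<lambda>s. (s, \<phi> s X)) ` {0..T})"
    unfolding X(2)[symmetric]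
    by (rule has_derivative_subset[OF time_smooth_has_derivative[OF \<theta> t x]]) (use in_D in auto)
  have "((\<lambda>s. \<theta> s (\<phi> s X)) has_derivative (\<lambda>h. ?\<theta>' (h, h *\<^sub>R u t x))) (at t within {0..T})"
    using diff_chain_within[OF 1 2] by (simp add: o_def)
  moreover have "((\<lambda>s. \<theta> s (\<phi> s X)) has_derivative (\<lambda>h. 0)) (at t within {0..T})"
    by (rule has_derivative_transform[OF t _ has_derivative_const[of "\<Theta>\<^sub>0 X"]])
      (use e X(1) in \<open>auto simp: eulerian_fields_def\<close>)
  ultimately have "(\<lambda>h. ?\<theta>' (h, h *\<^sub>R u t x)) = (\<lambda>h. 0)"
    by (rule fat_derivative_unique[OF fat_Icc[OF T] t])
  from fun_cong[OF this, of 1] have "?\<theta>' (1, u t x) = 0" by simp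
  moreover have "?\<theta>' (1, u t x) = ?\<theta>' (1, 0) + ?\<theta>' (0, u t x)"
    using linear_add[OF lin, of "(1, 0)" "(0, u t x)"] by simp
  ultimately show ?thesis
    using inner_grad_within[OF time_smooth_slice[OF \<theta> t] x, of "u t x"]
    by (simp add: time_deriv_frechet(2)[OF \<theta> t x] frechet_derivative_slice[OF \<theta> t x] inner_commute)
qed

end

lemma has_derivative_height:
  fixes D :: "(real^'n) set"
  assumes "smooth_on ((\<lambda>x. x $ k) ` D) f" "x \<in> D"
  shows "((\<lambda>y. f (y $ k)) has_derivative
    (\<lambda>v. vector_derivative f (at (x $ k) within (\<lambda>x. x $ k) ` D) * v $ k)) (at x within D)"
proof -
  have "f differentiable (at (x $ k) within (\<lambda>x. x $ k) ` D)"
    using smooth_on_has_derivative[OF assms(1)] assms(2) unfolding differentiable_def by blast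
  then have "(f has_derivative (\<lambda>h. h *\<^sub>R vector_derivative f (at (x $ k) within (\<lambda>x. x $ k) ` D)))
      (at (x $ k) within (\<lambda>x. x $ k) ` D)"
    unfolding vector_derivative_works has_vector_derivative_def .
  from diff_chain_within[OF bounded_linear_imp_has_derivative[OF bounded_linear_vec_nth] this]
  show ?thesis by (simp add: o_def mult.commute)
qed

context weighted_space_time
begin

text \<open>\<open>m\<close> and \<open>n\<close> are the partial derivatives of the integrand
  \<open>L\<close> in velocity and temperature. The size \<open>a\<close> of the perturbation may
  depend on the direction, because an integrand with the factor 1/\<open>\<theta>\<close> is regular
  only while the perturbed temperature stays away from 0.\<close>

lemma EP_principle_annihilates:
  assumes EP: "EP_principle D (scale_form \<sigma> \<mu>) T l u \<theta>"
    and l: "\<And>U q. l U q = (LINT x:D|lborel. L (U x) (q x) x * (\<sigma> x * \<bar>\<mu> x (mat 1)\<bar>))"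
    and m: "time_smooth D T m" and n: "time_smooth D T n"
    and der: "\<And>p q. time_smooth D T p \<Longrightarrow> time_smooth D T q \<Longrightarrow> \<exists>a>0. \<exists>L'.
      continuous_on ({-a..a} \<times> {0..T} \<times> D) (\<lambda>(e, t, x). L (u t x + e *\<^sub>R p t x) (\<theta> t x + e * q t x) x) \<and>
      continuous_on ({-a..a} \<times> {0..T} \<times> D) (\<lambda>(e, t, x). L' e t x) \<and>
      (\<forall>e\<in>{-a..a}. \<forall>t\<in>{0..T}. \<forall>x\<in>D.
        ((\<lambda>e. L (u t x + e *\<^sub>R p t x) (\<theta> t x + e * q t x) x) has_real_derivative L' e t x) (at e)) \<and>
      (\<forall>t\<in>{0..T}. \<forall>x\<in>D. L' 0 t x = m t x \<bullet> p t x + n t x * q t x)"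
  shows "annihilator_family (ep_residual m n u \<theta>)"
proof -
  have u: "time_smooth D T u" and \<theta>: "time_smooth D T \<theta>" and uX: "\<And>t. t \<in> {0..T} \<Longrightarrow> u t \<in> X_vol D (scale_form \<sigma> \<mu>)"
    using EP unfolding EP_principle_def by auto
  have cD: "compact D" by (rule smooth_domain_compact[OF D])
  show ?thesis
  proof (rule ep_residual_annihilates[OF m n u \<theta> uX])
    fix v assume v: "time_smooth D T v" "\<forall>t\<in>{0..T}. v t \<in> X_vol D (scale_form \<sigma> \<mu>)" "\<forall>x\<in>D. v 0 x = 0 \<and> v T x = 0"
    define p where "p = EP_du D T u v"
    define q where "q = EP_dtheta D \<theta> v"
    define w where "w x = \<sigma> x * \<bar>\<mu> x (mat 1)\<bar>" for x
    have "continuous_on D (\<lambda>x. \<mu> x (mat 1))"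
      using \<mu> smooth_on_continuous unfolding volume_form_def by blast
    then have cw: "continuous_on D w"
      unfolding w_def using smooth_on_continuous[OF \<sigma>] by (intro continuous_intros)
    have sp: "time_smooth D T p" "time_smooth D T q"
      unfolding p_def q_def by (intro time_smooth_EP_du time_smooth_EP_dtheta u \<theta> v)+
    obtain a L' where a: "a > 0"
      "continuous_on ({-a..a} \<times> {0..T} \<times> D) (\<lambda>(e, t, x). L (u t x + e *\<^sub>R p t x) (\<theta> t x + e * q t x) x)"
      "continuous_on ({-a..a} \<times> {0..T} \<times> D) (\<lambda>(e, t, x). L' e t x)"
      "\<forall>e\<in>{-a..a}. \<forall>t\<in>{0..T}. \<forall>x\<in>D.
        ((\<lambda>e. L (u t x + e *\<^sub>R p t x) (\<theta> t x + e * q t x) x) has_real_derivative L' e t x) (at e)"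
      "\<forall>t\<in>{0..T}. \<forall>x\<in>D. L' 0 t x = m t x \<bullet> p t x + n t x * q t x"
      using der[OF sp] by (elim exE conjE)
    have cw': "continuous_on ({-a..a} \<times> {0..T} \<times> D) (\<lambda>z. w (snd (snd z)))"
      by (rule continuous_on_compose2[OF cw]) (auto intro!: continuous_intros)
    have "((\<lambda>e. LINT t:{0..T}|lborel. LINT x:D|lborel. L (u t x + e *\<^sub>R p t x) (\<theta> t x + e * q t x) x * w x)
        has_real_derivative (LINT t:{0..T}|lborel. LINT x:D|lborel. L' 0 t x * w x)) (at 0)"
    proof (rule DERIV_iterated_integral[OF a(1) cD])
      show "continuous_on ({-a..a} \<times> {0..T} \<times> D) (\<lambda>(e, t, x). L (u t x + e *\<^sub>R p t x) (\<theta> t x + e * q t x) x * w x)"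
        "continuous_on ({-a..a} \<times> {0..T} \<times> D) (\<lambda>(e, t, x). L' e t x * w x)"
        using continuous_on_mult[OF a(2) cw'] continuous_on_mult[OF a(3) cw'] by (simp_all add: case_prod_unfold)
      show "((\<lambda>e. L (u t x + e *\<^sub>R p t x) (\<theta> t x + e * q t x) x * w x) has_real_derivative L' e t x * w x) (at e)"
        if "e \<in> {-a..a}" "t \<in> {0..T}" "x \<in> D" for e t x
        using a(4) that by (intro DERIV_cmult_right) blast
    qed
    moreover have "((\<lambda>e. action l T (\<lambda>t x. u t x + e *\<^sub>R p t x) (\<lambda>t x. \<theta> t x + e * q t x)) has_real_derivative 0) (at 0)"
      using EP v unfolding EP_principle_def p_def q_def by blast
    ultimately have "(LINT t:{0..T}|lborel. LINT x:D|lborel. L' 0 t x * w x) = 0"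
      unfolding action_def l w_def[symmetric] by (rule DERIV_unique)
    moreover have "(LINT t:{0..T}|lborel. LINT x:D|lborel. L' 0 t x * w x) =
        (LINT t:{0..T}|lborel. LINT x:D|lborel. (m t x \<bullet> p t x + n t x * q t x) * w x)"
    proof (rule set_lebesgue_integral_cong; (intro allI impI)?)
      fix t assume "t \<in> {0..T}"
      then show "(LINT x:D|lborel. L' 0 t x * w x) = (LINT x:D|lborel. (m t x \<bullet> p t x + n t x * q t x) * w x)"
        using a(5) borel_compact[OF cD] by (intro set_lebesgue_integral_cong) auto
    qed simp
    ultimately show "(LINT t:{0..T}|lborel. LINT x:D|lborel. (m t x \<bullet> EP_du D T u v t x + n t x * EP_dtheta D \<theta> v t x) *
        (\<sigma> x * \<bar>\<mu> x (mat 1)\<bar>)) = 0"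
      by (simp add: p_def q_def w_def)
  qed
qed

end

section \<open>The anelastic and the pseudo-incompressible equations\<close>

lemma anelastic_equations:
  fixes D :: "(real^'n) set" and k :: 'n
  assumes D: "smooth_domain D" and T: "T > 0" and \<mu>: "volume_form D \<mu>"
    and Z: "Z = (\<lambda>x. x $ k) ` D"
    and \<rho>b: "smooth_on Z \<rho>b" "\<forall>z\<in>Z. \<rho>b z > 0" and \<theta>b: "smooth_on Z \<theta>b" "\<forall>z\<in>Z. \<theta>b z > 0"
    and c: "c\<^sub>p > 0"
    and \<pi>b: "smooth_on Z \<pi>b" "\<forall>z\<in>Z. c\<^sub>p * \<theta>b z * vector_derivative \<pi>b (at z within Z) = - g"
    and \<phi>: "smooth_curve_in_Diff_vol D (scale_form (\<lambda>x. \<rho>b (x $ k)) \<mu>) T \<phi>"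
    and e: "eulerian_fields D T \<phi> \<Theta>\<^sub>0 u \<theta>"
    and EP: "EP_principle D (scale_form (\<lambda>x. \<rho>b (x $ k)) \<mu>) T (anelastic_lagrangian D \<mu> k c\<^sub>p \<rho>b \<pi>b) u \<theta>"
  shows "\<exists>\<pi>'. time_smooth D T \<pi>' \<and>
          (\<forall>t\<in>{0..T}. \<forall>x\<in>D.
             time_deriv T u t x + frechet_derivative (u t) (at x within D) (u t x)
               + grad_within D (\<lambda>y. c\<^sub>p * \<theta>b (y $ k) * \<pi>' t y) x
               = (g * ((\<theta> t x - \<theta>b (x $ k)) / \<theta>b (x $ k))) *\<^sub>R axis k 1 \<and>
             divergence D \<mu> (\<lambda>y. \<rho>b (y $ k) *\<^sub>R u t y) x = 0 \<and>
             time_deriv T \<theta> t x + u t x \<bullet> grad_within D (\<theta> t) x = 0)"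
proof -
  have fD: "fat D" by (rule smooth_domain_fat[OF D])
  have ZD: "x $ k \<in> Z" if "x \<in> D" for x using that by (simp add: Z)
  have height: "smooth_on D (\<lambda>x. f (x $ k))" if "smooth_on Z f" for f :: "real \<Rightarrow> real"
    by (rule smooth_on_comp_linear[OF fD bounded_linear_vec_nth ZD that])
  interpret weighted_space_time D T \<mu> "\<lambda>x. \<rho>b (x $ k)"
    by unfold_locales (use D T \<mu> height[OF \<rho>b(1)] \<rho>b(2) ZD in auto)
  have u: "time_smooth D T u" and \<theta>: "time_smooth D T \<theta>"
    and uX: "\<And>t. t \<in> {0..T} \<Longrightarrow> u t \<in> X_vol D (scale_form (\<lambda>x. \<rho>b (x $ k)) \<mu>)"
    using EP unfolding EP_principle_def by auto
  \<comment> \<open>The derivative of the integrand in the temperature; that in the velocity is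
    \<open>u\<close> itself.\<close>
  define n where "n = (\<lambda>(t::real) (x::real^'n). - (c\<^sub>p * \<pi>b (x $ k)))"
  have sn: "time_smooth D T n"
    unfolding n_def by (intro time_smooth_minus time_smooth_mult time_smooth_const time_smooth_space height \<pi>b)
  have ann: "annihilator_family (ep_residual u n u \<theta>)"
  proof (rule EP_principle_annihilates[OF EP _ u sn, where L = "\<lambda>U q x. 1/2 * (norm U)\<^sup>2 - c\<^sub>p * \<pi>b (x $ k) * q"])
    show "anelastic_lagrangian D \<mu> k c\<^sub>p \<rho>b \<pi>b U q =
        (LINT x:D|lborel. (1/2 * (norm (U x))\<^sup>2 - c\<^sub>p * \<pi>b (x $ k) * q x) * (\<rho>b (x $ k) * \<bar>\<mu> x (mat 1)\<bar>))" for U q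
      unfolding anelastic_lagrangian_def form_integral_def scale_form_def abs_sgn[of "\<mu> _ _"] by (simp add: mult_ac)
    fix p :: "real \<Rightarrow> real^'n \<Rightarrow> real^'n" and q :: "real \<Rightarrow> real^'n \<Rightarrow> real"
    assume p: "time_smooth D T p" and q: "time_smooth D T q"
    define L' where "L' e t x = (u t x + e *\<^sub>R p t x) \<bullet> p t x - c\<^sub>p * \<pi>b (x $ k) * q t x" for e t x
    note cv = continuous_on_variation[of _ 1]
    have cpi: "continuous_on ({-1..1::real} \<times> {0..T} \<times> D) (\<lambda>z. \<pi>b (snd (snd z) $ k))"
      using cv[OF time_smooth_space[OF height[OF \<pi>b(1)]]] .
    show "\<exists>a>0. \<exists>L'.
      continuous_on ({-a..a} \<times> {0..T} \<times> D) (\<lambda>(e, t, x). 1/2 * (norm (u t x + e *\<^sub>R p t x))\<^sup>2 - c\<^sub>p * \<pi>b (x $ k) * (\<theta> t x + e * q t x)) \<and>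
      continuous_on ({-a..a} \<times> {0..T} \<times> D) (\<lambda>(e, t, x). L' e t x) \<and>
      (\<forall>e\<in>{-a..a}. \<forall>t\<in>{0..T}. \<forall>x\<in>D.
        ((\<lambda>e. 1/2 * (norm (u t x + e *\<^sub>R p t x))\<^sup>2 - c\<^sub>p * \<pi>b (x $ k) * (\<theta> t x + e * q t x)) has_real_derivative L' e t x) (at e)) \<and>
      (\<forall>t\<in>{0..T}. \<forall>x\<in>D. L' 0 t x = u t x \<bullet> p t x + n t x * q t x)"
    proof (intro exI[of _ 1] exI[of _ L'] conjI ballI)
      show "continuous_on ({-1..1} \<times> {0..T} \<times> D)
          (\<lambda>(e, t, x). 1/2 * (norm (u t x + e *\<^sub>R p t x))\<^sup>2 - c\<^sub>p * \<pi>b (x $ k) * (\<theta> t x + e * q t x))"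
        unfolding case_prod_unfold by (intro continuous_intros cv u p q \<theta> cpi)
      show "continuous_on ({-1..1} \<times> {0..T} \<times> D) (\<lambda>(e, t, x). L' e t x)"
        unfolding case_prod_unfold L'_def by (intro continuous_intros cv u p q \<theta> cpi)
      show "((\<lambda>e. 1/2 * (norm (u t x + e *\<^sub>R p t x))\<^sup>2 - c\<^sub>p * \<pi>b (x $ k) * (\<theta> t x + e * q t x)) has_real_derivative L' e t x) (at e)" for e t x
        unfolding power2_norm_eq_inner L'_def has_real_derivative_iff_has_vector_derivative has_vector_derivative_def
        by (auto intro!: derivative_eq_intros simp: fun_eq_iff inner_commute algebra_simps inner_add_left inner_add_right)
      show "L' 0 t x = u t x \<bullet> p t x + n t x * q t x" for t x by (simp add: L'_def n_def)
    qed simp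
  qed
  define P where "P = potential (ep_residual u n u \<theta>)"
  have sP: "time_smooth D T P" unfolding P_def by (rule time_smooth_potential[OF ann])
  \<comment> \<open>The kinetic term cancels the transposed term of the residual, whose value is the
    gradient of half the squared speed. The term with \<open>\<pi>b \<theta>\<close> trades
    \<open>\<pi>b\<close> times the gradient of \<open>\<theta>\<close> for
    \<open>- \<theta>\<close> times that of \<open>\<pi>b\<close>, which the balance of the
    reference state turns into buoyancy. The height term replaces \<open>\<theta>\<close> by
    \<open>\<theta> - \<theta>b\<close> in it.\<close>
  define R where "R t x = P t x + 1/2 * (u t x \<bullet> u t x) - c\<^sub>p * (\<pi>b (x $ k) * \<theta> t x) - g * (x $ k)" for t x
  define \<pi>' where "\<pi>' t x = R t x / (c\<^sub>p * \<theta>b (x $ k))" for t x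
  have \<theta>b0: "\<theta>b (x $ k) > 0" if "x \<in> D" for x using \<theta>b(2) ZD[OF that] by blast
  have "time_smooth D T \<pi>'"
    unfolding \<pi>'_def R_def
    by (intro time_smooth_divide time_smooth_diff time_smooth_add time_smooth_mult time_smooth_inner time_smooth_const
        time_smooth_space height smooth_on_ident[OF fD bounded_linear_vec_nth] sP u \<theta> \<pi>b \<theta>b)
      (use c \<theta>b0 in force)
  moreover have "time_deriv T u t x + frechet_derivative (u t) (at x within D) (u t x)
       + grad_within D (\<lambda>y. c\<^sub>p * \<theta>b (y $ k) * \<pi>' t y) x
       = (g * ((\<theta> t x - \<theta>b (x $ k)) / \<theta>b (x $ k))) *\<^sub>R axis k 1" if t: "t \<in> {0..T}" and x: "x \<in> D" for t x
  proof -
    define u' where "u' = frechet_derivative (u t) (at x within D)"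
    define d\<pi> where "d\<pi> = vector_derivative \<pi>b (at (x $ k) within Z)"
    define tr where "tr = (\<chi> i. u t x \<bullet> u' (axis i 1))"
    define w where "w = ep_residual u n u \<theta> t x + tr - (c\<^sub>p * \<pi>b (x $ k)) *\<^sub>R grad_within D (\<theta> t) x
      - (c\<^sub>p * d\<pi> * \<theta> t x + g) *\<^sub>R axis k 1"
    have u': "(u t has_derivative u') (at x within D)"
      unfolding u'_def by (rule smooth_on_has_derivative[OF time_smooth_slice[OF u t] x])
    have \<theta>': "(\<theta> t has_derivative (\<lambda>v. grad_within D (\<theta> t) x \<bullet> v)) (at x within D)"
      unfolding inner_grad_within[OF time_smooth_slice[OF \<theta> t] x]
      by (rule smooth_on_has_derivative[OF time_smooth_slice[OF \<theta> t] x])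
    have P': "(P t has_derivative (\<lambda>v. ep_residual u n u \<theta> t x \<bullet> v)) (at x within D)"
      using potential(1)[OF ann t] x unfolding P_def has_gradient_on_def by blast
    have \<pi>b': "((\<lambda>y. \<pi>b (y $ k)) has_derivative (\<lambda>v. d\<pi> * v $ k)) (at x within D)"
      unfolding d\<pi>_def Z by (rule has_derivative_height[OF \<pi>b(1)[unfolded Z] x])
    have trv: "u t x \<bullet> u' v = tr \<bullet> v" for v
      unfolding tr_def inner_transpose_derivative[OF has_derivative_linear[OF u']] ..
    have "(R t has_derivative (\<lambda>v. w \<bullet> v)) (at x within D)"
      unfolding R_def
      by (rule has_derivative_eq_rhs, (rule derivative_intros P' u' \<theta>' \<pi>b' bounded_linear_imp_has_derivative bounded_linear_vec_nth)+)
        (simp add: fun_eq_iff w_def trv inner_commute[of _ "u t x"] inner_add_left inner_diff_left inner_axis' algebra_simps)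
    then have "grad_within D (R t) x = w" by (rule grad_within_eq[OF fD x])
    moreover have "grad_within D (\<lambda>y. c\<^sub>p * \<theta>b (y $ k) * \<pi>' t y) x = grad_within D (R t) x"
      unfolding grad_within_def
      by (subst frechet_derivative_cong_within[of D _ "R t"]) (use x c \<theta>b0 in \<open>force simp: \<pi>'_def\<close>)+
    moreover have "c\<^sub>p * d\<pi> * \<theta> t x + g = - (g * ((\<theta> t x - \<theta>b (x $ k)) / \<theta>b (x $ k)))"
    proof -
      have "c\<^sub>p * d\<pi> = - g / \<theta>b (x $ k)"
        using \<pi>b(2) ZD[OF x] \<theta>b0[OF x] unfolding d\<pi>_def by (simp add: field_simps)
      then have "c\<^sub>p * d\<pi> * \<theta> t x + g = - g / \<theta>b (x $ k) * \<theta> t x + g" by simp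
      also have "\<dots> = - (g * ((\<theta> t x - \<theta>b (x $ k)) / \<theta>b (x $ k)))"
        using \<theta>b0[OF x] by (simp add: field_simps)
      finally show ?thesis .
    qed
    ultimately show ?thesis
      unfolding w_def ep_residual_def n_def u'_def[symmetric] tr_def[symmetric] by simp
  qed
  ultimately show ?thesis
    using X_vol_div(2)[OF uX] eulerian_advection[OF \<phi> e \<theta>] by blast
qed

lemma pseudo_incompressible_equations:
  fixes D :: "(real^'n) set" and k :: 'n
  assumes D: "smooth_domain D" and T: "T > 0" and \<mu>: "volume_form D \<mu>"
    and Z: "Z = (\<lambda>x. x $ k) ` D"
    and \<rho>b: "smooth_on Z \<rho>b" "\<forall>z\<in>Z. \<rho>b z > 0" and \<theta>b: "smooth_on Z \<theta>b" "\<forall>z\<in>Z. \<theta>b z > 0"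
    and c: "c\<^sub>p > 0"
    and \<pi>b: "smooth_on Z \<pi>b" "\<forall>z\<in>Z. c\<^sub>p * \<theta>b z * vector_derivative \<pi>b (at z within Z) = - g"
    and \<phi>: "smooth_curve_in_Diff_vol D (scale_form (\<lambda>x. \<rho>b (x $ k) * \<theta>b (x $ k)) \<mu>) T \<phi>"
    and \<Theta>\<^sub>0: "\<forall>X\<in>D. \<Theta>\<^sub>0 X > 0" and e: "eulerian_fields D T \<phi> \<Theta>\<^sub>0 u \<theta>"
    and EP: "EP_principle D (scale_form (\<lambda>x. \<rho>b (x $ k) * \<theta>b (x $ k)) \<mu>) T
      (pseudo_incompressible_lagrangian D \<mu> k g \<rho>b \<theta>b) u \<theta>"
  shows "\<exists>\<pi>'. time_smooth D T \<pi>' \<and>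
          (\<forall>t\<in>{0..T}. \<forall>x\<in>D.
             time_deriv T u t x + frechet_derivative (u t) (at x within D) (u t x)
               + (c\<^sub>p * \<theta> t x) *\<^sub>R grad_within D (\<pi>' t) x
               = (g * ((\<theta> t x - \<theta>b (x $ k)) / \<theta>b (x $ k))) *\<^sub>R axis k 1 \<and>
             divergence D \<mu> (\<lambda>y. (\<rho>b (y $ k) * \<theta>b (y $ k)) *\<^sub>R u t y) x = 0 \<and>
             time_deriv T \<theta> t x + u t x \<bullet> grad_within D (\<theta> t) x = 0)"
proof -
  have fD: "fat D" by (rule smooth_domain_fat[OF D])
  have ZD: "x $ k \<in> Z" if "x \<in> D" for x using that by (simp add: Z)
  have height: "smooth_on D (\<lambda>x. f (x $ k))" if "smooth_on Z f" for f :: "real \<Rightarrow> real"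
    by (rule smooth_on_comp_linear[OF fD bounded_linear_vec_nth ZD that])
  have \<theta>b0: "\<theta>b (x $ k) > 0" if "x \<in> D" for x using \<theta>b(2) ZD[OF that] by blast
  interpret weighted_space_time D T \<mu> "\<lambda>x. \<rho>b (x $ k) * \<theta>b (x $ k)"
    by unfold_locales
      (use D T \<mu> smooth_on_mult[OF fD height[OF \<rho>b(1)] height[OF \<theta>b(1)]] \<rho>b(2) \<theta>b0 ZD in auto)
  have u: "time_smooth D T u" and \<theta>: "time_smooth D T \<theta>"
    and uX: "\<And>t. t \<in> {0..T} \<Longrightarrow> u t \<in> X_vol D (scale_form (\<lambda>x. \<rho>b (x $ k) * \<theta>b (x $ k)) \<mu>)"
    using EP unfolding EP_principle_def by auto
  have \<theta>0: "\<theta> t x > 0" if t: "t \<in> {0..T}" and x: "x \<in> D" for t x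
  proof -
    obtain X where "X \<in> D" "x = \<phi> t X" using smooth_curve_surj[OF \<phi> t x] by blast
    then show ?thesis using e \<Theta>\<^sub>0 t unfolding eulerian_fields_def by simp
  qed
  define h where "h t x = 1/2 * (u t x \<bullet> u t x) - g * x $ k" for t x
  \<comment> \<open>\<open>m\<close> and \<open>n\<close> are the derivatives of (|U|^2 / 2 - g z) /
    q in U and in q, taken at \<open>u\<close> and \<open>\<theta>\<close>.\<close>
  define m where "m t x = (1 / \<theta> t x) *\<^sub>R u t x" for t x
  define n where "n t x = - (h t x / (\<theta> t x * \<theta> t x))" for t x
  have sk: "time_smooth D T (\<lambda>_ x. x $ k)"
    by (intro time_smooth_space smooth_on_ident[OF fD bounded_linear_vec_nth])
  have sh: "time_smooth D T h"
    unfolding h_def by (intro time_smooth_diff time_smooth_mult time_smooth_inner time_smooth_const u sk)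
  have sm: "time_smooth D T m"
    unfolding m_def by (intro time_smooth_scaleR time_smooth_divide time_smooth_const u \<theta>) (use \<theta>0 in force)
  have sn: "time_smooth D T n"
    unfolding n_def by (intro time_smooth_minus time_smooth_divide time_smooth_mult sh \<theta>) (use \<theta>0 in force)
  have comp: "compact ({0..T} \<times> D)" by (intro compact_Times compact_Icc smooth_domain_compact[OF D])
  have ann: "annihilator_family (ep_residual m n u \<theta>)"
  proof (rule EP_principle_annihilates[OF EP _ sm sn, where L = "\<lambda>U q x. 1 / q * (1/2 * (norm U)\<^sup>2 - g * x $ k)"])
    show "pseudo_incompressible_lagrangian D \<mu> k g \<rho>b \<theta>b U q =
        (LINT x:D|lborel. 1 / q x * (1/2 * (norm (U x))\<^sup>2 - g * x $ k) * (\<rho>b (x $ k) * \<theta>b (x $ k) * \<bar>\<mu> x (mat 1)\<bar>))" for U q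
      unfolding pseudo_incompressible_lagrangian_def form_integral_def scale_form_def abs_sgn[of "\<mu> _ _"]
      by (simp add: mult_ac)
    fix p :: "real \<Rightarrow> real^'n \<Rightarrow> real^'n" and q :: "real \<Rightarrow> real^'n \<Rightarrow> real"
    assume p: "time_smooth D T p" and q: "time_smooth D T q"
    have "{0..T} \<times> D \<noteq> {}" using smooth_domain_nonempty[OF D] T by auto
    from continuous_attains_inf[OF comp this time_smooth_continuous[OF \<theta>]]
    obtain t0 x0 where tx0: "t0 \<in> {0..T}" "x0 \<in> D" "\<forall>t\<in>{0..T}. \<forall>x\<in>D. \<theta> t0 x0 \<le> \<theta> t x" by auto
    have "bounded ((\<lambda>(t, x). q t x) ` ({0..T} \<times> D))"
      by (intro compact_imp_bounded compact_continuous_image time_smooth_continuous q comp)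
    then obtain B where B: "B > 0" "\<forall>y\<in>(\<lambda>(t, x). q t x) ` ({0..T} \<times> D). norm y \<le> B" unfolding bounded_pos by blast
    \<comment> \<open>With \<open>B\<close> bounding \<open>q\<close>, perturbations up to this size
      change \<open>\<theta>\<close> by at most half of its minimum over the compact cylinder, so
      the temperature stays positive.\<close>
    define a where "a = \<theta> t0 x0 / (2 * B)"
    have a: "a > 0" using \<theta>0[OF tx0(1,2)] B by (simp add: a_def)
    have pos: "\<theta> t x + r * q t x > 0" if r: "r \<in> {-a..a}" and t: "t \<in> {0..T}" and x: "x \<in> D" for r t x
    proof -
      have "\<bar>r * q t x\<bar> \<le> a * B" unfolding abs_mult using B(2) r t x a by (intro mult_mono) force+
      also have "\<dots> = \<theta> t0 x0 / 2" using B by (simp add: a_def)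
      finally show ?thesis using tx0(3) \<theta>0[OF tx0(1,2)] t x by (smt (verit) field_sum_of_halves)
    qed
    define L' where "L' r t x = ((u t x + r *\<^sub>R p t x) \<bullet> p t x * (\<theta> t x + r * q t x)
        - (1/2 * (norm (u t x + r *\<^sub>R p t x))\<^sup>2 - g * x $ k) * q t x) / ((\<theta> t x + r * q t x) * (\<theta> t x + r * q t x))"
      for r t x
    note cv = continuous_on_variation[of _ a]
    show "\<exists>a>0. \<exists>L'.
      continuous_on ({-a..a} \<times> {0..T} \<times> D) (\<lambda>(e, t, x). 1 / (\<theta> t x + e * q t x) * (1/2 * (norm (u t x + e *\<^sub>R p t x))\<^sup>2 - g * x $ k)) \<and>
      continuous_on ({-a..a} \<times> {0..T} \<times> D) (\<lambda>(e, t, x). L' e t x) \<and>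
      (\<forall>e\<in>{-a..a}. \<forall>t\<in>{0..T}. \<forall>x\<in>D.
        ((\<lambda>e. 1 / (\<theta> t x + e * q t x) * (1/2 * (norm (u t x + e *\<^sub>R p t x))\<^sup>2 - g * x $ k)) has_real_derivative L' e t x) (at e)) \<and>
      (\<forall>t\<in>{0..T}. \<forall>x\<in>D. L' 0 t x = m t x \<bullet> p t x + n t x * q t x)"
    proof (intro exI[of _ a] exI[of _ L'] conjI ballI a)
      show "continuous_on ({-a..a} \<times> {0..T} \<times> D)
          (\<lambda>(e, t, x). 1 / (\<theta> t x + e * q t x) * (1/2 * (norm (u t x + e *\<^sub>R p t x))\<^sup>2 - g * x $ k))"
        unfolding case_prod_unfold by (intro continuous_intros cv u p q \<theta> sk) (use pos in force)
      show "continuous_on ({-a..a} \<times> {0..T} \<times> D) (\<lambda>(e, t, x). L' e t x)"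
        unfolding case_prod_unfold L'_def by (intro continuous_intros cv u p q \<theta> sk) (use pos in force)
      fix r t x assume r: "r \<in> {-a..a}" and t: "t \<in> {0..T}" and x: "x \<in> D"
      have "((\<lambda>e. 1/2 * (norm (u t x + e *\<^sub>R p t x))\<^sup>2 - g * x $ k) has_real_derivative (u t x + r *\<^sub>R p t x) \<bullet> p t x) (at r)"
        unfolding power2_norm_eq_inner has_real_derivative_iff_has_vector_derivative has_vector_derivative_def
        by (auto intro!: derivative_eq_intros simp: fun_eq_iff inner_commute algebra_simps inner_add_left inner_add_right)
      moreover have "((\<lambda>e. \<theta> t x + e * q t x) has_real_derivative q t x) (at r)"
        by (auto intro!: derivative_eq_intros)
      moreover have "\<theta> t x + r * q t x \<noteq> 0" using pos[OF r t x] by simp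
      ultimately have "((\<lambda>e. (1/2 * (norm (u t x + e *\<^sub>R p t x))\<^sup>2 - g * x $ k) / (\<theta> t x + e * q t x)) has_real_derivative L' r t x) (at r)"
        unfolding L'_def by (rule DERIV_divide)
      then show "((\<lambda>e. 1 / (\<theta> t x + e * q t x) * (1/2 * (norm (u t x + e *\<^sub>R p t x))\<^sup>2 - g * x $ k)) has_real_derivative L' r t x) (at r)"
        by simp
    next
      fix t x assume t: "t \<in> {0..T}" and x: "x \<in> D"
      show "L' 0 t x = m t x \<bullet> p t x + n t x * q t x"
        using \<theta>0[OF t x] by (simp add: L'_def m_def n_def h_def power2_norm_eq_inner field_simps)
    qed
  qed
  define P where "P = potential (ep_residual m n u \<theta>)"
  have sP: "time_smooth D T P" unfolding P_def by (rule time_smooth_potential[OF ann])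
  \<comment> \<open>The gradient of \<open>P + h / \<theta>\<close> is minus the acceleration plus
    gravity, divided by \<open>\<theta>\<close>: the terms with the gradients of
    \<open>\<theta>\<close> and of the kinetic energy cancel. Subtracting \<open>\<pi>b\<close> adds
    the balance of the reference state, which turns gravity into buoyancy.\<close>
  define \<pi>' where "\<pi>' t x = (P t x + h t x / \<theta> t x) / c\<^sub>p - \<pi>b (x $ k)" for t x
  have "time_smooth D T \<pi>'"
    unfolding \<pi>'_def
    by (intro time_smooth_diff time_smooth_divide time_smooth_add time_smooth_const time_smooth_space height sP sh \<theta> \<pi>b)
      (use c \<theta>0 in force)+
  moreover have "time_deriv T u t x + frechet_derivative (u t) (at x within D) (u t x)
       + (c\<^sub>p * \<theta> t x) *\<^sub>R grad_within D (\<pi>' t) x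
       = (g * ((\<theta> t x - \<theta>b (x $ k)) / \<theta>b (x $ k))) *\<^sub>R axis k 1" if t: "t \<in> {0..T}" and x: "x \<in> D" for t x
  proof -
    define u' where "u' = frechet_derivative (u t) (at x within D)"
    define d\<theta> where "d\<theta> = grad_within D (\<theta> t) x"
    define d\<pi> where "d\<pi> = vector_derivative \<pi>b (at (x $ k) within Z)"
    define tr where "tr = (\<chi> i. u t x \<bullet> u' (axis i 1))"
    define acc where "acc = time_deriv T u t x + u' (u t x)"
    have pos: "\<theta> t x \<noteq> 0" using \<theta>0[OF t x] by simp
    have u': "(u t has_derivative u') (at x within D)"
      unfolding u'_def by (rule smooth_on_has_derivative[OF time_smooth_slice[OF u t] x])
    have \<theta>': "(\<theta> t has_derivative (\<lambda>v. d\<theta> \<bullet> v)) (at x within D)"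
      unfolding d\<theta>_def inner_grad_within[OF time_smooth_slice[OF \<theta> t] x]
      by (rule smooth_on_has_derivative[OF time_smooth_slice[OF \<theta> t] x])
    have P': "(P t has_derivative (\<lambda>v. ep_residual m n u \<theta> t x \<bullet> v)) (at x within D)"
      using potential(1)[OF ann t] x unfolding P_def has_gradient_on_def by blast
    have \<pi>b': "((\<lambda>y. \<pi>b (y $ k)) has_derivative (\<lambda>v. d\<pi> * v $ k)) (at x within D)"
      unfolding d\<pi>_def Z by (rule has_derivative_height[OF \<pi>b(1)[unfolded Z] x])
    have trv: "u t x \<bullet> u' v = tr \<bullet> v" for v
      unfolding tr_def inner_transpose_derivative[OF has_derivative_linear[OF u']] ..
    have h': "(h t has_derivative (\<lambda>v. (tr - g *\<^sub>R axis k 1) \<bullet> v)) (at x within D)"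
      unfolding h_def
      by (rule has_derivative_eq_rhs, (rule derivative_intros u' bounded_linear_imp_has_derivative bounded_linear_vec_nth)+)
        (simp add: fun_eq_iff trv inner_commute[of _ "u t x"] inner_diff_left inner_axis')
    have m_space: "frechet_derivative (m t) (at x within D) =
        (\<lambda>v. (1 / \<theta> t x) *\<^sub>R u' v + (- (d\<theta> \<bullet> v) / (\<theta> t x * \<theta> t x)) *\<^sub>R u t x)"
    proof (rule frechet_derivative_fat[OF fD x])
      have "((\<lambda>y. 1 / \<theta> t y) has_derivative (\<lambda>v. - (d\<theta> \<bullet> v) / (\<theta> t x * \<theta> t x))) (at x within D)"
        by (rule has_derivative_eq_rhs[OF has_derivative_divide'[OF has_derivative_const \<theta>' pos]]) simp
      from has_derivative_scaleR[OF this u']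
      show "(m t has_derivative (\<lambda>v. (1 / \<theta> t x) *\<^sub>R u' v + (- (d\<theta> \<bullet> v) / (\<theta> t x * \<theta> t x)) *\<^sub>R u t x)) (at x within D)"
        unfolding m_def .
    qed
    have m_time: "time_deriv T m t x = (1 / \<theta> t x) *\<^sub>R time_deriv T u t x + (- time_deriv T \<theta> t x / (\<theta> t x * \<theta> t x)) *\<^sub>R u t x"
    proof (rule time_deriv_eq[OF _ t])
      have "((\<lambda>s. \<theta> s x) has_real_derivative time_deriv T \<theta> t x) (at t within {0..T})"
        using time_deriv_frechet(1)[OF \<theta> t x] by (simp add: has_real_derivative_iff_has_vector_derivative)
      from DERIV_divide[OF DERIV_const this pos, of 1]
      have "((\<lambda>s. 1 / \<theta> s x) has_real_derivative - time_deriv T \<theta> t x / (\<theta> t x * \<theta> t x)) (at t within {0..T})" by simp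
      from has_vector_derivative_scaleR[OF this time_deriv_frechet(1)[OF u t x]]
      show "((\<lambda>s. m s x) has_vector_derivative
          (1 / \<theta> t x) *\<^sub>R time_deriv T u t x + (- time_deriv T \<theta> t x / (\<theta> t x * \<theta> t x)) *\<^sub>R u t x) (at t within {0..T})"
        unfolding m_def .
    qed
    \<comment> \<open>Advection makes the material derivative of 1/\<open>\<theta>\<close> vanish,
      so that of \<open>m\<close> is the acceleration divided by \<open>\<theta>\<close>.\<close>
    have adv: "time_deriv T \<theta> t x = - (d\<theta> \<bullet> u t x)"
      using eulerian_advection[OF \<phi> e \<theta> t x] by (simp add: d\<theta>_def inner_commute)
    have "(\<chi> i. m t x \<bullet> u' (axis i 1)) = (1 / \<theta> t x) *\<^sub>R tr"
      by (simp add: vec_eq_iff m_def tr_def)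
    then have res: "ep_residual m n u \<theta> t x =
        (h t x / (\<theta> t x * \<theta> t x)) *\<^sub>R d\<theta> - (1 / \<theta> t x) *\<^sub>R (acc + tr)"
      unfolding ep_residual_def m_space m_time adv u'_def[symmetric] d\<theta>_def[symmetric] n_def acc_def
      by (simp add: scaleR_add_right)
    define w where "w = (1 / c\<^sub>p) *\<^sub>R (- (1 / \<theta> t x) *\<^sub>R acc - (g / \<theta> t x) *\<^sub>R axis k 1) - d\<pi> *\<^sub>R axis k (1::real)"
    have "(\<pi>' t has_derivative (\<lambda>v. w \<bullet> v)) (at x within D)"
      unfolding \<pi>'_def
    proof (rule has_derivative_eq_rhs[OF has_derivative_diff[OF bounded_linear.has_derivative[OF bounded_linear_divide
            has_derivative_add[OF P' has_derivative_divide'[OF h' \<theta>' pos]]] \<pi>b']])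
      show "(\<lambda>v. (ep_residual m n u \<theta> t x \<bullet> v + ((tr - g *\<^sub>R axis k 1) \<bullet> v * \<theta> t x - h t x * (d\<theta> \<bullet> v)) / (\<theta> t x * \<theta> t x)) / c\<^sub>p - d\<pi> * v $ k) =
          (\<lambda>v. w \<bullet> v)"
        using pos c unfolding res w_def
        by (simp add: fun_eq_iff inner_add_left inner_diff_left inner_axis' field_simps)
    qed
    then have grad: "grad_within D (\<pi>' t) x = w" by (rule grad_within_eq[OF fD x])
    have "(c\<^sub>p * \<theta> t x) *\<^sub>R w = - acc - (g + c\<^sub>p * \<theta> t x * d\<pi>) *\<^sub>R axis k 1"
      using pos c unfolding w_def by (simp add: scaleR_diff_right scaleR_add_left)
    moreover have "g + c\<^sub>p * \<theta> t x * d\<pi> = - (g * ((\<theta> t x - \<theta>b (x $ k)) / \<theta>b (x $ k)))"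
    proof -
      have "c\<^sub>p * d\<pi> = - g / \<theta>b (x $ k)"
        using \<pi>b(2) ZD[OF x] \<theta>b0[OF x] unfolding d\<pi>_def by (simp add: field_simps)
      then have "g + c\<^sub>p * d\<pi> * \<theta> t x = g + - g / \<theta>b (x $ k) * \<theta> t x" by simp
      also have "\<dots> = - (g * ((\<theta> t x - \<theta>b (x $ k)) / \<theta>b (x $ k)))"
        using \<theta>b0[OF x] by (simp add: field_simps)
      finally show ?thesis by (simp add: mult_ac)
    qed
    ultimately show ?thesis unfolding grad u'_def[symmetric] acc_def by simp
  qed
  ultimately show ?thesis
    using X_vol_div(2)[OF uX] eulerian_advection[OF \<phi> e \<theta>] by blast
qed

theorem theorem3p5:
  fixes D :: "(real^'n) set" and \<mu> :: "'n top_form" and k :: 'n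
    and \<rho>b \<theta>b \<pi>b :: "real \<Rightarrow> real" and g c\<^sub>p T :: real
  defines "Z \<equiv> (\<lambda>x. x $ k) ` D"
  assumes dim: "CARD('n) = 2 \<or> CARD('n) = 3"
    and D: "smooth_domain D"
    and \<mu>: "volume_form D \<mu>"
    and \<rho>b: "smooth_on Z \<rho>b" "\<forall>z\<in>Z. \<rho>b z > 0"
    and \<theta>b: "smooth_on Z \<theta>b" "\<forall>z\<in>Z. \<theta>b z > 0"
    and consts_pos: "g > 0" "c\<^sub>p > 0" "T > 0"
    and \<pi>b: "smooth_on Z \<pi>b"
      "\<forall>z\<in>Z. c\<^sub>p * \<theta>b z * vector_derivative \<pi>b (at z within Z) = - g"
  shows
    "(\<forall>\<phi> \<Theta>\<^sub>0 u \<theta>.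
        smooth_curve_in_Diff_vol D (scale_form (\<lambda>x. \<rho>b (x $ k)) \<mu>) T \<phi> \<longrightarrow>
        smooth_on D \<Theta>\<^sub>0 \<longrightarrow>
        eulerian_fields D T \<phi> \<Theta>\<^sub>0 u \<theta> \<longrightarrow>
        EP_principle D (scale_form (\<lambda>x. \<rho>b (x $ k)) \<mu>) T
          (anelastic_lagrangian D \<mu> k c\<^sub>p \<rho>b \<pi>b) u \<theta> \<longrightarrow>
        (\<exists>\<pi>'. time_smooth D T \<pi>' \<and>
          (\<forall>t\<in>{0..T}. \<forall>x\<in>D.
             time_deriv T u t x + frechet_derivative (u t) (at x within D) (u t x)
               + grad_within D (\<lambda>y. c\<^sub>p * \<theta>b (y $ k) * \<pi>' t y) x
               = (g * ((\<theta> t x - \<theta>b (x $ k)) / \<theta>b (x $ k))) *\<^sub>R axis k 1 \<and>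
             divergence D \<mu> (\<lambda>y. \<rho>b (y $ k) *\<^sub>R u t y) x = 0 \<and>
             time_deriv T \<theta> t x + u t x \<bullet> grad_within D (\<theta> t) x = 0)))
     \<and>
     (\<forall>\<phi> \<Theta>\<^sub>0 u \<theta>.
        smooth_curve_in_Diff_vol D (scale_form (\<lambda>x. \<rho>b (x $ k) * \<theta>b (x $ k)) \<mu>) T \<phi> \<longrightarrow>
        smooth_on D \<Theta>\<^sub>0 \<longrightarrow> (\<forall>X\<in>D. \<Theta>\<^sub>0 X > 0) \<longrightarrow>
        eulerian_fields D T \<phi> \<Theta>\<^sub>0 u \<theta> \<longrightarrow>
        EP_principle D (scale_form (\<lambda>x. \<rho>b (x $ k) * \<theta>b (x $ k)) \<mu>) T
          (pseudo_incompressible_lagrangian D \<mu> k g \<rho>b \<theta>b) u \<theta> \<longrightarrow>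
        (\<exists>\<pi>'. time_smooth D T \<pi>' \<and>
          (\<forall>t\<in>{0..T}. \<forall>x\<in>D.
             time_deriv T u t x + frechet_derivative (u t) (at x within D) (u t x)
               + (c\<^sub>p * \<theta> t x) *\<^sub>R grad_within D (\<pi>' t) x
               = (g * ((\<theta> t x - \<theta>b (x $ k)) / \<theta>b (x $ k))) *\<^sub>R axis k 1 \<and>
             divergence D \<mu> (\<lambda>y. (\<rho>b (y $ k) * \<theta>b (y $ k)) *\<^sub>R u t y) x = 0 \<and>
             time_deriv T \<theta> t x + u t x \<bullet> grad_within D (\<theta> t) x = 0)))"
proof (intro conjI allI impI, goal_cases)
  note common = D consts_pos(3) \<mu> Z_def[THEN meta_eq_to_obj_eq] \<rho>b \<theta>b consts_pos(2) \<pi>b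
  case (1 \<phi> \<Theta>\<^sub>0 u \<theta>)
  from 1(1,3,4) show ?case by (rule anelastic_equations[OF common])
next
  note common = D consts_pos(3) \<mu> Z_def[THEN meta_eq_to_obj_eq] \<rho>b \<theta>b consts_pos(2) \<pi>b
  case (2 \<phi> \<Theta>\<^sub>0 u \<theta>)
  from 2(1,3,4,5) show ?case by (rule pseudo_incompressible_equations[OF common])
qed

end
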